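(* Let $X$ be a normal (irreducible) affine almost homogeneous variety over $\mathbb{K}$ and let $D$ be a prime divisor on $X$. Assume that there is a non-trivial regular action of a one-dimensional torus $\mathbb{G}_m$ on $X$ such that $D$ is fixed by $\mathbb{G}_m$ pointwise. Then the automorphism group $\mathrm{Aut}(X)$ acts on $X$ with an open orbit and this orbit intersects the divisor $D$.
   Context: $\mathbb{K}$ is an algebraically closed field of characteristic zero; all varieties are over $\mathbb{K}$ and are irreducible. $\mathbb{G}_m$ is the one-dimensional algebraic torus. $\mathrm{Aut}(X)$ is the group of automorphisms of the algebraic variety $X$. A prime divisor is an irreducible closed subvariety of codimension one. An algebraic variety $X$ is called almost homogeneous if there is a regular action $G\times X\to X$ of an algebraic group $G$ with an open orbit. *)

theory Defs
  imports
    "HOL-Analysis.Abstract_Topology"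
    "HOL-Algebra.Group_Action"
    "HOL-Computational_Algebra.Polynomial"
    "HOL-Library.Extended_Nat"
    "HOL-Library.FuncSet"
begin

section \<open>Spaces with functions\<close>

text \<open>
  Varieties over an algebraically closed field \<open>'k\<close> are treated classically, through their
  \<open>'k\<close>-points: a variety is a topological space with a sheaf of \<open>'k\<close>-valued functions that is
  locally isomorphic to an affine algebraic set. Regular functions are total HOL functions; the
  predicate \<open>regular X U f\<close> only concerns the values of \<open>f\<close> on the open set \<open>U\<close>.
\<close>

record ('a, 'k) fun_space =
  zariski :: "'a topology"
  regular :: "'a set \<Rightarrow> ('a \<Rightarrow> 'k) \<Rightarrow> bool"

abbreviation points :: "('a, 'k) fun_space \<Rightarrow> 'a set" where
  "points X \<equiv> topspace (zariski X)"

text \<open>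
  Being regular is a local property. The function \<open>g\<close> on the neighbourhood \<open>V\<close> is allowed to
  differ from \<open>f\<close> outside \<open>V\<close>, so the second conjunct includes independence of the values
  outside \<open>U\<close>; the third conjunct is restriction.
\<close>

definition function_sheaf :: "('a, 'k) fun_space \<Rightarrow> bool" where
  "function_sheaf X \<longleftrightarrow>
     (\<forall>U f. regular X U f \<longrightarrow> openin (zariski X) U) \<and>
     (\<forall>U f. openin (zariski X) U \<and>
        (\<forall>x\<in>U. \<exists>V g. x \<in> V \<and> V \<subseteq> U \<and> regular X V g \<and> (\<forall>y\<in>V. f y = g y))
        \<longrightarrow> regular X U f) \<and>
     (\<forall>U V f. regular X U f \<and> openin (zariski X) V \<and> V \<subseteq> U \<longrightarrow> regular X V f)"

definition morphism :: "('a, 'k) fun_space \<Rightarrow> ('b, 'k) fun_space \<Rightarrow> ('a \<Rightarrow> 'b) \<Rightarrow> bool" where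
  "morphism X Y \<phi> \<longleftrightarrow>
     continuous_map (zariski X) (zariski Y) \<phi> \<and>
     (\<forall>V f. regular Y V f \<longrightarrow> regular X {x \<in> points X. \<phi> x \<in> V} (f \<circ> \<phi>))"

definition isomorphism :: "('a, 'k) fun_space \<Rightarrow> ('b, 'k) fun_space \<Rightarrow> ('a \<Rightarrow> 'b) \<Rightarrow> bool" where
  "isomorphism X Y \<phi> \<longleftrightarrow>
     morphism X Y \<phi> \<and>
     (\<exists>\<psi>. morphism Y X \<psi> \<and> (\<forall>x\<in>points X. \<psi> (\<phi> x) = x) \<and> (\<forall>y\<in>points Y. \<phi> (\<psi> y) = y))"

definition open_subspace :: "('a, 'k) fun_space \<Rightarrow> 'a set \<Rightarrow> ('a, 'k) fun_space" where
  "open_subspace X U =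
     \<lparr>zariski = subtopology (zariski X) U, regular = (\<lambda>W f. W \<subseteq> U \<and> regular X W f)\<rparr>"

text \<open>
  The space of local fractions of a family \<open>B\<close>, where \<open>B U\<close> is a set of functions on \<open>U\<close>: its
  topology is generated by the sets \<open>{x \<in> U. b x \<noteq> 0}\<close> with \<open>b \<in> B U\<close>, and a function is regular
  if it is locally a quotient \<open>a / b\<close> with \<open>a\<close> and \<open>b\<close> in a common \<open>B U\<close>.
\<close>

definition fraction_topology :: "('a set \<Rightarrow> ('a \<Rightarrow> 'k::field) set) \<Rightarrow> 'a topology" where
  "fraction_topology B = topology_generated_by {{x \<in> U. b x \<noteq> 0} |U b. b \<in> B U}"

definition fraction_space :: "('a set \<Rightarrow> ('a \<Rightarrow> 'k::field) set) \<Rightarrow> ('a, 'k) fun_space" where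
  "fraction_space B =
     \<lparr>zariski = fraction_topology B,
      regular = (\<lambda>W f. openin (fraction_topology B) W \<and>
        (\<forall>x\<in>W. \<exists>U N a b. a \<in> B U \<and> b \<in> B U \<and> openin (fraction_topology B) N \<and>
           x \<in> N \<and> N \<subseteq> U \<inter> W \<and> (\<forall>y\<in>N. b y \<noteq> 0 \<and> f y = a y / b y)))\<rparr>"


section \<open>Varieties\<close>

text \<open>The points of affine \<open>n\<close>-space are the functions in \<open>{..<n} \<rightarrow>\<^sub>E UNIV\<close>.\<close>

inductive_set polynomial_functions :: "nat \<Rightarrow> ((nat \<Rightarrow> 'k::field) \<Rightarrow> 'k) set" for n :: nat where
  const: "(\<lambda>x. c) \<in> polynomial_functions n"
| coord: "i < n \<Longrightarrow> (\<lambda>x. x i) \<in> polynomial_functions n"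
| add: "\<lbrakk>p \<in> polynomial_functions n; q \<in> polynomial_functions n\<rbrakk>
    \<Longrightarrow> (\<lambda>x. p x + q x) \<in> polynomial_functions n"
| mult: "\<lbrakk>p \<in> polynomial_functions n; q \<in> polynomial_functions n\<rbrakk>
    \<Longrightarrow> (\<lambda>x. p x * q x) \<in> polynomial_functions n"

definition zero_locus :: "nat \<Rightarrow> ((nat \<Rightarrow> 'k::field) \<Rightarrow> 'k) set \<Rightarrow> (nat \<Rightarrow> 'k) set" where
  "zero_locus n P = {x \<in> {..<n} \<rightarrow>\<^sub>E UNIV. \<forall>p\<in>P. p x = 0}"

definition affine_set_space ::
  "nat \<Rightarrow> ((nat \<Rightarrow> 'k::field) \<Rightarrow> 'k) set \<Rightarrow> (nat \<Rightarrow> 'k, 'k) fun_space" where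
  "affine_set_space n P =
     fraction_space (\<lambda>U. if U = zero_locus n P then polynomial_functions n else {})"

definition affine_variety :: "('a, 'k::field) fun_space \<Rightarrow> bool" where
  "affine_variety X \<longleftrightarrow>
     function_sheaf X \<and>
     (\<exists>n P \<phi>. P \<subseteq> polynomial_functions n \<and> isomorphism X (affine_set_space n P) \<phi>)"

text \<open>
  On \<open>U \<times> V\<close>, with \<open>U\<close> and \<open>V\<close> open, the functions used to form fractions are the finite sums
  of products of regular functions on \<open>U\<close> and on \<open>V\<close>. For varieties this is the categorical
  product; its topology is in general strictly finer than the product topology.
\<close>

definition product_space ::
  "('a, 'k::field) fun_space \<Rightarrow> ('b, 'k) fun_space \<Rightarrow> ('a \<times> 'b, 'k) fun_space" where
  "product_space X Y = fraction_space (\<lambda>W.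
     {h. \<exists>U V n f g. W = U \<times> V \<and> openin (zariski X) U \<and> openin (zariski Y) V \<and>
         (\<forall>i<n. regular X U (f i) \<and> regular Y V (g i)) \<and>
         h = (\<lambda>(x, y). \<Sum>i<(n::nat). f i x * g i y)})"

text \<open>Varieties are not required to be irreducible here; irreducibility is a separate predicate.\<close>

definition variety :: "('a, 'k::field) fun_space \<Rightarrow> bool" where
  "variety X \<longleftrightarrow>
     function_sheaf X \<and>
     (\<exists>\<U>. finite \<U> \<and> \<Union>\<U> = points X \<and>
        (\<forall>U\<in>\<U>. openin (zariski X) U \<and> affine_variety (open_subspace X U))) \<and>
     closedin (zariski (product_space X X)) {(x, x) |x. x \<in> points X}"

definition irreducible_in :: "'a topology \<Rightarrow> 'a set \<Rightarrow> bool" where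
  "irreducible_in T Z \<longleftrightarrow>
     Z \<subseteq> topspace T \<and> Z \<noteq> {} \<and>
     (\<forall>A B. closedin T A \<and> closedin T B \<and> Z \<subseteq> A \<union> B \<longrightarrow> Z \<subseteq> A \<or> Z \<subseteq> B)"

abbreviation irreducible_space :: "('a, 'k) fun_space \<Rightarrow> bool" where
  "irreducible_space X \<equiv> irreducible_in (zariski X) (points X)"

definition codimension :: "'a topology \<Rightarrow> 'a set \<Rightarrow> enat" where
  "codimension T Z =
     Sup {enat n |n. \<exists>C :: nat \<Rightarrow> 'a set. C 0 = Z \<and>
        (\<forall>i\<le>n. closedin T (C i) \<and> irreducible_in T (C i)) \<and> (\<forall>i<n. C i \<subset> C (Suc i))}"

definition prime_divisor :: "('a, 'k) fun_space \<Rightarrow> 'a set \<Rightarrow> bool" where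
  "prime_divisor X D \<longleftrightarrow>
     closedin (zariski X) D \<and> irreducible_in (zariski X) D \<and> codimension (zariski X) D = 1"

text \<open>
  Normality of an irreducible variety: every local ring is integrally closed in the function field.
  An element of the function field is represented by a regular function \<open>f\<close> on a nonempty open
  set \<open>U\<close>, an element of the local ring at \<open>x\<close> by a regular function on a neighbourhood of \<open>x\<close>.
  Two such functions represent the same element if they agree on the intersection of their
  domains, which is nonempty, hence dense, by irreducibility.
\<close>

definition integral_at ::
  "('a, 'k::field) fun_space \<Rightarrow> 'a \<Rightarrow> 'a set \<Rightarrow> ('a \<Rightarrow> 'k) \<Rightarrow> bool" where
  "integral_at X x U f \<longleftrightarrow>
     (\<exists>V (n::nat) a. openin (zariski X) V \<and> x \<in> V \<and> (\<forall>i<n. regular X V (a i)) \<and>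
        (\<forall>y\<in>U \<inter> V. f y ^ n + (\<Sum>i<n. a i y * f y ^ i) = 0))"

definition normal_space :: "('a, 'k::field) fun_space \<Rightarrow> bool" where
  "normal_space X \<longleftrightarrow>
     (\<forall>x\<in>points X. \<forall>U f. U \<noteq> {} \<and> regular X U f \<and> integral_at X x U f \<longrightarrow>
        (\<exists>W g. x \<in> W \<and> regular X W g \<and> (\<forall>y\<in>U \<inter> W. g y = f y)))"


section \<open>Algebraic groups and actions\<close>

text \<open>
  An algebraic group is an abstract group together with a variety structure on its carrier. It is
  required neither to be affine nor to be connected.
\<close>

definition algebraic_group :: "'g monoid \<Rightarrow> ('g, 'k::field) fun_space \<Rightarrow> bool" where
  "algebraic_group G S \<longleftrightarrow>
     group G \<and> variety S \<and> points S = carrier G \<and>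
     morphism (product_space S S) S (\<lambda>(g, h). g \<otimes>\<^bsub>G\<^esub> h) \<and>
     morphism S S (\<lambda>g. inv\<^bsub>G\<^esub> g)"

definition regular_action ::
  "'g monoid \<Rightarrow> ('g, 'k::field) fun_space \<Rightarrow> ('a, 'k) fun_space \<Rightarrow> ('g \<Rightarrow> 'a \<Rightarrow> 'a) \<Rightarrow> bool" where
  "regular_action G S X \<phi> \<longleftrightarrow>
     group_action G (points X) \<phi> \<and> morphism (product_space S X) X (\<lambda>(g, x). \<phi> g x)"

definition has_open_orbit ::
  "('g, 'm) monoid_scheme \<Rightarrow> ('a, 'k) fun_space \<Rightarrow> ('g \<Rightarrow> 'a \<Rightarrow> 'a) \<Rightarrow> bool" where
  "has_open_orbit G X \<phi> \<longleftrightarrow> (\<exists>\<Omega>\<in>orbits G (points X) \<phi>. openin (zariski X) \<Omega>)"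

text \<open>
  HOL cannot quantify existentially over types, so the type \<open>'g\<close> carrying the group is a parameter.
  A statement with this predicate as a hypothesis and \<open>'g\<close> arbitrary covers all algebraic groups.
\<close>

definition almost_homogeneous :: "'g itself \<Rightarrow> ('a, 'k::field) fun_space \<Rightarrow> bool" where
  "almost_homogeneous T X \<longleftrightarrow>
     (\<exists>(G :: 'g monoid) S \<phi>.
        algebraic_group G S \<and> regular_action G S X \<phi> \<and> has_open_orbit G X \<phi>)"

definition Gm_group :: "'k::field monoid" where
  "Gm_group = \<lparr>carrier = - {0}, monoid.mult = (*), one = 1\<rparr>"

definition Gm_space :: "('k::field, 'k) fun_space" where
  "Gm_space = fraction_space (\<lambda>U. if U = - {0} then range poly else {})"

text \<open>As in \<^const>\<open>BijGroup\<close>, automorphisms are normalised to be extensional.\<close>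

definition automorphism_group :: "('a, 'k) fun_space \<Rightarrow> ('a \<Rightarrow> 'a) monoid" where
  "automorphism_group X =
     BijGroup (points X) \<lparr>carrier := {\<phi> \<in> Bij (points X). isomorphism X X \<phi>}\<rparr>"

end

theory Submission
  imports Defs "HOL-Library.Function_Algebras"
begin

text \<open>
  Let \<open>A\<close> be the ring of global functions on \<open>X\<close>. The torus grades \<open>A\<close> by weights. A function of
  nonzero weight vanishes on \<open>D\<close>, because \<open>D\<close> is fixed pointwise. The local ring of \<open>X\<close> at \<open>D\<close> is a
  discrete valuation ring, as \<open>X\<close> is normal and \<open>D\<close> has codimension one; a uniformizer can be found
  among the weight components of any given one (\<open>homogeneous_uniformizer_exists\<close>). So there is a
  homogeneous \<open>u\<close>, of weight \<open>i\<close> say, such that every nonzero \<open>g\<close> in \<open>A\<close> is \<open>u ^ m\<close> times a fraction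
  \<open>a / b\<close> of functions that do not vanish identically on \<open>D\<close>. If \<open>g\<close> is homogeneous of weight \<open>j\<close>,
  comparing weights in \<open>b * g = u ^ m * a\<close> shows that \<open>a\<close> and \<open>b\<close> may be taken invariant and that
  \<open>j = m * i\<close> (\<open>weight_value\<close>). As the action is not trivial, \<open>i \<noteq> 0\<close>. Thus, up to denominators
  \<open>f\<close> that are invariant and nonzero on \<open>D\<close>, all functions are polynomials in \<open>u\<close> with invariant
  coefficients: over a dense open part of \<open>D\<close>, \<open>X\<close> looks like a line bundle with fibre coordinate \<open>u\<close>, zero
  section \<open>D\<close>, and the torus acting by scaling the fibres.

  On such a bundle one can translate along the fibres. The automorphism \<open>shift s\<close> replaces \<open>u\<close> by
  \<open>u + s * f\<close>, where the factor \<open>f\<close> clears the denominators of the coordinate functions. No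
  derivation has to be exponentiated to see that this is well defined: at a generic point \<open>x\<close> it moves
  \<open>x\<close> within its torus orbit, namely to \<open>\<psi> t x\<close> with \<open>t powi i = (u x + s * f x) / u x\<close>, so that all
  equations of \<open>X\<close> hold generically and hence everywhere. The choice \<open>s = - u x / f x\<close> moves \<open>x\<close> to a
  point with \<open>u = 0\<close>, and this point lies on \<open>D\<close> (\<open>shift_into_divisor\<close>). Hence all points of a
  nonempty open set can be moved into \<open>D\<close> by automorphisms. This open set meets the open orbit of the
  given algebraic group, which acts by automorphisms; so the orbit of \<open>Aut(X)\<close> that contains it is open
  and meets \<open>D\<close>.

  The algebra behind the discrete valuation ring is developed for subrings of a commutative ring, to be
  applied to rings of functions: the Hilbert basis theorem, the Nullstellensatz for prime ideals (used
  to translate codimension one into height one), and the existence of a uniformizer at a height one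
  prime of a Noetherian domain that is integrally closed there (\<open>normal_height_one_uniformizer\<close>).
\<close>

section \<open>Noetherian rings of functions\<close>

text \<open>
  Rings are subsets of a commutative ring type, so that the polynomial rings in any number of variables,
  as sets of functions, live in one type.
\<close>

definition ring_set :: "'r::comm_ring_1 set \<Rightarrow> bool" where
  "ring_set R \<longleftrightarrow> 1 \<in> R \<and> (\<forall>a\<in>R. \<forall>b\<in>R. a - b \<in> R \<and> a * b \<in> R)"

definition ideal_in :: "'r::comm_ring_1 set \<Rightarrow> 'r set \<Rightarrow> bool" where
  "ideal_in R J \<longleftrightarrow> J \<subseteq> R \<and> 0 \<in> J \<and> (\<forall>a\<in>J. \<forall>b\<in>J. a + b \<in> J) \<and> (\<forall>r\<in>R. \<forall>a\<in>J. r * a \<in> J)"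

definition prime_ideal_in :: "'r::comm_ring_1 set \<Rightarrow> 'r set \<Rightarrow> bool" where
  "prime_ideal_in R q \<longleftrightarrow> ideal_in R q \<and> 1 \<notin> q \<and> (\<forall>a\<in>R. \<forall>b\<in>R. a * b \<in> q \<longrightarrow> a \<in> q \<or> b \<in> q)"

definition noetherian :: "'r::comm_ring_1 set \<Rightarrow> bool" where
  "noetherian R \<longleftrightarrow>
     (\<forall>J. (\<forall>k. ideal_in R (J k)) \<and> (\<forall>k. J k \<subseteq> J (Suc k)) \<longrightarrow> (\<exists>K. \<forall>k\<ge>K. J k = J K))"

text \<open>
  The ring \<open>R[y]\<close>; \<open>y\<close> may be algebraic over \<open>R\<close>.
\<close>

definition adjoin :: "'r::comm_ring_1 set \<Rightarrow> 'r \<Rightarrow> 'r set" where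
  "adjoin R y = {poly p y |p. \<forall>i. coeff p i \<in> R}"

lemma ring_setD:
  assumes "ring_set R"
  shows "1 \<in> R" "0 \<in> R" "a \<in> R \<Longrightarrow> b \<in> R \<Longrightarrow> a - b \<in> R" "a \<in> R \<Longrightarrow> b \<in> R \<Longrightarrow> a * b \<in> R"
    "a \<in> R \<Longrightarrow> - a \<in> R" "a \<in> R \<Longrightarrow> b \<in> R \<Longrightarrow> a + b \<in> R"
proof -
  have d: "a - b \<in> R" if "a \<in> R" "b \<in> R" for a b using assms that by (auto simp: ring_set_def)
  show one: "1 \<in> R" using assms by (auto simp: ring_set_def)
  show z: "0 \<in> R" using d[OF one one] by simp
  have m: "- a \<in> R" if "a \<in> R" for a using d[OF z that] by simp
  show "a \<in> R \<Longrightarrow> - a \<in> R" by (rule m)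
  show "a \<in> R \<Longrightarrow> b \<in> R \<Longrightarrow> a - b \<in> R" by (rule d)
  show "a + b \<in> R" if "a \<in> R" "b \<in> R" using d[OF that(1) m[OF that(2)]] by simp
  show "a \<in> R \<Longrightarrow> b \<in> R \<Longrightarrow> a * b \<in> R" using assms by (auto simp: ring_set_def)
qed

lemma ring_set_sum: "ring_set R \<Longrightarrow> (\<And>i. i \<in> I \<Longrightarrow> f i \<in> R) \<Longrightarrow> sum f I \<in> R"
  by (induction I rule: infinite_finite_induct) (auto intro: ring_setD)

lemma ring_set_power: "ring_set R \<Longrightarrow> a \<in> R \<Longrightarrow> a ^ n \<in> R"
  by (induction n) (auto intro: ring_setD)

lemma ideal_inD:
  assumes "ideal_in R J"
  shows "a \<in> J \<Longrightarrow> a \<in> R" "0 \<in> J" "a \<in> J \<Longrightarrow> b \<in> J \<Longrightarrow> a + b \<in> J"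
    "r \<in> R \<Longrightarrow> a \<in> J \<Longrightarrow> r * a \<in> J" "r \<in> R \<Longrightarrow> a \<in> J \<Longrightarrow> a * r \<in> J"
  using assms by (auto simp: ideal_in_def mult.commute)

lemma ideal_in_diff:
  assumes "ring_set R" "ideal_in R J" "a \<in> J" "b \<in> J"
  shows "a - b \<in> J"
proof -
  have "- 1 * b \<in> J" using assms by (intro ideal_inD(4)[OF assms(2)] ring_setD(5)[OF assms(1)] ring_setD(1)[OF assms(1)])
  then show ?thesis using ideal_inD(3)[OF assms(2,3)] by fastforce
qed

lemma ideal_in_sum: "ideal_in R J \<Longrightarrow> (\<And>i. i \<in> I \<Longrightarrow> f i \<in> J) \<Longrightarrow> sum f I \<in> J"
  by (induction I rule: infinite_finite_induct) (auto intro: ideal_inD)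

lemma prime_ideal_inD:
  assumes "prime_ideal_in R q"
  shows "ideal_in R q" "1 \<notin> q" "a \<in> R \<Longrightarrow> b \<in> R \<Longrightarrow> a * b \<in> q \<Longrightarrow> a \<notin> q \<Longrightarrow> b \<in> q"
    "a \<in> R \<Longrightarrow> b \<in> R \<Longrightarrow> a \<notin> q \<Longrightarrow> b \<notin> q \<Longrightarrow> a * b \<notin> q"
  using assms by (auto simp: prime_ideal_in_def)

lemma prime_ideal_power: "prime_ideal_in R q \<Longrightarrow> ring_set R \<Longrightarrow> a \<in> R \<Longrightarrow> a \<notin> q \<Longrightarrow> a ^ n \<notin> q"
  by (induction n) (auto intro: prime_ideal_inD ring_set_power dest: prime_ideal_inD(2,4))

lemma noetherianD:
  assumes "noetherian R" "\<And>k. ideal_in R (J k)" "\<And>k. J k \<subseteq> J (Suc k)"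
  shows "\<exists>K. \<forall>k\<ge>K. J k = J K"
  using assms unfolding noetherian_def by blast

text \<open>
  The maximal condition, from the ascending chain condition by dependent choice.
\<close>

lemma noetherian_maximal:
  assumes "noetherian R" "\<And>J. J \<in> \<C> \<Longrightarrow> ideal_in R J" "\<C> \<noteq> {}"
  obtains M where "M \<in> \<C>" "\<And>J. J \<in> \<C> \<Longrightarrow> M \<subseteq> J \<Longrightarrow> J = M"
proof (rule ccontr)
  assume "\<not> thesis"
  then have "\<forall>M\<in>\<C>. \<exists>J\<in>\<C>. M \<subset> J" using that by blast
  then obtain s where s: "\<And>M. M \<in> \<C> \<Longrightarrow> s M \<in> \<C> \<and> M \<subset> s M" by metis
  obtain M0 where M0: "M0 \<in> \<C>" using assms(3) by blast
  define J where "J k = (s ^^ k) M0" for k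
  have J: "J k \<in> \<C>" for k by (induction k) (auto simp: J_def M0 s)
  have "J k \<subset> J (Suc k)" for k using s[OF J[of k]] by (simp add: J_def)
  moreover from this obtain K where "\<forall>k\<ge>K. J k = J K"
    using noetherianD[OF assms(1), of J] assms(2) J by (meson psubset_imp_subset)
  ultimately show False by (metis le_SucI order_refl psubset_eq)
qed

lemma adjoin_ring_set:
  assumes R: "ring_set R"
  shows "ring_set (adjoin R y)" "R \<subseteq> adjoin R y" "y \<in> adjoin R y"
proof -
  have "1 \<in> adjoin R y"
    unfolding adjoin_def by (rule CollectI, rule exI[of _ "[:1:]"])
      (auto simp: ring_setD[OF R] coeff_pCons split: nat.split)
  moreover have "poly p y - poly q y \<in> adjoin R y" "poly p y * poly q y \<in> adjoin R y"
    if "\<forall>i. coeff p i \<in> R" "\<forall>i. coeff q i \<in> R" for p q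
  proof -
    show "poly p y - poly q y \<in> adjoin R y" unfolding adjoin_def using that
      by (intro CollectI exI[of _ "p - q"]) (auto simp: ring_setD[OF R])
    show "poly p y * poly q y \<in> adjoin R y" unfolding adjoin_def using that
      by (intro CollectI exI[of _ "p * q"])
        (auto simp: coeff_mult intro!: ring_setD[OF R] ring_set_sum[OF R])
  qed
  ultimately show "ring_set (adjoin R y)" unfolding ring_set_def by (auto simp: adjoin_def)
  show "R \<subseteq> adjoin R y"
  proof
    fix a assume "a \<in> R"
    then show "a \<in> adjoin R y" unfolding adjoin_def
      by (intro CollectI exI[of _ "[:a:]"]) (auto simp: coeff_pCons ring_setD[OF R] split: nat.split)
  qed
  show "y \<in> adjoin R y" unfolding adjoin_def
    by (intro CollectI exI[of _ "[:0,1:]"]) (auto simp: coeff_pCons ring_setD[OF R] split: nat.split)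
qed

text \<open>
  Hilbert's argument: an ideal of \<open>R[y]\<close> is determined by the ideals of its leading coefficients in
  the various degrees, and these form a family that increases in the chain index and in the degree.
  The diagonal of the family and finitely many of its rows stabilize, hence all of it does.
\<close>

lemma hilbert_basis:
  assumes R: "ring_set R" and N: "noetherian R"
  shows "noetherian (adjoin R y)"
  unfolding noetherian_def
proof (intro allI impI, elim conjE)
  fix J :: "nat \<Rightarrow> 'a set"
  assume J: "\<forall>k. ideal_in (adjoin R y) (J k)" and inc: "\<forall>k. J k \<subseteq> J (Suc k)"
  note A = adjoin_ring_set[OF R, of y]
  note JD = ideal_inD[OF J[rule_format]]
  have mono: "J k \<subseteq> J l" if "k \<le> l" for k l using inc that by (rule_tac lift_Suc_mono_le) auto
  \<comment> \<open>The ideal of coefficients of \<open>y ^ d\<close> of elements of \<open>J k\<close> of degree at most \<open>d\<close>.\<close>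
  define L where "L k d = {c\<in>R. \<exists>p. (\<forall>i. coeff p i \<in> R) \<and> degree p \<le> d \<and> coeff p d = c \<and> poly p y \<in> J k}" for k d
  have L_ideal: "ideal_in R (L k d)" for k d
    unfolding ideal_in_def
  proof (intro conjI ballI)
    show "L k d \<subseteq> R" by (auto simp: L_def)
    show "0 \<in> L k d" unfolding L_def
      by (intro CollectI conjI exI[of _ 0]) (auto simp: ring_setD[OF R] JD)
    show "a + b \<in> L k d" if ab: "a \<in> L k d" "b \<in> L k d" for a b
    proof -
      from ab obtain p q where "\<forall>i. coeff p i \<in> R" "degree p \<le> d" "coeff p d = a" "poly p y \<in> J k"
        "\<forall>i. coeff q i \<in> R" "degree q \<le> d" "coeff q d = b" "poly q y \<in> J k" by (auto simp: L_def)
      then show ?thesis unfolding L_def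
        by (intro CollectI conjI exI[of _ "p + q"])
          (auto simp: ring_setD[OF R] JD degree_add_le)
    qed
    show "r * a \<in> L k d" if r: "r \<in> R" "a \<in> L k d" for r a
    proof -
      from r obtain p where "\<forall>i. coeff p i \<in> R" "degree p \<le> d" "coeff p d = a" "poly p y \<in> J k"
        by (auto simp: L_def)
      then show ?thesis unfolding L_def using r A(2)
        by (intro CollectI conjI exI[of _ "smult r p"])
          (auto simp: ring_setD[OF R] intro: JD order_trans[OF degree_smult_le])
    qed
  qed
  have L1: "L k d \<subseteq> L l d" if "k \<le> l" for k l d using mono[OF that] by (auto simp: L_def)
  have L2': "L k d \<subseteq> L k (Suc d)" for k d
  proof
    fix a assume "a \<in> L k d"
    then obtain p where p: "a \<in> R" "\<forall>i. coeff p i \<in> R" "degree p \<le> d" "coeff p d = a" "poly p y \<in> J k"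
      by (auto simp: L_def)
    then show "a \<in> L k (Suc d)" unfolding L_def using A(3)
      by (intro CollectI conjI exI[of _ "pCons 0 p"])
        (auto simp: ring_setD[OF R] coeff_pCons degree_pCons_eq_if intro: JD split: nat.split)
  qed
  have L2: "L k d \<subseteq> L k e" if "d \<le> e" for k d e using L2' that by (rule_tac lift_Suc_mono_le) auto
  have "L k k \<subseteq> L (Suc k) (Suc k)" for k by (rule order_trans[OF L1 L2]) auto
  then have "\<exists>K. \<forall>k\<ge>K. L k k = L K K" by (rule noetherianD[OF N L_ideal])
  then obtain K0 where K0: "\<And>k. k \<ge> K0 \<Longrightarrow> L k k = L K0 K0" by blast
  have "\<exists>K. \<forall>k\<ge>K. L k d = L K d" for d by (rule noetherianD[OF N L_ideal L1]) simp
  then obtain Kd where Kd: "\<And>d k. k \<ge> Kd d \<Longrightarrow> L k d = L (Kd d) d" by metis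
  define K where "K = Max (insert K0 (Kd ` {..<K0}))"
  have K: "K0 \<le> K" "d < K0 \<Longrightarrow> Kd d \<le> K" for d by (auto simp: K_def)
  \<comment> \<open>Beyond the diagonal index the whole quadrant is constant, since it is squeezed between diagonal terms.\<close>
  have big: "L k d = L K0 K0" if "k \<ge> K0" "d \<ge> K0" for k d
  proof
    show "L K0 K0 \<subseteq> L k d" using L1[of K0 k] L2[of K0 d] that by blast
    have "L k d \<subseteq> L (max k d) (max k d)" using L1[of k "max k d"] L2[of d "max k d"] by fastforce
    then show "L k d \<subseteq> L K0 K0" using K0[of "max k d"] that by auto
  qed
  have LK: "L k d = L K d" if "k \<ge> K" for k d
  proof (cases "d < K0")
    case True
    show ?thesis
      by (rule trans[OF Kd[OF order_trans[OF K(2)[OF True] that]] Kd[OF K(2)[OF True], symmetric]])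
  next
    case False then show ?thesis using big[of k d] big[of K d] K that by auto
  qed
  \<comment> \<open>Subtracting an element of \<open>J K\<close> with the same leading coefficient lowers the degree.\<close>
  have descend: "poly p y \<in> J K" if "k \<ge> K" "\<forall>i. coeff p i \<in> R" "poly p y \<in> J k" "degree p < d" for k p d
    using that
  proof (induction d arbitrary: p)
    case (Suc d)
    from Suc.prems have "coeff p d \<in> L k d" by (auto simp: L_def)
    then have "coeff p d \<in> L K d" using LK[OF Suc.prems(1), of d] by simp
    then obtain q where q: "\<forall>i. coeff q i \<in> R" "degree q \<le> d" "coeff q d = coeff p d" "poly q y \<in> J K"
      by (auto simp: L_def)
    have "poly (p - q) y \<in> J K"
    proof (cases "p - q = 0")
      case True then show ?thesis using JD(2) by (simp only: poly_0)
    next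
      case False
      have "coeff (p - q) d = 0" "degree (p - q) \<le> d" using q Suc.prems by (auto intro: degree_diff_le)
      then have d: "degree (p - q) < d" using False by (metis le_neq_implies_less leading_coeff_0_iff)
      have "poly q y \<in> J k" using q mono[OF Suc.prems(1)] by blast
      then have "poly (p - q) y \<in> J k"
        using ideal_in_diff[OF A(1) J[rule_format] Suc.prems(3)] by simp
      moreover have "\<forall>i. coeff (p - q) i \<in> R" using q(1) Suc.prems(2) by (auto simp: ring_setD[OF R])
      ultimately show ?thesis using Suc.IH[OF Suc.prems(1) _ _ d] by blast
    qed
    then show ?case using JD(3)[OF _ q(4), of "poly (p - q) y"] by simp
  qed simp
  have "J k \<subseteq> J K" if "k \<ge> K" for k
  proof -
    have "f \<in> J K" if f: "f \<in> J k" for f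
    proof -
      obtain p where "f = poly p y" "\<forall>i. coeff p i \<in> R" using JD(1)[OF f] by (auto simp: adjoin_def)
      then show ?thesis using descend[OF \<open>k \<ge> K\<close>, of p "Suc (degree p)"] f by simp
    qed
    then show ?thesis by blast
  qed
  then show "\<exists>K. \<forall>k\<ge>K. J k = J K"
    using mono[of K] by (meson subset_antisym)
qed

section \<open>The Nullstellensatz for prime ideals\<close>

text \<open>
  Division by a polynomial whose leading coefficient need not be a unit. The formula for
  \<open>coeff s k\<close> says that the quotient keeps its leading coefficient up to a power of that of \<open>P\<close>.
\<close>

lemma pseudo_division:
  assumes R: "ring_set R" and P: "\<forall>i. coeff P i \<in> R" "degree P \<le> m"
    and "\<forall>i. coeff f i \<in> R" "degree f \<le> m + k"
  shows "\<exists>s r. (\<forall>i. coeff s i \<in> R) \<and> (\<forall>i. coeff r i \<in> R) \<and>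
    smult (coeff P m ^ Suc k) f = P * s + r \<and> (\<forall>i\<ge>m. coeff r i = 0) \<and>
    degree s \<le> k \<and> coeff s k = coeff P m ^ k * coeff f (m + k)"
  using assms(4,5)
proof (induction k arbitrary: f)
  case 0
  define r where "r = smult (coeff P m) f - smult (coeff f m) P"
  have "coeff r i = 0" if "i \<ge> m" for i
  proof (cases "i = m")
    case False
    then show ?thesis using that 0 P(2) by (simp add: r_def coeff_eq_0)
  qed (simp add: r_def mult.commute)
  then show ?case using 0 P
    by (intro exI[of _ "[:coeff f m:]"] exI[of _ r])
      (auto simp: r_def coeff_pCons ring_setD[OF R] split: nat.split)
next
  case (Suc k)
  define a where "a = coeff f (m + Suc k)"
  define f' where "f' = smult (coeff P m) f - monom a (Suc k) * P"
  have c: "coeff P m \<in> R" "a \<in> R" using P Suc.prems by (auto simp: a_def)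
  have "\<forall>i. coeff f' i \<in> R"
    using Suc.prems P c by (auto simp: f'_def coeff_monom_mult ring_setD[OF R])
  moreover have "degree f' \<le> m + k"
  proof (rule degree_le, intro allI impI)
    fix i assume i: "m + k < i"
    show "coeff f' i = 0"
    proof (cases "i = m + Suc k")
      case True then show ?thesis
        by (simp add: f'_def coeff_monom_mult a_def mult.commute[of "coeff P m"])
    next
      case False
      then have "coeff f i = 0" "coeff P (i - Suc k) = 0"
        using i Suc.prems P(2) by (auto intro!: coeff_eq_0)
      then show ?thesis by (simp add: f'_def coeff_monom_mult)
    qed
  qed
  ultimately obtain s r where sr: "\<forall>i. coeff s i \<in> R" "\<forall>i. coeff r i \<in> R"
    "smult (coeff P m ^ Suc k) f' = P * s + r" "\<forall>i\<ge>m. coeff r i = 0" "degree s \<le> k"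
    using Suc.IH by blast
  let ?s = "s + monom (coeff P m ^ Suc k * a) (Suc k)"
  have "smult (coeff P m ^ Suc k) (monom a (Suc k) * P) = monom (coeff P m ^ Suc k * a) (Suc k) * P"
    by (simp only: mult_smult_left[symmetric] smult_monom)
  then have "smult (coeff P m ^ Suc (Suc k)) f = smult (coeff P m ^ Suc k) f' + monom (coeff P m ^ Suc k * a) (Suc k) * P"
    by (simp only: f'_def smult_diff_right smult_smult power_Suc2 diff_add_cancel)
  then have "smult (coeff P m ^ Suc (Suc k)) f = P * ?s + r"
    by (simp only: sr(3) distrib_left mult.commute[of P] add_ac)
  moreover have "coeff ?s i \<in> R" for i
    using sr(1) c by (auto intro!: ring_setD[OF R] ring_set_power[OF R])
  moreover have "degree ?s \<le> Suc k" using sr(5) by (intro degree_add_le) (auto intro: order_trans[OF degree_monom_le])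
  moreover have "coeff ?s (Suc k) = coeff P m ^ Suc k * coeff f (m + Suc k)"
    using sr(5) by (simp add: coeff_eq_0 a_def)
  ultimately show ?case using sr(2,4) by blast
qed

text \<open>
  Top coefficients that lie in \<open>q\<close> can be dropped without changing the class modulo \<open>q\<close>. This makes
  degrees of representatives meaningful for minimality arguments over \<open>R / q\<close>.
\<close>

lemma trim_coeffs:
  assumes R: "ring_set R" and q: "ideal_in S q"
    and "\<forall>i. coeff p i \<in> R"
  shows "\<exists>p'. (\<forall>i. coeff p' i \<in> R) \<and> (p' = 0 \<or> lead_coeff p' \<notin> q) \<and> degree p' \<le> degree p \<and>
    (\<forall>i. coeff (p - p') i \<in> q)"
  using assms(3)
proof (induction "degree p" arbitrary: p rule: less_induct)
  case less
  show ?case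
  proof (cases "p = 0 \<or> lead_coeff p \<notin> q")
    case True
    then show ?thesis using less.prems ideal_inD(2)[OF q] by (intro exI[of _ p]) auto
  next
    case False
    define p1 where "p1 = p - monom (lead_coeff p) (degree p)"
    have p1R: "\<forall>i. coeff p1 i \<in> R" using less.prems by (auto simp: p1_def ring_setD[OF R])
    show ?thesis
    proof (cases "p1 = 0")
      case True
      then have "coeff p i \<in> q" for i
        using False ideal_inD(2)[OF q] by (metis coeff_monom eq_iff_diff_eq_0 p1_def)
      then show ?thesis by (intro exI[of _ 0]) (auto simp: ring_setD[OF R])
    next
      case nz: False
      have "coeff p1 (degree p) = 0" "degree p1 \<le> degree p"
        by (auto simp: p1_def intro!: degree_diff_le degree_monom_le)
      then have deg: "degree p1 < degree p" using nz by (metis le_neq_implies_less leading_coeff_0_iff)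
      from less.hyps[OF deg p1R] obtain p' where p': "\<forall>i. coeff p' i \<in> R" "p' = 0 \<or> lead_coeff p' \<notin> q"
        "degree p' \<le> degree p1" "\<forall>i. coeff (p1 - p') i \<in> q" by blast
      have "coeff (p - p') i \<in> q" for i
      proof -
        have "coeff (p - p') i = coeff (p1 - p') i + coeff (monom (lead_coeff p) (degree p)) i"
          by (simp add: p1_def)
        also have "\<dots> \<in> q" using p'(4) False ideal_inD(2)[OF q] by (intro ideal_inD(3)[OF q]) auto
        finally show ?thesis .
      qed
      then show ?thesis using p' deg by (intro exI[of _ p']) auto
    qed
  qed
qed

lemma poly_in_ideal:
  assumes A: "ring_set A" "ideal_in A q" "y \<in> A" "\<forall>i. coeff p i \<in> q"
  shows "poly p y \<in> q"
  unfolding poly_altdef using assms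
  by (intro ideal_in_sum[OF A(2)] ideal_inD(5)[OF A(2)] ring_set_power) auto

definition ring_hom_total :: "('r::comm_ring_1 \<Rightarrow> 'k::field) \<Rightarrow> bool" where
  "ring_hom_total h \<longleftrightarrow> h 1 = 1 \<and> (\<forall>a b. h (a + b) = h a + h b \<and> h (a * b) = h a * h b)"

lemma ring_hom_totalD:
  assumes "ring_hom_total h"
  shows "h 1 = 1" "h (a + b) = h a + h b" "h (a * b) = h a * h b" "h 0 = 0" "h (a - b) = h a - h b"
    "h (a ^ n) = h a ^ n"
proof -
  show 1: "h 1 = 1" and 2: "h (a + b) = h a + h b" and 3: "h (a * b) = h a * h b" for a b
    using assms by (auto simp: ring_hom_total_def)
  show "h 0 = 0" using 2[of 1 0] by simp
  show "h (a - b) = h a - h b" using 2[of "a - b" b] by simp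
  show "h (a ^ n) = h a ^ n" by (induction n) (auto simp: 1 3)
qed

text \<open>
  Chevalley's extension of homomorphisms. Here \<open>\<theta>\<close> is a homomorphism from \<open>R\<close> to an algebraically closed
  field, and \<open>\<Theta> v\<close> extends it to \<open>R[y]\<close> by sending \<open>y\<close> to \<open>v\<close>. Almost every \<open>\<theta>\<close> that kills \<open>q \<inter> R\<close>,
  namely every one with \<open>\<theta> c \<noteq> 0\<close>, has an extension that kills \<open>q\<close> but not the given element outside \<open>q\<close>.
  If \<open>y\<close> is transcendental modulo \<open>q\<close>, then \<open>c\<close> is a coefficient of \<open>G\<close> and \<open>v\<close> any value that is not a
  root. If it is algebraic, then \<open>v\<close> is a root of an equation \<open>F\<close> of minimal degree, and \<open>c\<close> combines the
  leading coefficient of \<open>F\<close> with an element of \<open>R\<close> that is a multiple of \<open>G(y)\<close> modulo \<open>q\<close>.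
\<close>

lemma hom_extension:
  fixes G :: "'r::comm_ring_1 poly"
  assumes R: "ring_set R" and q: "prime_ideal_in (adjoin R y) q"
    and G: "\<forall>i. coeff G i \<in> R" "poly G y \<notin> q"
  shows "\<exists>c\<in>R. c \<notin> q \<and>
    (\<forall>\<theta> (\<Theta> :: 'k::{alg_closed_field, field_char_0} \<Rightarrow> 'r \<Rightarrow> 'k).
       (\<forall>v. ring_hom_total (\<Theta> v)) \<longrightarrow> (\<forall>v. \<forall>a\<in>R. \<Theta> v a = \<theta> a) \<longrightarrow> (\<forall>v. \<Theta> v y = v) \<longrightarrow>
       (\<forall>a\<in>R. a \<in> q \<longrightarrow> \<theta> a = 0) \<longrightarrow> \<theta> c \<noteq> 0 \<longrightarrow>
       (\<exists>v. (\<forall>f\<in>q. \<Theta> v f = 0) \<and> \<Theta> v (poly G y) \<noteq> 0))"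
proof -
  let ?A = "adjoin R y"
  note A = adjoin_ring_set[OF R, of y]
  note qi = prime_ideal_inD(1)[OF q]
  note qD = ideal_inD[OF qi]
  have inA: "poly p y \<in> ?A" if "\<forall>i. coeff p i \<in> R" for p using that by (auto simp: adjoin_def)
  have RA: "a \<in> ?A" if "a \<in> R" for a using A(2) that by auto
  have inq: "poly p y \<in> q" if "\<forall>i. coeff p i \<in> q" for p
    using poly_in_ideal[OF A(1) qi A(3)] that by auto
  have ev: "\<Theta> v (poly p y) = poly (map_poly \<theta> p) v"
    if \<Theta>: "\<And>v. ring_hom_total (\<Theta> v)" "\<And>v a. a \<in> R \<Longrightarrow> \<Theta> v a = \<theta> a" "\<And>v. \<Theta> v y = v"
      and p: "\<forall>i. coeff p i \<in> R" for \<Theta> :: "'k \<Rightarrow> 'r \<Rightarrow> 'k" and \<theta> p v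
    using p
  proof (induction p)
    case 0
    then show ?case by (simp add: ring_hom_totalD[OF \<Theta>(1)])
  next
    case (pCons a p)
    have t0: "\<theta> 0 = 0" using \<Theta>(2)[of 0 v] ring_setD(2)[OF R] by (simp add: ring_hom_totalD[OF \<Theta>(1)])
    have a: "a \<in> R" and p: "\<forall>i. coeff p i \<in> R"
      using pCons.prems by (metis coeff_pCons_0, metis coeff_pCons_Suc)
    then show ?case using pCons.IH a
      by (simp add: ring_hom_totalD[OF \<Theta>(1)] \<Theta> t0 map_poly_pCons)
  qed
  show ?thesis
  proof (cases "\<forall>p. (\<forall>i. coeff p i \<in> R) \<and> poly p y \<in> q \<longrightarrow> (\<forall>i. coeff p i \<in> q)")
    case transcendental: True
    obtain i where i: "coeff G i \<notin> q" using G inq by blast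
    show ?thesis
    proof (intro bexI[of _ "coeff G i"] conjI allI impI)
      show "coeff G i \<in> R" "coeff G i \<notin> q" using G i by auto
      fix \<Theta> :: "'k \<Rightarrow> 'r \<Rightarrow> 'k" and \<theta>
      assume \<Theta>': "\<forall>v. ring_hom_total (\<Theta> v)" "\<forall>v. \<forall>a\<in>R. \<Theta> v a = \<theta> a" "\<forall>v. \<Theta> v y = v"
        and z': "\<forall>a\<in>R. a \<in> q \<longrightarrow> \<theta> a = 0" and nz: "\<theta> (coeff G i) \<noteq> 0"
      note \<Theta> = \<Theta>'[rule_format] and z = z'[rule_format]
      have t0: "\<theta> 0 = 0" using z qD(2) ring_setD(2)[OF R] by auto
      have "map_poly \<theta> G \<noteq> 0" using nz t0 by (metis coeff_0 coeff_map_poly)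
      then obtain v where v: "poly (map_poly \<theta> G) v \<noteq> 0"
        using poly_roots_finite infinite_UNIV_char_0 by (metis (mono_tags) UNIV_eq_I mem_Collect_eq)
      have "\<Theta> v f = 0" if f: "f \<in> q" for f
      proof -
        obtain p where p: "f = poly p y" "\<forall>i. coeff p i \<in> R" using qD(1)[OF f] by (auto simp: adjoin_def)
        then have "map_poly \<theta> p = 0" using transcendental f z t0 by (auto simp: poly_eq_iff coeff_map_poly)
        then show ?thesis using ev[OF \<Theta> p(2), of v] p(1) by simp
      qed
      then show "\<exists>v. (\<forall>f\<in>q. \<Theta> v f = 0) \<and> \<Theta> v (poly G y) \<noteq> 0"
        using v ev[OF \<Theta> G(1), of v] by (intro exI[of _ v]) auto
    qed
  next
    case False
    define Alg where "Alg d \<longleftrightarrow> (\<exists>F. (\<forall>i. coeff F i \<in> R) \<and> poly F y \<in> q \<and> degree F = d \<and> lead_coeff F \<notin> q)" for d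
    have trimmed: "\<exists>p'. (\<forall>i. coeff p' i \<in> R) \<and> poly p y - poly p' y \<in> q \<and> degree p' \<le> degree p \<and>
        (p' = 0 \<or> lead_coeff p' \<notin> q) \<and> (p' = 0 \<longrightarrow> (\<forall>i. coeff p i \<in> q))" if "\<forall>i. coeff p i \<in> R" for p
      using trim_coeffs[OF R qi that] inq
      by (metis diff_zero poly_diff)
    have Alg_less: "\<exists>d. Alg d \<and> d \<le> degree p"
      if p: "\<forall>i. coeff p i \<in> R" "poly p y \<in> q" "\<not> (\<forall>i. coeff p i \<in> q)" for p
    proof -
      obtain p' where p': "\<forall>i. coeff p' i \<in> R" "poly p y - poly p' y \<in> q" "degree p' \<le> degree p"
        "lead_coeff p' \<notin> q" using trimmed[OF p(1)] p(3) by metis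
      have "poly p' y \<in> q" using ideal_in_diff[OF A(1) qi p(2) p'(2)] by simp
      then show ?thesis using p' unfolding Alg_def by blast
    qed
    define e where "e = (LEAST d. Alg d)"
    have "Alg e" unfolding e_def using False Alg_less by (metis LeastI_ex)
    then obtain F where F: "\<forall>i. coeff F i \<in> R" "poly F y \<in> q" "degree F = e" "coeff F e \<notin> q"
      by (auto simp: Alg_def)
    have min_e: "\<forall>i. coeff p i \<in> q"
      if p: "\<forall>i. coeff p i \<in> R" "poly p y \<in> q" "\<forall>i\<ge>e. coeff p i = 0" for p
    proof (rule ccontr)
      assume n: "\<not> (\<forall>i. coeff p i \<in> q)"
      then have "p \<noteq> 0" using qD(2) by auto
      then have "degree p < e" using p(3) by (meson leading_coeff_0_iff not_le_imp_less)
      then show False using Alg_less[OF p(1,2) n] Least_le[of Alg] e_def by (metis leD order_trans)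
    qed
    \<comment> \<open>The ideal generated by \<open>G(y)\<close> and \<open>q\<close>; the Euclidean algorithm finds in it an element of \<open>R\<close> outside \<open>q\<close>.\<close>
    define S where "S = {f\<in>?A. \<exists>h\<in>?A. f - poly G y * h \<in> q}"
    have S_diff: "f - g \<in> S" if "f \<in> S" "g \<in> S" for f g
    proof -
      from that obtain h k where hk: "f \<in> ?A" "g \<in> ?A" "h \<in> ?A" "k \<in> ?A"
         "f - poly G y * h \<in> q" "g - poly G y * k \<in> q" by (auto simp: S_def)
      then have "(f - g) - poly G y * (h - k) \<in> q"
        using ideal_in_diff[OF A(1) qi hk(5,6)] by (simp add: algebra_simps)
      then show ?thesis using hk ring_setD(3)[OF A(1)] by (auto simp: S_def)
    qed
    have S_mult: "f * g \<in> S" if "f \<in> S" "g \<in> ?A" for f g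
    proof -
      from that obtain h where h: "f \<in> ?A" "h \<in> ?A" "f - poly G y * h \<in> q" by (auto simp: S_def)
      then have "f * g - poly G y * (h * g) \<in> q"
        using qD(5)[OF that(2) h(3)] by (simp add: algebra_simps)
      then show ?thesis using h that ring_setD(4)[OF A(1)] by (auto simp: S_def)
    qed
    have qS: "f \<in> S" if "f \<in> q" for f
      unfolding S_def using qD(1)[OF that] ring_setD(2)[OF A(1)] that by (intro CollectI conjI bexI[of _ 0]) auto
    define Rep where "Rep d \<longleftrightarrow> (\<exists>p. (\<forall>i. coeff p i \<in> R) \<and> poly p y \<in> S \<and> poly p y \<notin> q \<and> degree p = d)" for d
    have "poly G y \<in> S" unfolding S_def using inA[OF G(1)] ring_setD(1)[OF A(1)] qD(2)
      by (intro CollectI conjI bexI[of _ 1]) auto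
    then have "Rep (degree G)" using G by (auto simp: Rep_def)
    define e' where "e' = (LEAST d. Rep d)"
    have "Rep e'" unfolding e'_def using \<open>Rep (degree G)\<close> by (rule LeastI)
    then obtain P0 where P0: "\<forall>i. coeff P0 i \<in> R" "poly P0 y \<in> S" "poly P0 y \<notin> q" "degree P0 = e'"
      by (auto simp: Rep_def)
    have min_e': "poly p y \<in> q" if "\<forall>i. coeff p i \<in> R" "poly p y \<in> S" "\<forall>i\<ge>e'. coeff p i = 0" for p
    proof (rule ccontr)
      assume n: "poly p y \<notin> q"
      then have "p \<noteq> 0" using qD(2) by auto
      then have "degree p < e'" using that(3) by (meson leading_coeff_0_iff not_le_imp_less)
      then show False using Least_le[of Rep "degree p"] that n e'_def by (auto simp: Rep_def)
    qed
    obtain P where P: "\<forall>i. coeff P i \<in> R" "poly P0 y - poly P y \<in> q" "degree P \<le> e'"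
      "P = 0 \<or> lead_coeff P \<notin> q" using trimmed[OF P0(1)] P0(4) by metis
    have PS: "poly P y \<in> S" using S_diff[OF P0(2) qS[OF P(2)]] by simp
    have Pq: "poly P y \<notin> q" using P0(3) ideal_inD(3)[OF qi P(2), of "poly P y"] by auto
    have "P \<noteq> 0" using Pq qD(2) by auto
    then have degP: "degree P = e'" using P(3) min_e'[OF P(1) PS] Pq
      by (metis coeff_eq_0 le_neq_implies_less less_le_trans)
    then have cP: "coeff P e' \<notin> q" using P(4) \<open>P \<noteq> 0\<close> by auto
    have "e' < e"
    proof (rule ccontr)
      assume "\<not> e' < e"
      then obtain k where k: "e' = e + k" using le_Suc_ex not_less by blast
      obtain s r where sr: "\<forall>i. coeff s i \<in> R" "\<forall>i. coeff r i \<in> R"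
        "smult (coeff F e ^ Suc k) P = F * s + r" "\<forall>i\<ge>e. coeff r i = 0"
        using pseudo_division[OF R F(1) _ P(1), of e k] F(3) degP k by auto
      have cA: "coeff F e ^ Suc k \<in> ?A" by (intro ring_set_power[OF A(1)] RA) (use F in auto)
      have r: "poly r y = coeff F e ^ Suc k * poly P y - poly F y * poly s y"
        using arg_cong[OF sr(3), of "\<lambda>p. poly p y"] by simp
      have "poly r y \<in> S" unfolding r
        using PS S_mult[OF PS cA] S_mult[OF qS[OF F(2)] inA[OF sr(1)]] by (intro S_diff) (auto simp: mult.commute)
      then have "poly r y \<in> q" using min_e'[OF sr(2)] sr(4) k by auto
      then have "coeff F e ^ Suc k * poly P y \<in> q"
        using ideal_inD(3)[OF qi _ qD(5)[OF inA[OF sr(1)] F(2)], of "poly r y"] r by simp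
      then show False
        using prime_ideal_inD(4)[OF q cA inA[OF P(1)]] prime_ideal_power[OF q A(1)] F RA Pq by blast
    qed
    \<comment> \<open>Otherwise dividing \<open>F\<close> by the minimal \<open>P\<close> would give a quotient in \<open>q\<close> of smaller degree than \<open>F\<close>.\<close>
    have "e' = 0"
    proof (rule ccontr)
      assume "e' \<noteq> 0"
      obtain k where k: "e = e' + k" using \<open>e' < e\<close> less_imp_le le_Suc_ex by blast
      obtain s r where sr: "\<forall>i. coeff s i \<in> R" "\<forall>i. coeff r i \<in> R"
        "smult (coeff P e' ^ Suc k) F = P * s + r" "\<forall>i\<ge>e'. coeff r i = 0"
        "degree s \<le> k" "coeff s k = coeff P e' ^ k * coeff F (e' + k)"
        using pseudo_division[OF R P(1) _ F(1), of e' k] F(3) degP k by auto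
      have cA: "coeff P e' ^ n \<in> ?A" for n by (intro ring_set_power[OF A(1)] RA) (use P in auto)
      have r: "poly r y = coeff P e' ^ Suc k * poly F y - poly P y * poly s y"
        using arg_cong[OF sr(3), of "\<lambda>p. poly p y"] by simp
      have Fq: "coeff P e' ^ Suc k * poly F y \<in> q" by (rule qD(4)[OF cA F(2)])
      have "poly r y \<in> S" unfolding r
        by (intro S_diff qS[OF Fq] S_mult[OF PS] inA sr)
      then have "poly r y \<in> q" using min_e'[OF sr(2)] sr(4) by auto
      then have "poly P y * poly s y \<in> q" using ideal_in_diff[OF A(1) qi Fq] r by fastforce
      then have "poly s y \<in> q" using prime_ideal_inD(3)[OF q inA[OF P(1)] inA[OF sr(1)]] Pq by auto
      then have "\<forall>i. coeff s i \<in> q"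
        using min_e[OF sr(1)] sr(5) k \<open>e' \<noteq> 0\<close> by (simp add: coeff_eq_0)
      then have "coeff P e' ^ k * coeff F e \<in> q" using sr(6) k by metis
      then show False
        using prime_ideal_inD(4)[OF q cA[of k] RA] prime_ideal_power[OF q A(1)] F P RA cP by blast
    qed
    then obtain c0 where c0: "P = [:c0:]" using degP degree_eq_zeroE by auto
    have c0': "c0 \<in> R" "c0 \<notin> q" using P(1) cP c0 \<open>e' = 0\<close> by (auto simp: coeff_pCons_0 dest: spec[of _ 0])
    obtain h where h: "h \<in> ?A" "c0 - poly G y * h \<in> q" using PS c0 by (auto simp: S_def)
    have "e \<noteq> 0"
    proof
      assume e0: "e = 0"
      then obtain a where "F = [:a:]" using F(3) degree_eq_zeroE by auto
      then show False using F e0 by auto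
    qed
    show ?thesis
    proof (intro bexI[of _ "c0 * coeff F e"] conjI allI impI)
      show "c0 * coeff F e \<in> R" using c0' F ring_setD(4)[OF R] by auto
      show "c0 * coeff F e \<notin> q" using prime_ideal_inD(4)[OF q] c0' F RA by blast
      fix \<Theta> :: "'k \<Rightarrow> 'r \<Rightarrow> 'k" and \<theta>
      assume \<Theta>': "\<forall>v. ring_hom_total (\<Theta> v)" "\<forall>v. \<forall>a\<in>R. \<Theta> v a = \<theta> a" "\<forall>v. \<Theta> v y = v"
        and z': "\<forall>a\<in>R. a \<in> q \<longrightarrow> \<theta> a = 0" and nz: "\<theta> (c0 * coeff F e) \<noteq> 0"
      note \<Theta> = \<Theta>'[rule_format] and z = z'[rule_format]
      note hD = ring_hom_totalD[OF \<Theta>(1)]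
      have t0: "\<theta> 0 = 0" using z qD(2) ring_setD(2)[OF R] by auto
      have "\<theta> (c0 * coeff F e) = \<theta> c0 * \<theta> (coeff F e)"
        using \<Theta>(2)[of "c0 * coeff F e"] \<Theta>(2)[OF c0'(1)] \<Theta>(2)[of "coeff F e"] F(1) ring_setD(4)[OF R c0'(1)] hD(3)
        by metis
      then have nz': "\<theta> c0 \<noteq> 0" "\<theta> (coeff F e) \<noteq> 0" using nz by auto
      have "coeff (map_poly \<theta> F) e \<noteq> 0" using nz' t0 by (simp add: coeff_map_poly)
      then have "degree (map_poly \<theta> F) > 0" using \<open>e \<noteq> 0\<close> le_degree by (metis gr0I le_zero_eq)
      then obtain v where v: "poly (map_poly \<theta> F) v = 0" using alg_closed_imp_poly_has_root by blast
      have Fv: "\<Theta> v (poly F y) = 0" using ev[OF \<Theta> F(1)] v by simp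
      \<comment> \<open>Division by \<open>F\<close> leaves, by minimality, a remainder with coefficients in \<open>q\<close>, which \<open>\<theta>\<close> kills.\<close>
      have zero: "\<Theta> v f = 0" if f: "f \<in> q" for f
      proof -
        obtain p where p: "f = poly p y" "\<forall>i. coeff p i \<in> R" using qD(1)[OF f] by (auto simp: adjoin_def)
        obtain s r where sr: "\<forall>i. coeff s i \<in> R" "\<forall>i. coeff r i \<in> R"
          "smult (coeff F e ^ Suc (degree p)) p = F * s + r" "\<forall>i\<ge>e. coeff r i = 0"
          using pseudo_division[OF R F(1) _ p(2), of e "degree p"] F(3) by auto
        have cA: "coeff F e ^ Suc (degree p) \<in> ?A" by (intro ring_set_power[OF A(1)] RA) (use F in auto)
        have r: "coeff F e ^ Suc (degree p) * f = poly F y * poly s y + poly r y"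
          using arg_cong[OF sr(3), of "\<lambda>p. poly p y"] p by simp
        have "poly r y \<in> q"
          using ideal_in_diff[OF A(1) qi qD(4)[OF cA f] qD(5)[OF inA[OF sr(1)] F(2)]] r by simp
        then have "map_poly \<theta> r = 0" using min_e[OF sr(2)] sr(2,4) z t0
          by (auto simp: poly_eq_iff coeff_map_poly)
        then have "\<Theta> v (poly r y) = 0" using ev[OF \<Theta> sr(2), of v] by simp
        then have "\<Theta> v (coeff F e) ^ Suc (degree p) * \<Theta> v f = 0"
          using arg_cong[OF r, of "\<Theta> v"] Fv by (simp add: hD)
        then show ?thesis using nz' \<Theta>(2)[of "coeff F e" v] F(1) by auto
      qed
      have "\<theta> c0 = \<Theta> v (poly G y) * \<Theta> v h"
        using zero[OF h(2)] \<Theta>(2)[OF c0'(1), of v] by (simp add: hD)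
      then show "\<exists>v. (\<forall>f\<in>q. \<Theta> v f = 0) \<and> \<Theta> v (poly G y) \<noteq> 0" using zero nz' by (intro exI[of _ v]) auto
    qed
  qed
qed

lemma adjoin_least:
  assumes "ring_set S" "R \<subseteq> S" "y \<in> S"
  shows "adjoin R y \<subseteq> S"
  using assms unfolding adjoin_def poly_altdef
  by (auto intro!: ring_set_sum ring_setD ring_set_power)

lemma polynomial_functions_ring_set: "ring_set (polynomial_functions n)"
proof -
  have "p - q \<in> polynomial_functions n"
    if "p \<in> polynomial_functions n" "q \<in> polynomial_functions n" for p q :: "(nat \<Rightarrow> 'k::field) \<Rightarrow> 'k"
  proof -
    have "(\<lambda>x. p x + (- 1) * q x) \<in> polynomial_functions n"
      by (intro polynomial_functions.intros that)
    moreover have "(\<lambda>x. p x + (- 1) * q x) = p - q" by (simp add: fun_eq_iff)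
    ultimately show ?thesis by simp
  qed
  then show ?thesis
    unfolding ring_set_def one_fun_def times_fun_def by (auto intro: polynomial_functions.intros)
qed

lemma polynomial_functions_cong:
  "p \<in> polynomial_functions n \<Longrightarrow> (\<And>i. i < n \<Longrightarrow> x i = y i) \<Longrightarrow> p x = p y"
  by (induction rule: polynomial_functions.induct) auto

lemma polynomial_functions_Suc:
  "polynomial_functions (Suc n) = adjoin (polynomial_functions n) (\<lambda>x. x n)" (is "?L = ?A")
proof
  have mono: "polynomial_functions n \<subseteq> ?L"
  proof
    fix p :: "(nat \<Rightarrow> 'a) \<Rightarrow> 'a" assume "p \<in> polynomial_functions n"
    then show "p \<in> ?L" by induction (auto intro: polynomial_functions.intros)
  qed
  then show "?A \<subseteq> ?L"
    by (intro adjoin_least polynomial_functions_ring_set) (auto intro: polynomial_functions.coord)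
  note A = adjoin_ring_set[OF polynomial_functions_ring_set[of n], of "\<lambda>x. x n"]
  show "?L \<subseteq> ?A"
  proof
    fix p :: "(nat \<Rightarrow> 'a) \<Rightarrow> 'a" assume "p \<in> ?L"
    then show "p \<in> ?A"
    proof induction
      case (const c)
      then show ?case using A(2) polynomial_functions.const by blast
    next
      case (coord i)
      then show ?case using A(2,3) polynomial_functions.coord[of i n] by (cases "i = n") auto
    next
      case (add p q)
      then show ?case using ring_setD(6)[OF A(1)] by (auto simp: plus_fun_def)
    next
      case (mult p q)
      then show ?case using ring_setD(4)[OF A(1)] by (auto simp: times_fun_def)
    qed
  qed
qed

lemma polynomial_functions_0: "p \<in> polynomial_functions 0 \<Longrightarrow> \<exists>c. p = (\<lambda>x. c)"
  by (induction rule: polynomial_functions.induct) auto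

text \<open>
  In zero variables all functions are constant, so this leaves only two ideals and starts the inductions on
  the number of variables.
\<close>

lemma constant_in_ideal:
  assumes "ideal_in (polynomial_functions n) J" "(\<lambda>x. c) \<in> J" "c \<noteq> 0"
  shows "J = polynomial_functions n"
proof
  show "polynomial_functions n \<subseteq> J"
  proof
    fix p :: "(nat \<Rightarrow> 'a) \<Rightarrow> 'a" assume p: "p \<in> polynomial_functions n"
    have "p * (\<lambda>x. inverse c) \<in> polynomial_functions n"
      using p by (intro ring_setD(4)[OF polynomial_functions_ring_set] polynomial_functions.const)
    from ideal_inD(4)[OF assms(1) this assms(2)]
    have "p * (\<lambda>x. inverse c) * (\<lambda>x. c) \<in> J" .
    moreover have "p * (\<lambda>x. inverse c) * (\<lambda>x. c) = p" using assms(3) by (simp add: fun_eq_iff)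
    ultimately show "p \<in> J" by simp
  qed
qed (use ideal_inD(1)[OF assms(1)] in auto)

lemma polynomial_functions_noetherian: "noetherian (polynomial_functions n :: ((nat \<Rightarrow> 'k::field) \<Rightarrow> 'k) set)"
proof (induction n)
  case 0
  show ?case
    unfolding noetherian_def
  proof (intro allI impI, elim conjE)
    fix J :: "nat \<Rightarrow> ((nat \<Rightarrow> 'k) \<Rightarrow> 'k) set"
    assume J: "\<forall>k. ideal_in (polynomial_functions 0) (J k)" and inc: "\<forall>k. J k \<subseteq> J (Suc k)"
    have mono: "J k \<subseteq> J l" if "k \<le> l" for k l using inc that by (rule_tac lift_Suc_mono_le) auto
    show "\<exists>K. \<forall>k\<ge>K. J k = J K"
    proof (cases "\<exists>K. J K \<noteq> {0}")
      case True
      then obtain K p where p: "p \<in> J K" "p \<noteq> 0" using ideal_inD(2)[OF J[rule_format]] by blast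
      then obtain c where c: "p = (\<lambda>x. c)" using ideal_inD(1)[OF J[rule_format]] polynomial_functions_0 by blast
      have "c \<noteq> 0" using p c by (auto simp: fun_eq_iff)
      then have "J k = polynomial_functions 0" if "k \<ge> K" for k
        using constant_in_ideal[OF J[rule_format, of k], of c] p(1) c mono[OF that] by blast
      then show ?thesis by (intro exI[of _ K]) simp
    next
      case False then show ?thesis by simp
    qed
  qed
next
  case (Suc n)
  then show ?case
    unfolding polynomial_functions_Suc by (intro hilbert_basis polynomial_functions_ring_set)
qed

text \<open>
  Every polynomial outside a prime ideal is nonzero at some zero of the ideal. The induction adds one
  variable at a time and chooses its value by \<open>hom_extension\<close>.
\<close>

theorem prime_nullstellensatz:
  fixes q :: "((nat \<Rightarrow> 'k::{alg_closed_field, field_char_0}) \<Rightarrow> 'k) set"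
  assumes "prime_ideal_in (polynomial_functions n) q" "g \<in> polynomial_functions n" "g \<notin> q"
  shows "\<exists>a\<in>{..<n} \<rightarrow>\<^sub>E UNIV. (\<forall>p\<in>q. p a = 0) \<and> g a \<noteq> 0"
  using assms
proof (induction n arbitrary: q g)
  case 0
  note qi = prime_ideal_inD(1)[OF "0.prems"(1)]
  have "p = (\<lambda>x. 0)" if p: "p \<in> q" for p
  proof -
    obtain c where c: "p = (\<lambda>x. c)" using ideal_inD(1)[OF qi p] polynomial_functions_0 by blast
    show ?thesis
    proof (cases "c = 0")
      case False
      then have "q = polynomial_functions 0" using constant_in_ideal[OF qi] p c by auto
      then show ?thesis using prime_ideal_inD(2)[OF "0.prems"(1)] ring_setD(1)[OF polynomial_functions_ring_set] by blast
    qed (use c in simp)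
  qed
  moreover obtain c where "g = (\<lambda>x. c)" using "0.prems"(2) polynomial_functions_0 by blast
  moreover have "c \<noteq> 0" if "g = (\<lambda>x. c)" for c
    using "0.prems"(3) ideal_inD(2)[OF qi] that by (auto simp: zero_fun_def)
  ultimately show ?case by (intro bexI[of _ "\<lambda>_. undefined"]) auto
next
  case (Suc n)
  let ?R = "polynomial_functions n :: ((nat \<Rightarrow> 'k) \<Rightarrow> 'k) set"
  let ?y = "\<lambda>x::nat \<Rightarrow> 'k. x n"
  note R = polynomial_functions_ring_set[of n]
  note A = adjoin_ring_set(2)[OF R, of ?y]
  have q: "prime_ideal_in (adjoin ?R ?y) q" using Suc.prems(1) by (simp add: polynomial_functions_Suc)
  obtain G where G: "\<forall>i. coeff G i \<in> ?R" "g = poly G ?y"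
    using Suc.prems(2) by (auto simp: polynomial_functions_Suc adjoin_def)
  have "prime_ideal_in ?R (q \<inter> ?R)"
  proof -
    have "a \<in> q \<or> b \<in> q" if "a \<in> ?R" "b \<in> ?R" "a * b \<in> q" for a b
      using prime_ideal_inD(3)[OF q] A that by blast
    moreover have "r * a \<in> q" if "r \<in> ?R" "a \<in> q" for r a
      using ideal_inD(4)[OF prime_ideal_inD(1)[OF q]] A that by blast
    ultimately show ?thesis
      unfolding prime_ideal_in_def ideal_in_def
      using ideal_inD(2,3)[OF prime_ideal_inD(1)[OF q]] prime_ideal_inD(2)[OF q] ring_setD(2,4,6)[OF R]
      by auto
  qed
  moreover have nq: "poly G ?y \<notin> q" using G(2) Suc.prems(3) by simp
  obtain c where c: "c \<in> ?R" "c \<notin> q" and ext: "\<forall>\<theta> (\<Theta> :: 'k \<Rightarrow> ((nat \<Rightarrow> 'k) \<Rightarrow> 'k) \<Rightarrow> 'k).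
       (\<forall>v. ring_hom_total (\<Theta> v)) \<longrightarrow> (\<forall>v. \<forall>a\<in>?R. \<Theta> v a = \<theta> a) \<longrightarrow> (\<forall>v. \<Theta> v ?y = v) \<longrightarrow>
       (\<forall>a\<in>?R. a \<in> q \<longrightarrow> \<theta> a = 0) \<longrightarrow> \<theta> c \<noteq> 0 \<longrightarrow>
       (\<exists>v. (\<forall>f\<in>q. \<Theta> v f = 0) \<and> \<Theta> v (poly G ?y) \<noteq> 0)"
    by (rule bexE[OF hom_extension[OF R q G(1) nq]], elim conjE) (rule that)
  ultimately obtain a where a: "a \<in> {..<n} \<rightarrow>\<^sub>E UNIV" "\<And>p. p \<in> q \<Longrightarrow> p \<in> ?R \<Longrightarrow> p a = 0" "c a \<noteq> 0"
    using Suc.IH[of "q \<inter> ?R" c] by blast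
  have "\<exists>v. (\<forall>f\<in>q. f (a(n := v)) = 0) \<and> poly G ?y (a(n := v)) \<noteq> 0"
  proof (rule ext[rule_format, of "\<lambda>v f. f (a(n := v))" "\<lambda>f. f a"])
    show "p (a(n := v)) = p a" if "p \<in> ?R" for v p using that by (rule polynomial_functions_cong) auto
  qed (use a in \<open>auto simp: ring_hom_total_def\<close>)
  then obtain v where "\<forall>f\<in>q. f (a(n := v)) = 0" "g (a(n := v)) \<noteq> 0" using G(2) by auto
  moreover have "a(n := v) \<in> {..<Suc n} \<rightarrow>\<^sub>E UNIV" using a(1) by (auto simp: PiE_def extensional_def)
  ultimately show ?case by blast
qed

section \<open>Uniformizers at height one primes\<close>

lemma principal_ideal:
  assumes B: "ring_set B" and f: "f \<in> B"
  shows "ideal_in B {f * a |a. a \<in> B}"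
  unfolding ideal_in_def
proof (intro conjI ballI subsetI)
  note BD = ring_setD[OF B]
  show "0 \<in> {f * a |a. a \<in> B}" using BD(2) by force
  fix x assume "x \<in> {f * a |a. a \<in> B}"
  then obtain a where a: "x = f * a" "a \<in> B" by blast
  show "x \<in> B" using a f BD(4) by simp
  show "x + y \<in> {f * a |a. a \<in> B}" if "y \<in> {f * a |a. a \<in> B}" for y
    using that a BD(6) by (auto simp flip: distrib_left)
  show "r * x \<in> {f * a |a. a \<in> B}" if "r \<in> B" for r
    using that a BD(4) by (auto simp: mult.left_commute[of r])
qed

lemma generated_ideal:
  assumes B: "ring_set B" and h: "\<And>j. h j \<in> B"
  shows "ideal_in B {\<Sum>j<(k::nat). c j * h j |c. \<forall>j. c j \<in> B}" (is "ideal_in B ?I")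
  unfolding ideal_in_def
proof (intro conjI ballI subsetI)
  note BD = ring_setD[OF B]
  have "(\<Sum>j<k. 0 * h j) \<in> ?I" using BD(2) by (intro CollectI exI[of _ "\<lambda>_. 0"]) simp
  then show "0 \<in> ?I" by simp
  fix x assume "x \<in> ?I"
  then obtain c where c: "x = (\<Sum>j<k. c j * h j)" "\<forall>j. c j \<in> B" by blast
  show "x \<in> B" unfolding c(1) by (intro ring_set_sum[OF B] BD(4) h) (use c(2) in blast)
  show "x + y \<in> ?I" if y: "y \<in> ?I" for y
  proof -
    obtain d where d: "y = (\<Sum>j<k. d j * h j)" "\<forall>j. d j \<in> B" using y by blast
    have "x + y = (\<Sum>j<k. (c j + d j) * h j)" by (simp add: c d distrib_right sum.distrib)
    then show ?thesis using c(2) d(2) BD(6) by (intro CollectI exI[of _ "\<lambda>j. c j + d j"]) simp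
  qed
  show "r * x \<in> ?I" if r: "r \<in> B" for r
  proof -
    have "r * x = (\<Sum>j<k. (r * c j) * h j)" by (simp add: c sum_distrib_left mult.assoc)
    then show ?thesis using c(2) r BD(4) by (intro CollectI exI[of _ "\<lambda>j. r * c j"]) simp
  qed
qed

text \<open>
  The contraction to \<open>B\<close> of the colon ideal of \<open>I\<close> and \<open>y\<close> in the localization at \<open>P\<close>. Working with
  contractions avoids fractions.
\<close>

lemma localized_colon_ideal:
  assumes B: "ring_set B" and P: "prime_ideal_in B P" and I: "ideal_in B I"
  shows "ideal_in B {h\<in>B. \<exists>d\<in>B - P. d * h * y \<in> I}" (is "ideal_in B ?J")
  unfolding ideal_in_def
proof (intro conjI ballI)
  note BD = ring_setD[OF B] and ID = ideal_inD[OF I]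
  have one: "1 \<in> B - P" using BD(1) prime_ideal_inD(2)[OF P] by auto
  show "?J \<subseteq> B" by blast
  show "0 \<in> ?J" using one BD(2) ID(2) by auto
  fix g assume "g \<in> ?J"
  then obtain d where d: "d \<in> B - P" "d * g * y \<in> I" "g \<in> B" by blast
  show "g + h \<in> ?J" if h: "h \<in> ?J" for h
  proof -
    obtain d' where d': "d' \<in> B - P" "d' * h * y \<in> I" "h \<in> B" using h by blast
    have "d * d' * (g + h) * y = d' * (d * g * y) + d * (d' * h * y)" by (simp add: algebra_simps)
    also have "\<dots> \<in> I" by (intro ID(3,4) d d') (use d d' in blast)+
    finally have "d * d' * (g + h) * y \<in> I" .
    moreover have "d * d' \<in> B - P" using d(1) d'(1) BD(4) prime_ideal_inD(4)[OF P] by blast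
    ultimately show ?thesis using BD(6)[OF d(3) d'(3)] by blast
  qed
  show "r * g \<in> ?J" if r: "r \<in> B" for r
  proof -
    have "d * (r * g) * y \<in> I" using ID(4)[OF r d(2)] by (simp only: mult_ac)
    then show ?thesis using d(1) BD(4)[OF r d(3)] by blast
  qed
qed

text \<open>
  A Noetherian domain that is integrally closed at a height one prime \<open>P\<close> has a discrete valuation ring
  as localization \<open>B\<^sub>P\<close>. Membership in \<open>f B\<^sub>P\<close> is expressed by a multiplier outside \<open>P\<close>.
  
  Fix a nonzero \<open>f\<close> in \<open>P\<close>. A maximal element among the proper ideals \<open>(f : y)\<close> of the localization is
  prime, hence it is the maximal ideal: \<open>y P\<close> lies in \<open>f B\<^sub>P\<close> but \<open>y\<close> does not. If the fraction \<open>y / f\<close>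
  mapped \<open>P\<close> into itself, then iterating it on \<open>f\<close> would give an ascending chain of ideals, which stops
  and yields an integral equation for \<open>y / f\<close>, contrary to integral closedness. So \<open>y u = f\<close> up to units
  for some \<open>u\<close> in \<open>P\<close>, and \<open>u\<close> generates \<open>P\<close>. No nonzero element is divisible by all powers of \<open>u\<close>,
  again by the ascending chain condition.
\<close>

theorem normal_height_one_uniformizer:
  fixes B P :: "'r::comm_ring_1 set"
  assumes B: "ring_set B" and N: "noetherian B"
    and dom: "\<And>a b. a \<in> B \<Longrightarrow> b \<in> B \<Longrightarrow> a * b = 0 \<Longrightarrow> a = 0 \<or> b = 0"
    and P: "prime_ideal_in B P" and nz: "P \<noteq> {0}"
    and height: "\<And>q. prime_ideal_in B q \<Longrightarrow> q \<subseteq> P \<Longrightarrow> q \<noteq> {0} \<Longrightarrow> q = P"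
    and int_closed: "\<And>y f b n c. y \<in> B \<Longrightarrow> f \<in> B \<Longrightarrow> f \<noteq> 0 \<Longrightarrow> b \<in> B \<Longrightarrow> b \<notin> P \<Longrightarrow>
       (\<And>j. c j \<in> B) \<Longrightarrow> b * y ^ n = (\<Sum>j<n. c j * y ^ j * f ^ (n - j)) \<Longrightarrow>
       \<exists>b'\<in>B - P. \<exists>a\<in>B. b' * y = f * a"
  shows "\<exists>u\<in>P. \<forall>g\<in>B. g \<noteq> 0 \<longrightarrow> (\<exists>m. \<exists>a\<in>B - P. \<exists>b\<in>B - P. b * g = u ^ m * a)"
proof -
  note BD = ring_setD[OF B]
  note Pi = prime_ideal_inD(1)[OF P]
  note PD = ideal_inD[OF Pi]
  have prime: "a * b \<in> B - P" if "a \<in> B - P" "b \<in> B - P" for a b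
    using that prime_ideal_inD(4)[OF P] BD(4) by auto
  have one: "1 \<in> B - P" using BD(1) prime_ideal_inD(2)[OF P] by auto
  have cancel: "a = b" if "f \<in> B" "f \<noteq> 0" "a \<in> B" "b \<in> B" "f * a = f * b" for f a b
  proof -
    have "f * (a - b) = 0" using that by (simp add: algebra_simps)
    then show ?thesis using dom[of f "a - b"] that BD(3) by auto
  qed
  have pnz: "x \<noteq> 0" if "x \<in> B - P" for x using that PD(2) by auto
  obtain f where f: "f \<in> P" "f \<noteq> 0" using nz PD(2) by blast
  have fB: "f \<in> B" using PD(1) f by auto
  \<comment> \<open>The contraction of the ideal \<open>(f : y)\<close> of the localization; it is proper iff it does not contain 1.\<close>
  define J where "J y = {h\<in>B. \<exists>b\<in>B - P. \<exists>a\<in>B. b * h * y = f * a}" for y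
  have J_ideal: "ideal_in B (J y)" for y
  proof -
    have eq: "J y = {h\<in>B. \<exists>d\<in>B - P. d * h * y \<in> {f * a |a. a \<in> B}}" unfolding J_def by blast
    show ?thesis unfolding eq by (rule localized_colon_ideal[OF B P principal_ideal[OF B fB]])
  qed
  define \<C> where "\<C> = {J y |y. y \<in> B \<and> 1 \<notin> J y}"
  have "1 \<notin> J 1" unfolding J_def using PD(5)[OF _ f(1)] by auto
  then have "\<C> \<noteq> {}" using BD(1) by (auto simp: \<C>_def)
  then obtain M where M: "M \<in> \<C>" "\<And>I. I \<in> \<C> \<Longrightarrow> M \<subseteq> I \<Longrightarrow> I = M"
    using noetherian_maximal[OF N, of \<C>] J_ideal by (auto simp: \<C>_def)
  then obtain y where y: "y \<in> B" "1 \<notin> J y" "M = J y" by (auto simp: \<C>_def)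
  have "prime_ideal_in B (J y)"
    unfolding prime_ideal_in_def
  proof (intro conjI ballI impI J_ideal y)
    fix h k assume hk: "h \<in> B" "k \<in> B" "h * k \<in> J y"
    show "h \<in> J y \<or> k \<in> J y"
    proof (rule disjCI)
      assume k: "k \<notin> J y"
      have "J (k * y) = J y"
      proof (rule M(2)[unfolded y(3)])
        have "1 \<notin> J (k * y)" using k hk BD(1) by (auto simp: J_def mult.assoc)
        then show "J (k * y) \<in> \<C>" using hk y BD(4) by (auto simp: \<C>_def)
        show "J y \<subseteq> J (k * y)"
        proof
          fix h assume "h \<in> J y"
          then obtain b a where h: "b \<in> B - P" "a \<in> B" "b * h * y = f * a" "h \<in> B" by (auto simp: J_def)
          have "b * h * (k * y) = k * (b * h * y)" by (simp add: algebra_simps)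
          also have "\<dots> = f * (k * a)" by (simp only: h) (simp add: algebra_simps)
          finally show "h \<in> J (k * y)" unfolding J_def using h hk BD(4)
            by (intro CollectI conjI bexI[of _ b] bexI[of _ "k * a"]) auto
        qed
      qed
      moreover have "h \<in> J (k * y)" using hk by (auto simp: J_def mult.assoc)
      ultimately show "h \<in> J y" by simp
    qed
  qed
  moreover have "J y \<subseteq> P"
  proof
    fix h assume h: "h \<in> J y"
    then obtain b a where b: "b \<in> B - P" "a \<in> B" "b * h * y = f * a" "h \<in> B" by (auto simp: J_def)
    show "h \<in> P"
    proof (rule ccontr)
      assume "h \<notin> P"
      then have "b * h \<in> B - P" using prime b by auto
      then have "1 \<in> J y" using b BD(1) by (auto simp: J_def)
      then show False using y by simp
    qed
  qed
  moreover have "f \<in> J y" unfolding J_def using one fB y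
    by (intro CollectI conjI bexI[of _ 1] bexI[of _ y]) auto
  ultimately have JP: "J y = P" using height f by auto
  have nl: "b * y \<noteq> f * a" if "b \<in> B - P" "a \<in> B" for a b
    using y(2) that BD(1) by (auto simp: J_def)
  have colon: "\<exists>b\<in>B - P. \<exists>a\<in>B. b * h * y = f * a" if "h \<in> P" for h
  proof -
    have "h \<in> J y" using that JP by simp
    then show ?thesis unfolding J_def by blast
  qed
  have "\<exists>u\<in>P. \<exists>b\<in>B - P. \<exists>a\<in>B - P. b * u * y = f * a"
  proof (rule ccontr)
    assume neg: "\<not> ?thesis"
    have "\<exists>b k. b \<in> B - P \<and> k \<in> P \<and> b * h * y = f * k" if h: "h \<in> P" for h
    proof -
      obtain b a where ba: "b \<in> B - P" "a \<in> B" "b * h * y = f * a" using colon[OF h] by blast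
      then have "a \<in> P" using neg h by (meson DiffI)
      then show ?thesis using ba by blast
    qed
    then obtain \<beta> \<eta> where \<beta>: "\<And>h. h \<in> P \<Longrightarrow> \<beta> h \<in> B - P \<and> \<eta> h \<in> P \<and> \<beta> h * h * y = f * \<eta> h" by metis
    \<comment> \<open>Up to the units \<open>b k\<close>, the element \<open>h k\<close> is \<open>(y / f) ^ k * f\<close>.\<close>
    define h where "h k = (\<eta> ^^ k) f" for k
    have hP: "h k \<in> P" for k by (induction k) (use f \<beta> in \<open>auto simp: h_def\<close>)
    have hB: "h k \<in> B" for k using hP PD(1) by auto
    define b where "b k = (\<Prod>i<k. \<beta> (h i))" for k
    have bP: "b k \<in> B - P" for k
      by (induction k) (use prime one \<beta> hP in \<open>auto simp: b_def lessThan_Suc\<close>)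
    have rel: "b k * f * y ^ k = f ^ k * h k" for k
    proof (induction k)
      case (Suc k)
      have "b (Suc k) * f * y ^ Suc k = \<beta> (h k) * y * (b k * f * y ^ k)"
        by (simp add: b_def lessThan_Suc algebra_simps)
      also have "\<dots> = f ^ k * (\<beta> (h k) * h k * y)" by (simp only: Suc) (simp add: algebra_simps)
      also have "\<dots> = f ^ Suc k * h (Suc k)" using \<beta>[OF hP[of k]] by (simp add: h_def algebra_simps)
      finally show ?case .
    qed (simp add: b_def h_def)
    \<comment> \<open>The contraction of the ideal generated by \<open>h 0, \<dots>, h (k - 1)\<close> in the localization.\<close>
    define I where "I k = {g\<in>B. \<exists>d\<in>B - P. \<exists>c. (\<forall>j. c j \<in> B) \<and> d * g = (\<Sum>j<k. c j * h j)}" for k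
    have "ideal_in B (I k)" for k
    proof -
      have eq: "I k = {g\<in>B. \<exists>d\<in>B - P. d * g * 1 \<in> {\<Sum>j<k. c j * h j |c. \<forall>j. c j \<in> B}}"
        unfolding I_def mult_1_right by blast
      show ?thesis unfolding eq by (rule localized_colon_ideal[OF B P generated_ideal[OF B hB]])
    qed
    moreover have "I k \<subseteq> I (Suc k)" for k
    proof
      fix g assume "g \<in> I k"
      then obtain d c where h: "d \<in> B - P" "\<forall>j. c j \<in> B" "d * g = (\<Sum>j<k. c j * h j)" "g \<in> B"
        by (auto simp: I_def)
      have "d * g = (\<Sum>j<Suc k. (if j < k then c j else 0) * h j)" unfolding h by simp
      then show "g \<in> I (Suc k)" unfolding I_def using h BD(2)
        by (intro CollectI conjI bexI[of _ d] exI[of _ "\<lambda>j. if j < k then c j else 0"]) auto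
    qed
    ultimately obtain K where K: "\<forall>k\<ge>K. I k = I K" using noetherianD[OF N, of I] by blast
    have "h K \<in> I (Suc K)" unfolding I_def using hB one BD(1,2)
      by (intro CollectI conjI bexI[of _ 1] exI[of _ "\<lambda>j. if j = K then 1 else 0"]) auto
    moreover have "I (Suc K) = I K" by (rule K[rule_format]) simp
    ultimately have "h K \<in> I K" by simp
    then obtain d c where dc: "d \<in> B - P" "\<forall>j. c j \<in> B" "d * h K = (\<Sum>j<K. c j * h j)"
      by (auto simp: I_def)
    have "f * (d * b K * y ^ K) = d * (b K * f * y ^ K)" by (simp add: algebra_simps)
    also have "\<dots> = f ^ K * (d * h K)" by (simp only: rel) (simp add: algebra_simps)
    also have "\<dots> = (\<Sum>j<K. f ^ K * (c j * h j))" by (simp only: dc sum_distrib_left)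
    also have "\<dots> = (\<Sum>j<K. f * (c j * b j * y ^ j * f ^ (K - j)))"
    proof (rule sum.cong[OF refl])
      fix j assume "j \<in> {..<K}"
      then have "f ^ K = f ^ (K - j) * f ^ j" by (simp flip: power_add)
      then have "f ^ K * (c j * h j) = f ^ (K - j) * c j * (f ^ j * h j)" by (simp add: algebra_simps)
      also have "\<dots> = f * (c j * b j * y ^ j * f ^ (K - j))" by (simp only: rel[symmetric]) (simp add: algebra_simps)
      finally show "f ^ K * (c j * h j) = f * (c j * b j * y ^ j * f ^ (K - j))" .
    qed
    also have "\<dots> = f * (\<Sum>j<K. c j * b j * y ^ j * f ^ (K - j))" by (simp only: sum_distrib_left)
    finally have eq: "f * (d * b K * y ^ K) = f * (\<Sum>j<K. c j * b j * y ^ j * f ^ (K - j))" .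
    have bB: "b k \<in> B" and dB: "d \<in> B" and cB: "c j \<in> B" for k j using bP dc by auto
    have "d * b K * y ^ K \<in> B" by (intro BD(4) ring_set_power[OF B] bB dB y(1))
    moreover have "(\<Sum>j<K. c j * b j * y ^ j * f ^ (K - j)) \<in> B"
      by (intro ring_set_sum[OF B] BD(4) ring_set_power[OF B] bB cB y(1) fB)
    ultimately have "d * b K * y ^ K = (\<Sum>j<K. c j * b j * y ^ j * f ^ (K - j))"
      using cancel[OF fB f(2) _ _ eq] by blast
    moreover have "d * b K \<in> B - P" using prime[OF dc(1) bP] .
    moreover have "c j * b j \<in> B" for j by (intro BD(4) bB cB)
    ultimately have "\<exists>b'\<in>B - P. \<exists>a\<in>B. b' * y = f * a"
      using int_closed[OF y(1) fB f(2), of "d * b K" "\<lambda>j. c j * b j" K] by blast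
    then show False using nl by blast
  qed
  then obtain u b0 a0 where u: "u \<in> P" "b0 \<in> B - P" "a0 \<in> B - P" "b0 * u * y = f * a0" by blast
  have uB: "u \<in> B" using PD(1) u by auto
  have ynz: "y \<noteq> 0" using nl[OF one BD(2)] by auto
  have divides: "\<exists>b\<in>B - P. \<exists>a\<in>B. b * g = u * a" if g: "g \<in> P" for g
  proof -
    obtain b a where ba: "b \<in> B - P" "a \<in> B" "b * g * y = f * a" using colon[OF g] by blast
    have gB: "g \<in> B" using PD(1) g by auto
    have "(f * y) * (b * a0 * g) = (b * g * y) * (f * a0)" by (simp add: algebra_simps)
    also have "\<dots> = (f * a) * (b0 * u * y)" by (simp only: ba u)
    also have "\<dots> = (f * y) * (u * (a * b0))" by (simp add: algebra_simps)
    finally have "b * a0 * g = u * (a * b0)"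
      by (rule cancel[rotated 4]) (use dom[OF fB y(1)] f ynz ba u uB gB y fB BD(4) in auto)
    moreover have "b * a0 \<in> B - P" "a * b0 \<in> B" using ba u prime BD(4) by auto
    ultimately show ?thesis by blast
  qed
    have "\<exists>m. \<exists>a\<in>B - P. \<exists>b\<in>B - P. b * g = u ^ m * a" if g: "g \<in> B" "g \<noteq> 0" for g
  proof (rule ccontr)
    assume neg: "\<not> ?thesis"
    have "\<exists>a\<in>B. \<exists>b\<in>B - P. b * g = u ^ m * a" for m
    proof (induction m)
      case 0
      then show ?case using g one by (intro bexI[of _ g] bexI[of _ 1]) auto
    next
      case (Suc m)
      then obtain a b where ab: "a \<in> B" "b \<in> B - P" "b * g = u ^ m * a" by blast
      then have "a \<in> P" using neg by blast
      then obtain b' a' where b': "b' \<in> B - P" "a' \<in> B" "b' * a = u * a'" using divides by blast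
      have "(b' * b) * g = u ^ m * (b' * a)" using ab(3) by (simp add: algebra_simps)
      then have "(b' * b) * g = u ^ Suc m * a'" by (simp only: b') (simp add: algebra_simps)
      then show ?case using b' ab prime by blast
    qed
    then obtain a b where ab: "\<And>m. a m \<in> B" "\<And>m. b m \<in> B - P" "\<And>m. b m * g = u ^ m * a m" by metis
    \<comment> \<open>The contraction of the fractional ideal generated by \<open>g / u ^ m\<close>.\<close>
    define I where "I m = {h\<in>B. \<exists>d\<in>B - P. \<exists>c\<in>B. d * u ^ m * h = c * g}" for m
    have "ideal_in B (I m)" for m
    proof -
      have eq: "I m = {h\<in>B. \<exists>d\<in>B - P. d * h * u ^ m \<in> {g * c |c. c \<in> B}}"
        unfolding I_def by (simp only: mult_ac) blast
      show ?thesis unfolding eq by (rule localized_colon_ideal[OF B P principal_ideal[OF B g(1)]])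
    qed
    moreover have "I m \<subseteq> I (Suc m)" for m
    proof
      fix h assume "h \<in> I m"
      then obtain d c where h: "d \<in> B - P" "c \<in> B" "d * u ^ m * h = c * g" "h \<in> B" by (auto simp: I_def)
      have "d * u ^ Suc m * h = u * (d * u ^ m * h)" by (simp add: algebra_simps)
      also have "\<dots> = (u * c) * g" by (simp only: h) (simp add: algebra_simps)
      finally show "h \<in> I (Suc m)" unfolding I_def using h uB BD(4)
        by (intro CollectI conjI bexI[of _ d] bexI[of _ "u * c"]) auto
    qed
    ultimately obtain K where K: "\<forall>m\<ge>K. I m = I K" using noetherianD[OF N, of I] by blast
    have "1 * u ^ Suc K * a (Suc K) = b (Suc K) * g" by (simp add: ab(3))
    then have "a (Suc K) \<in> I (Suc K)" unfolding I_def using one ab(1,2) by blast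
    moreover have "I (Suc K) = I K" by (rule K[rule_format]) simp
    ultimately have "a (Suc K) \<in> I K" by simp
    then obtain d c where dc: "d \<in> B - P" "c \<in> B" "d * u ^ K * a (Suc K) = c * g" by (auto simp: I_def)
    have "g * (d * b (Suc K)) = d * (b (Suc K) * g)" by (simp add: algebra_simps)
    also have "\<dots> = u * (d * u ^ K * a (Suc K))" by (simp only: ab(3)) (simp add: algebra_simps)
    also have "\<dots> = g * (c * u)" by (simp only: dc) (simp add: algebra_simps)
    finally have "d * b (Suc K) = c * u"
      by (rule cancel[OF g, rotated 2]) (use dc ab uB BD(4) in auto)
    moreover have "d * b (Suc K) \<in> B - P" using prime dc ab by auto
    moreover have "c * u \<in> P" using PD(4) dc u by auto
    ultimately show False by auto
  qed
  then show ?thesis using u(1) by blast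
qed

section \<open>Spaces of local fractions\<close>

text \<open>
  A space whose topology and regular functions are given by local fractions of a ring \<open>R\<close> of globally
  defined functions. Affine varieties and the torus are of this form, and all local arguments below use
  only this description.
\<close>

locale fraction_functions =
  fixes X :: "('a, 'k::field) fun_space" and R :: "('a \<Rightarrow> 'k) set"
  assumes ring: "ring_set R" and const_in: "(\<lambda>x. c) \<in> R"
    and open_iff: "openin (zariski X) U \<longleftrightarrow>
      U \<subseteq> points X \<and> (\<forall>x\<in>U. \<exists>b\<in>R. b x \<noteq> 0 \<and> (\<forall>y\<in>points X. b y \<noteq> 0 \<longrightarrow> y \<in> U))"
    and regular_iff: "regular X U f \<longleftrightarrow> openin (zariski X) U \<and>
      (\<forall>x\<in>U. \<exists>a\<in>R. \<exists>b\<in>R. b x \<noteq> 0 \<and> (\<forall>y\<in>points X. b y \<noteq> 0 \<longrightarrow> y \<in> U \<and> f y = a y / b y))"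
begin

lemmas RD = ring_setD[OF ring]

lemma regular_open: "regular X U f \<Longrightarrow> openin (zariski X) U"
  by (simp add: regular_iff)

lemma open_subset_points: "openin (zariski X) U \<Longrightarrow> U \<subseteq> points X"
  by (rule openin_subset)

lemma open_basic:
  assumes "openin (zariski X) U" "x \<in> U"
  shows "\<exists>b\<in>R. b x \<noteq> 0 \<and> (\<forall>y\<in>points X. b y \<noteq> 0 \<longrightarrow> y \<in> U)"
  using assms by (simp add: open_iff)

lemma regular_fraction:
  assumes "regular X U f" "x \<in> U"
  shows "\<exists>a\<in>R. \<exists>b\<in>R. b x \<noteq> 0 \<and> (\<forall>y\<in>points X. b y \<noteq> 0 \<longrightarrow> y \<in> U \<and> f y = a y / b y)"
  using assms by (simp add: regular_iff)

lemma regularE: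
  assumes "regular X U f" "x \<in> U"
  obtains a b where "a \<in> R" "b \<in> R" "b x \<noteq> 0" "a x = f x * b x"
    "\<And>y. y \<in> points X \<Longrightarrow> b y \<noteq> 0 \<Longrightarrow> y \<in> U" "\<And>y. y \<in> points X \<Longrightarrow> b y \<noteq> 0 \<Longrightarrow> f y = a y / b y"
proof -
  obtain a b where ab: "a \<in> R" "b \<in> R" "b x \<noteq> 0"
    "\<And>y. y \<in> points X \<Longrightarrow> b y \<noteq> 0 \<Longrightarrow> y \<in> U \<and> f y = a y / b y" using regular_fraction[OF assms] by blast
  have "x \<in> points X" using open_subset_points[OF regular_open[OF assms(1)]] assms(2) by blast
  then have "a x = f x * b x" using ab(3) ab(4)[of x] by simp
  then show thesis using that ab by blast
qed

lemma regularI_fraction: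
  assumes "openin (zariski X) U"
    and "\<And>x. x \<in> U \<Longrightarrow> \<exists>a b. a \<in> R \<and> b \<in> R \<and> b x \<noteq> 0 \<and> (\<forall>y\<in>points X. b y \<noteq> 0 \<longrightarrow> y \<in> U \<and> f y = a y / b y)"
  shows "regular X U f"
  unfolding regular_iff using assms by (simp add: Bex_def)

lemma regularI:
  assumes "openin (zariski X) U"
    and "\<And>x. x \<in> U \<Longrightarrow> \<exists>V g. x \<in> V \<and> regular X V g \<and> (\<forall>y\<in>U \<inter> V. f y = g y)"
  shows "regular X U f"
proof (rule regularI_fraction[OF assms(1)])
  fix x assume x: "x \<in> U"
  then obtain V g where V: "x \<in> V" "regular X V g" "\<forall>y\<in>U \<inter> V. f y = g y" using assms(2) by blast
  obtain a b where ab: "a \<in> R" "b \<in> R" "b x \<noteq> 0" "\<And>y. y \<in> points X \<Longrightarrow> b y \<noteq> 0 \<Longrightarrow> y \<in> V"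
    "\<And>y. y \<in> points X \<Longrightarrow> b y \<noteq> 0 \<Longrightarrow> g y = a y / b y" using regularE[OF V(2,1)] by metis
  obtain b' where b': "b' \<in> R" "b' x \<noteq> 0" "\<forall>y\<in>points X. b' y \<noteq> 0 \<longrightarrow> y \<in> U"
    using open_basic[OF assms(1) x] by blast
  have "a * b' \<in> R" "b * b' \<in> R" by (intro RD(4) ab(1,2) b'(1))+
  then show "\<exists>a b. a \<in> R \<and> b \<in> R \<and> b x \<noteq> 0 \<and> (\<forall>y\<in>points X. b y \<noteq> 0 \<longrightarrow> y \<in> U \<and> f y = a y / b y)"
    using ab b' V(3) by (intro exI[of _ "a * b'"] exI[of _ "b * b'"]) auto
qed

lemma regular_cong:
  assumes "regular X U f" "\<And>x. x \<in> U \<Longrightarrow> f x = g x"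
  shows "regular X U g"
proof (rule regularI[OF regular_open[OF assms(1)]])
  fix x assume "x \<in> U"
  then show "\<exists>V h. x \<in> V \<and> regular X V h \<and> (\<forall>y\<in>U \<inter> V. g y = h y)"
    using assms by (intro exI[of _ U] exI[of _ f]) simp
qed

lemma regular_subset:
  assumes "regular X U f" "openin (zariski X) V" "V \<subseteq> U"
  shows "regular X V f"
proof (rule regularI[OF assms(2)])
  fix x assume "x \<in> V"
  then show "\<exists>W h. x \<in> W \<and> regular X W h \<and> (\<forall>y\<in>V \<inter> W. f y = h y)"
    using assms by (intro exI[of _ U] exI[of _ f]) auto
qed

lemma regular_of_R:
  assumes "a \<in> R" "openin (zariski X) U"
  shows "regular X U a"
proof (rule regularI_fraction[OF assms(2)])
  fix x assume "x \<in> U"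
  then obtain b where b: "b \<in> R" "b x \<noteq> 0" "\<forall>y\<in>points X. b y \<noteq> 0 \<longrightarrow> y \<in> U"
    using open_basic[OF assms(2)] by blast
  have "a * b \<in> R" by (intro RD(4) assms(1) b(1))
  then show "\<exists>a' b. a' \<in> R \<and> b \<in> R \<and> b x \<noteq> 0 \<and> (\<forall>y\<in>points X. b y \<noteq> 0 \<longrightarrow> y \<in> U \<and> a y = a' y / b y)"
    using b by (intro exI[of _ "a * b"] exI[of _ b]) auto
qed

lemma regular_const: "openin (zariski X) U \<Longrightarrow> regular X U (\<lambda>x. c)"
  by (intro regular_of_R const_in)

lemma regular_add:
  assumes f: "regular X U f" and g: "regular X U g"
  shows "regular X U (\<lambda>x. f x + g x)"
proof (rule regularI_fraction[OF regular_open[OF f]])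
  fix x assume x: "x \<in> U"
  obtain a b where ab: "a \<in> R" "b \<in> R" "b x \<noteq> 0" "\<And>y. y \<in> points X \<Longrightarrow> b y \<noteq> 0 \<Longrightarrow> y \<in> U"
    "\<And>y. y \<in> points X \<Longrightarrow> b y \<noteq> 0 \<Longrightarrow> f y = a y / b y" using regularE[OF f x] by metis
  obtain a' b' where ab': "a' \<in> R" "b' \<in> R" "b' x \<noteq> 0" 
    "\<And>y. y \<in> points X \<Longrightarrow> b' y \<noteq> 0 \<Longrightarrow> g y = a' y / b' y" using regularE[OF g x] by metis
  have "a * b' + a' * b \<in> R" "b * b' \<in> R" by (intro RD(4,6) ab(1,2) ab'(1,2))+
  moreover have "f y + g y = (a * b' + a' * b) y / (b * b') y" if "y \<in> points X" "(b * b') y \<noteq> 0" for y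
    using that(2) by (simp add: ab(5)[OF that(1)] ab'(4)[OF that(1)] field_simps)
  ultimately show "\<exists>a b. a \<in> R \<and> b \<in> R \<and> b x \<noteq> 0 \<and> (\<forall>y\<in>points X. b y \<noteq> 0 \<longrightarrow> y \<in> U \<and> f y + g y = a y / b y)"
    using ab(3,4) ab'(3) by (intro exI[of _ "a * b' + a' * b"] exI[of _ "b * b'"]) auto
qed

lemma regular_mult:
  assumes f: "regular X U f" and g: "regular X U g"
  shows "regular X U (\<lambda>x. f x * g x)"
proof (rule regularI_fraction[OF regular_open[OF f]])
  fix x assume x: "x \<in> U"
  obtain a b where ab: "a \<in> R" "b \<in> R" "b x \<noteq> 0" "\<And>y. y \<in> points X \<Longrightarrow> b y \<noteq> 0 \<Longrightarrow> y \<in> U"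
    "\<And>y. y \<in> points X \<Longrightarrow> b y \<noteq> 0 \<Longrightarrow> f y = a y / b y" using regularE[OF f x] by metis
  obtain a' b' where ab': "a' \<in> R" "b' \<in> R" "b' x \<noteq> 0" 
    "\<And>y. y \<in> points X \<Longrightarrow> b' y \<noteq> 0 \<Longrightarrow> g y = a' y / b' y" using regularE[OF g x] by metis
  have "a * a' \<in> R" "b * b' \<in> R" by (intro RD(4,6) ab(1,2) ab'(1,2))+
  moreover have "f y * g y = (a * a') y / (b * b') y" if "y \<in> points X" "(b * b') y \<noteq> 0" for y
    using that(2) by (simp add: ab(5)[OF that(1)] ab'(4)[OF that(1)] field_simps)
  ultimately show "\<exists>a b. a \<in> R \<and> b \<in> R \<and> b x \<noteq> 0 \<and> (\<forall>y\<in>points X. b y \<noteq> 0 \<longrightarrow> y \<in> U \<and> f y * g y = a y / b y)"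
    using ab(3,4) ab'(3) by (intro exI[of _ "a * a'"] exI[of _ "b * b'"]) auto
qed

lemma regular_inverse:
  assumes f: "regular X U f" and nz: "\<And>x. x \<in> U \<Longrightarrow> f x \<noteq> 0"
  shows "regular X U (\<lambda>x. inverse (f x))"
proof (rule regularI_fraction[OF regular_open[OF f]])
  fix x assume x: "x \<in> U"
  obtain a b where ab: "a \<in> R" "b \<in> R" "b x \<noteq> 0" "a x = f x * b x" "\<And>y. y \<in> points X \<Longrightarrow> b y \<noteq> 0 \<Longrightarrow> y \<in> U"
    "\<And>y. y \<in> points X \<Longrightarrow> b y \<noteq> 0 \<Longrightarrow> f y = a y / b y" using regularE[OF f x] by metis
  have "b * b \<in> R" "a * b \<in> R" by (intro RD(4) ab(1,2))+
  moreover have "inverse (f y) = (b * b) y / (a * b) y" if "y \<in> points X" "(a * b) y \<noteq> 0" for y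
    using that(2) by (simp add: ab(6)[OF that(1)])
  moreover have "(a * b) x \<noteq> 0" using ab(3,4) nz[OF x] by simp
  ultimately show "\<exists>a b. a \<in> R \<and> b \<in> R \<and> b x \<noteq> 0 \<and> (\<forall>y\<in>points X. b y \<noteq> 0 \<longrightarrow> y \<in> U \<and> inverse (f y) = a y / b y)"
    using ab(5) by (intro exI[of _ "b * b"] exI[of _ "a * b"]) auto
qed

lemma regular_divide:
  "regular X U f \<Longrightarrow> regular X U g \<Longrightarrow> (\<And>x. x \<in> U \<Longrightarrow> g x \<noteq> 0) \<Longrightarrow> regular X U (\<lambda>x. f x / g x)"
  unfolding divide_inverse by (intro regular_mult regular_inverse)

lemma regular_minus: "regular X U f \<Longrightarrow> regular X U (\<lambda>x. - f x)"
  using regular_mult[OF regular_const[OF regular_open, of U f "- 1"]] by auto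

lemma regular_diff: "regular X U f \<Longrightarrow> regular X U g \<Longrightarrow> regular X U (\<lambda>x. f x - g x)"
  using regular_add[OF _ regular_minus, of U f g] by simp

lemma regular_sum:
  assumes "openin (zariski X) U"
  shows "(\<And>i. i \<in> I \<Longrightarrow> regular X U (f i)) \<Longrightarrow> regular X U (\<lambda>x. \<Sum>i\<in>I. f i x)"
  by (induction I rule: infinite_finite_induct) (auto intro: regular_const assms regular_add)

lemma regular_power: "regular X U f \<Longrightarrow> regular X U (\<lambda>x. f x ^ n)"
  by (induction n) (auto intro: regular_const regular_open regular_mult)

lemma nonvanishing_open:
  assumes f: "regular X U f"
  shows "openin (zariski X) {x\<in>U. f x \<noteq> 0}"
  unfolding open_iff
proof (intro conjI ballI)
  show "{x\<in>U. f x \<noteq> 0} \<subseteq> points X" using open_subset_points[OF regular_open[OF assms]] by auto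
  fix x assume x: "x \<in> {x\<in>U. f x \<noteq> 0}"
  then obtain a b where ab: "a \<in> R" "b \<in> R" "b x \<noteq> 0" "a x = f x * b x"
    "\<And>y. y \<in> points X \<Longrightarrow> b y \<noteq> 0 \<Longrightarrow> y \<in> U" "\<And>y. y \<in> points X \<Longrightarrow> b y \<noteq> 0 \<Longrightarrow> f y = a y / b y"
    using regularE[OF f, of x] by auto
  have "a * b \<in> R" by (intro RD(4) ab(1,2))
  then show "\<exists>b\<in>R. b x \<noteq> 0 \<and> (\<forall>y\<in>points X. b y \<noteq> 0 \<longrightarrow> y \<in> {x\<in>U. f x \<noteq> 0})"
    using ab x by (intro bexI[of _ "a * b"]) auto
qed

lemma vanishing_closed:
  assumes "regular X (points X) f"
  shows "closedin (zariski X) {x\<in>points X. f x = 0}"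
proof -
  have "{x\<in>points X. f x = 0} = points X - {x\<in>points X. f x \<noteq> 0}" by auto
  then show ?thesis using nonvanishing_open[OF assms] by (simp add: closedin_diff)
qed

lemma regular_prime:
  assumes "irreducible_in (zariski X) Z" and f: "regular X (points X) f" and g: "regular X (points X) g"
    and z: "\<And>x. x \<in> Z \<Longrightarrow> f x * g x = 0"
  shows "(\<forall>x\<in>Z. f x = 0) \<or> (\<forall>x\<in>Z. g x = 0)"
proof -
  have "Z \<subseteq> points X" using assms(1) by (auto simp: irreducible_in_def)
  then have "Z \<subseteq> {x\<in>points X. f x = 0} \<union> {x\<in>points X. g x = 0}" using z by auto
  then have "Z \<subseteq> {x\<in>points X. f x = 0} \<or> Z \<subseteq> {x\<in>points X. g x = 0}"
    using assms(1) vanishing_closed[OF f] vanishing_closed[OF g] unfolding irreducible_in_def by blast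
  then show ?thesis by blast
qed

text \<open>
  The identity principle: regular functions that agree on a nonempty open set agree everywhere, because
  on an irreducible space that set is dense.
\<close>

lemma regular_agree:
  assumes irr: "irreducible_space X" and f: "regular X (points X) f" and g: "regular X (points X) g"
    and W: "openin (zariski X) W" "W \<noteq> {}" "\<And>x. x \<in> W \<Longrightarrow> f x = g x" and x: "x \<in> points X"
  shows "f x = g x"
proof -
  have "closedin (zariski X) {x\<in>points X. f x - g x = 0}" by (intro vanishing_closed regular_diff f g)
  moreover have "closedin (zariski X) (points X - W)" using W(1) by (simp add: closedin_diff)
  moreover have "points X \<subseteq> {x\<in>points X. f x - g x = 0} \<union> (points X - W)" using W(3) by auto
  ultimately have "points X \<subseteq> {x\<in>points X. f x - g x = 0} \<or> points X \<subseteq> points X - W"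
    using irr unfolding irreducible_in_def by blast
  then show ?thesis using x W(2) open_subset_points[OF W(1)] by auto
qed

lemma morphism_from_fractions:
  assumes Y: "fraction_functions Y S" and maps: "\<And>x. x \<in> points X \<Longrightarrow> \<alpha> x \<in> points Y"
    and reg: "\<And>b. b \<in> S \<Longrightarrow> regular X (points X) (\<lambda>x. b (\<alpha> x))"
  shows "morphism X Y \<alpha>"
proof -
  interpret Y: fraction_functions Y S by (rule Y)
  have pre: "openin (zariski X) {x\<in>points X. \<alpha> x \<in> V}" if V: "openin (zariski Y) V" for V
  proof (subst openin_subopen, intro ballI)
    fix x assume x: "x \<in> {x\<in>points X. \<alpha> x \<in> V}"
    then obtain b where b: "b \<in> S" "b (\<alpha> x) \<noteq> 0" "\<forall>y\<in>points Y. b y \<noteq> 0 \<longrightarrow> y \<in> V"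
      using Y.open_basic[OF V, of "\<alpha> x"] by blast
    show "\<exists>T. openin (zariski X) T \<and> x \<in> T \<and> T \<subseteq> {x\<in>points X. \<alpha> x \<in> V}"
      using nonvanishing_open[OF reg[OF b(1)]] b x maps
      by (intro exI[of _ "{x\<in>points X. b (\<alpha> x) \<noteq> 0}"]) auto
  qed
  show ?thesis
    unfolding morphism_def continuous_map_def
  proof (intro conjI allI impI pre)
    show "\<alpha> \<in> points X \<rightarrow> points Y" using maps by auto
    fix V f assume f: "regular Y V f"
    show "regular X {x\<in>points X. \<alpha> x \<in> V} (f \<circ> \<alpha>)"
    proof (rule regularI)
      show "openin (zariski X) {x\<in>points X. \<alpha> x \<in> V}" by (rule pre[OF Y.regular_open[OF f]])
      fix x assume x: "x \<in> {x\<in>points X. \<alpha> x \<in> V}"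
      then obtain a b where ab: "a \<in> S" "b \<in> S" "b (\<alpha> x) \<noteq> 0"
        "\<forall>y\<in>points Y. b y \<noteq> 0 \<longrightarrow> y \<in> V \<and> f y = a y / b y"
        using Y.regularE[OF f, of "\<alpha> x"] by (metis (lifting) mem_Collect_eq)
      let ?W = "{x\<in>points X. b (\<alpha> x) \<noteq> 0}"
      have W: "openin (zariski X) ?W" by (rule nonvanishing_open[OF reg[OF ab(2)]])
      have "regular X ?W (\<lambda>x. a (\<alpha> x) / b (\<alpha> x))"
        by (intro regular_divide regular_subset[OF reg[OF ab(1)] W] regular_subset[OF reg[OF ab(2)] W]) auto
      then show "\<exists>W g. x \<in> W \<and> regular X W g \<and> (\<forall>y\<in>{x\<in>points X. \<alpha> x \<in> V} \<inter> W. (f \<circ> \<alpha>) y = g y)"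
        using x ab maps by (intro exI[of _ ?W] exI[of _ "\<lambda>x. a (\<alpha> x) / b (\<alpha> x)"]) auto
    qed
  qed
qed

end

lemma morphism_comp:
  assumes "morphism X Y \<alpha>" "morphism Y Z \<beta>"
  shows "morphism X Z (\<beta> \<circ> \<alpha>)"
  unfolding morphism_def
proof (intro conjI allI impI)
  show "continuous_map (zariski X) (zariski Z) (\<beta> \<circ> \<alpha>)"
    using assms by (auto simp: morphism_def intro: continuous_map_compose)
  fix V f assume "regular Z V f"
  then have "regular X {x\<in>points X. \<alpha> x \<in> {y\<in>points Y. \<beta> y \<in> V}} ((f \<circ> \<beta>) \<circ> \<alpha>)"
    using assms unfolding morphism_def by blast
  moreover have "{x\<in>points X. \<alpha> x \<in> {y\<in>points Y. \<beta> y \<in> V}} = {x\<in>points X. (\<beta> \<circ> \<alpha>) x \<in> V}"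
    using assms(1) by (auto simp: morphism_def continuous_map_def)
  ultimately show "regular X {x\<in>points X. (\<beta> \<circ> \<alpha>) x \<in> V} (f \<circ> (\<beta> \<circ> \<alpha>))" by (simp add: comp_assoc)
qed

lemma morphism_points: "morphism X Y \<alpha> \<Longrightarrow> x \<in> points X \<Longrightarrow> \<alpha> x \<in> points Y"
  by (auto simp: morphism_def continuous_map_def)

lemma morphism_regular:
  assumes "morphism X Y \<alpha>" "regular Y (points Y) f"
  shows "regular X (points X) (\<lambda>x. f (\<alpha> x))"
proof -
  have "{x\<in>points X. \<alpha> x \<in> points Y} = points X" using morphism_points[OF assms(1)] by auto
  then show ?thesis using assms by (metis (no_types, lifting) comp_def ext morphism_def)
qed

text \<open>
  The sets where an element of \<open>R\<close> does not vanish are closed under finite intersections, so this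
  subbasis is a basis.
\<close>

lemma fraction_space_single:
  fixes R :: "('a \<Rightarrow> 'k::field) set" and Z :: "'a set"
  assumes R: "ring_set R" and c: "\<And>c. (\<lambda>x. c) \<in> R"
  defines "S \<equiv> fraction_space (\<lambda>U. if U = Z then R else {})"
  shows "points S = Z" "fraction_functions S R"
proof -
  let ?B = "\<lambda>U. if U = Z then R else {}"
  let ?T = "fraction_topology ?B"
  have T: "?T = topology_generated_by {{x\<in>Z. b x \<noteq> 0} |b. b \<in> R}"
  proof -
    have "{{x \<in> U. b x \<noteq> 0} |U b. b \<in> ?B U} = {{x\<in>Z. b x \<noteq> 0} |b. b \<in> R}" by (auto split: if_splits)
    then show ?thesis by (simp add: fraction_topology_def)
  qed
  have S: "zariski S = ?T" by (simp add: S_def fraction_space_def)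
  have Z: "topspace ?T = Z"
  proof -
    have "{x\<in>Z. (1::'a \<Rightarrow> 'k) x \<noteq> 0} \<in> {{x\<in>Z. b x \<noteq> 0} |b. b \<in> R}" using ring_setD(1)[OF R] by blast
    then show ?thesis unfolding T by auto
  qed
  then show pZ: "points S = Z" by (simp add: S)
  have basic: "openin ?T {x\<in>Z. b x \<noteq> 0}" if "b \<in> R" for b
    unfolding T using that by (intro topology_generated_by_Basis) auto
  have op: "openin ?T U \<longleftrightarrow> U \<subseteq> Z \<and> (\<forall>x\<in>U. \<exists>b\<in>R. b x \<noteq> 0 \<and> (\<forall>y\<in>Z. b y \<noteq> 0 \<longrightarrow> y \<in> U))" for U
  proof
    assume U: "openin ?T U"
    then have "generate_topology_on {{x\<in>Z. b x \<noteq> 0} |b. b \<in> R} U" by (simp add: T openin_topology_generated_by_iff)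
    then have "\<forall>x\<in>U. \<exists>b\<in>R. b x \<noteq> 0 \<and> (\<forall>y\<in>Z. b y \<noteq> 0 \<longrightarrow> y \<in> U)"
    proof induction
      case (Int U V)
      show ?case
      proof
        fix x assume x: "x \<in> U \<inter> V"
        then have "x \<in> U" "x \<in> V" by auto
        from bspec[OF Int.IH(1) this(1)] bspec[OF Int.IH(2) this(2)]
        obtain b b' where b: "b \<in> R" "b x \<noteq> 0" "\<forall>y\<in>Z. b y \<noteq> 0 \<longrightarrow> y \<in> U"
           "b' \<in> R" "b' x \<noteq> 0" "\<forall>y\<in>Z. b' y \<noteq> 0 \<longrightarrow> y \<in> V" by blast
        have "b * b' \<in> R" by (rule ring_setD(4)[OF R b(1,4)])
        then show "\<exists>b\<in>R. b x \<noteq> 0 \<and> (\<forall>y\<in>Z. b y \<noteq> 0 \<longrightarrow> y \<in> U \<inter> V)"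
          using b by (intro bexI[of _ "b * b'"]) auto
      qed
    next
      case (UN K)
      show ?case
      proof
        fix x assume "x \<in> \<Union>K"
        then obtain k where k: "k \<in> K" "x \<in> k" by blast
        then obtain b where "b \<in> R" "b x \<noteq> 0" "\<forall>y\<in>Z. b y \<noteq> 0 \<longrightarrow> y \<in> k" using UN.IH[OF k(1)] by blast
        then show "\<exists>b\<in>R. b x \<noteq> 0 \<and> (\<forall>y\<in>Z. b y \<noteq> 0 \<longrightarrow> y \<in> \<Union>K)" using k by blast
      qed
    next
      case (Basis s)
      then show ?case by blast
    qed auto
    then show "U \<subseteq> Z \<and> (\<forall>x\<in>U. \<exists>b\<in>R. b x \<noteq> 0 \<and> (\<forall>y\<in>Z. b y \<noteq> 0 \<longrightarrow> y \<in> U))"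
      using openin_subset[OF U] Z by auto
  next
    assume U: "U \<subseteq> Z \<and> (\<forall>x\<in>U. \<exists>b\<in>R. b x \<noteq> 0 \<and> (\<forall>y\<in>Z. b y \<noteq> 0 \<longrightarrow> y \<in> U))"
    show "openin ?T U"
    proof (subst openin_subopen, intro ballI)
      fix x assume "x \<in> U"
      then obtain b where "b \<in> R" "b x \<noteq> 0" "\<forall>y\<in>Z. b y \<noteq> 0 \<longrightarrow> y \<in> U" "x \<in> Z" using U by blast
      then show "\<exists>T. openin ?T T \<and> x \<in> T \<and> T \<subseteq> U"
        using basic by (intro exI[of _ "{x\<in>Z. b x \<noteq> 0}"]) auto
    qed
  qed
  have reg: "regular S U f \<longleftrightarrow> openin ?T U \<and>
      (\<forall>x\<in>U. \<exists>a\<in>R. \<exists>b\<in>R. b x \<noteq> 0 \<and> (\<forall>y\<in>Z. b y \<noteq> 0 \<longrightarrow> y \<in> U \<and> f y = a y / b y))" for U f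
  proof -
    have eq: "(\<exists>V N a b. a \<in> ?B V \<and> b \<in> ?B V \<and> openin ?T N \<and> x \<in> N \<and> N \<subseteq> V \<inter> U \<and> (\<forall>y\<in>N. b y \<noteq> 0 \<and> f y = a y / b y))
      \<longleftrightarrow> (\<exists>a\<in>R. \<exists>b\<in>R. b x \<noteq> 0 \<and> (\<forall>y\<in>Z. b y \<noteq> 0 \<longrightarrow> y \<in> U \<and> f y = a y / b y))"
      (is "?l \<longleftrightarrow> ?r") if x: "x \<in> U" "U \<subseteq> Z" for x
    proof
      assume ?l
      then obtain V N a b where h: "a \<in> ?B V" "b \<in> ?B V" "openin ?T N" "x \<in> N" "N \<subseteq> V \<inter> U"
        "\<forall>y\<in>N. b y \<noteq> 0 \<and> f y = a y / b y" by blast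
      then have "V = Z" by (cases "V = Z") auto
      then have ab: "a \<in> R" "b \<in> R" "N \<subseteq> U" using h by auto
      obtain b' where b': "b' \<in> R" "b' x \<noteq> 0" "\<forall>y\<in>Z. b' y \<noteq> 0 \<longrightarrow> y \<in> N"
        using op[of N] h(3,4) by blast
      have "a * b' \<in> R" "b * b' \<in> R" using ring_setD(4)[OF R] ab(1,2) b'(1) by blast+
      moreover have "(b * b') x \<noteq> 0" using b' h(4,6) by simp
      moreover have "y \<in> U \<and> f y = (a * b') y / (b * b') y" if "y \<in> Z" "(b * b') y \<noteq> 0" for y
      proof -
        have "b' y \<noteq> 0" using that(2) by auto
        then have "y \<in> N" using b'(3) that(1) by blast
        then show ?thesis using ab(3) h(6) \<open>b' y \<noteq> 0\<close> by auto
      qed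
      ultimately show ?r by blast
    next
      assume ?r
      then obtain a b where ab: "a \<in> R" "b \<in> R" "b x \<noteq> 0" "\<forall>y\<in>Z. b y \<noteq> 0 \<longrightarrow> y \<in> U \<and> f y = a y / b y" by blast
      have "a \<in> ?B Z \<and> b \<in> ?B Z \<and> openin ?T {x\<in>Z. b x \<noteq> 0} \<and> x \<in> {x\<in>Z. b x \<noteq> 0} \<and>
          {x\<in>Z. b x \<noteq> 0} \<subseteq> Z \<inter> U \<and> (\<forall>y\<in>{x\<in>Z. b x \<noteq> 0}. b y \<noteq> 0 \<and> f y = a y / b y)"
        using ab x basic[OF ab(2)] by auto
      then show ?l by blast
    qed
    have "regular S U f \<longleftrightarrow> openin ?T U \<and> (\<forall>x\<in>U. \<exists>V N a b. a \<in> ?B V \<and> b \<in> ?B V \<and> openin ?T N \<and> x \<in> N \<and>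
        N \<subseteq> V \<inter> U \<and> (\<forall>y\<in>N. b y \<noteq> 0 \<and> f y = a y / b y))"
      by (simp only: S_def fraction_space_def fun_space.simps)
    also have "\<dots> \<longleftrightarrow> openin ?T U \<and>
      (\<forall>x\<in>U. \<exists>a\<in>R. \<exists>b\<in>R. b x \<noteq> 0 \<and> (\<forall>y\<in>Z. b y \<noteq> 0 \<longrightarrow> y \<in> U \<and> f y = a y / b y))"
      by (intro conj_cong refl ball_cong eq) (use openin_subset[of ?T U] Z in auto)
    finally show ?thesis .
  qed
  show "fraction_functions S R"
    by (rule fraction_functions.intro[OF R c]) (simp_all only: S Z op reg)
qed

lemma function_sheaf_open:
  assumes "function_sheaf X" "regular X U f"
  shows "openin (zariski X) U"
  by (rule assms(1)[unfolded function_sheaf_def, THEN conjunct1, rule_format, OF assms(2)])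

lemma function_sheaf_glue:
  assumes "function_sheaf X" "openin (zariski X) U"
    "\<And>x. x \<in> U \<Longrightarrow> \<exists>V g. x \<in> V \<and> V \<subseteq> U \<and> regular X V g \<and> (\<forall>y\<in>V. f y = g y)"
  shows "regular X U f"
  by (rule assms(1)[unfolded function_sheaf_def, THEN conjunct2, THEN conjunct1, THEN spec, THEN spec, THEN mp])
    (intro conjI ballI assms(2,3))

lemma morphism_pullback:
  assumes "morphism X Y \<phi>" "regular Y V f"
  shows "regular X {x \<in> points X. \<phi> x \<in> V} (f \<circ> \<phi>)"
  by (rule assms(1)[unfolded morphism_def, THEN conjunct2, THEN spec, THEN spec, THEN mp, OF assms(2)])

text \<open>
  For a space that is only isomorphic to a space of fractions, the sheaf condition is what makes local
  fractions regular.
\<close>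

lemma fraction_functions_transport:
  assumes S: "fraction_functions S Q" and sh: "function_sheaf X" and iso: "isomorphism X S \<phi>"
    and R: "ring_set R" "\<And>c. (\<lambda>x. c) \<in> R"
    and to_Q: "\<And>r. r \<in> R \<Longrightarrow> \<exists>q\<in>Q. \<forall>x\<in>points X. r x = q (\<phi> x)"
    and of_Q: "\<And>q. q \<in> Q \<Longrightarrow> \<exists>r\<in>R. \<forall>x\<in>points X. r x = q (\<phi> x)"
  shows "fraction_functions X R"
proof -
  interpret S: fraction_functions S Q by (rule S)
  obtain \<psi> where mor: "morphism X S \<phi>" "morphism S X \<psi>" and inv: "\<And>x. x \<in> points X \<Longrightarrow> \<psi> (\<phi> x) = x"
    using iso unfolding isomorphism_def by blast
  have pre: "openin (zariski X) {x\<in>points X. \<phi> x \<in> V}" if "openin (zariski S) V" for V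
    using mor(1) that by (auto simp: morphism_def continuous_map_def)
  have pre': "openin (zariski S) {x\<in>points S. \<psi> x \<in> V}" if "openin (zariski X) V" for V
    using mor(2) that by (auto simp: morphism_def continuous_map_def)
  note pt = morphism_points[OF mor(1)]
  have basic: "openin (zariski S) {s\<in>points S. b s \<noteq> 0}" if "b \<in> Q" for b
    by (intro S.nonvanishing_open S.regular_of_R that) simp
  show ?thesis
  proof
    fix U
    show op: "openin (zariski X) U \<longleftrightarrow>
      U \<subseteq> points X \<and> (\<forall>x\<in>U. \<exists>b\<in>R. b x \<noteq> 0 \<and> (\<forall>y\<in>points X. b y \<noteq> 0 \<longrightarrow> y \<in> U))" for U
    proof (intro iffI conjI ballI)
      assume U: "openin (zariski X) U"
      then show Us: "U \<subseteq> points X" by (rule openin_subset)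
      fix x assume x: "x \<in> U"
      then have "\<phi> x \<in> {s\<in>points S. \<psi> s \<in> U}" using Us inv pt by auto
      then obtain b where b: "b \<in> Q" "b (\<phi> x) \<noteq> 0" "\<forall>s\<in>points S. b s \<noteq> 0 \<longrightarrow> \<psi> s \<in> U"
        using S.open_basic[OF pre'[OF U]] by blast
      obtain r where r: "r \<in> R" "\<forall>x\<in>points X. r x = b (\<phi> x)" using of_Q[OF b(1)] by blast
      have "y \<in> U" if "y \<in> points X" "r y \<noteq> 0" for y
        using b(3) pt[OF that(1)] inv[OF that(1)] r(2) that by fastforce
      moreover have "r x \<noteq> 0" using r(2) b(2) x Us by auto
      ultimately show "\<exists>b\<in>R. b x \<noteq> 0 \<and> (\<forall>y\<in>points X. b y \<noteq> 0 \<longrightarrow> y \<in> U)" using r(1) by blast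
    next
      assume U: "U \<subseteq> points X \<and> (\<forall>x\<in>U. \<exists>b\<in>R. b x \<noteq> 0 \<and> (\<forall>y\<in>points X. b y \<noteq> 0 \<longrightarrow> y \<in> U))"
      show "openin (zariski X) U"
      proof (subst openin_subopen, intro ballI)
        fix x assume x: "x \<in> U"
        then obtain r where r: "r \<in> R" "r x \<noteq> 0" "\<forall>y\<in>points X. r y \<noteq> 0 \<longrightarrow> y \<in> U" using U by blast
        obtain q where q: "q \<in> Q" "\<forall>x\<in>points X. r x = q (\<phi> x)" using to_Q[OF r(1)] by blast
        show "\<exists>T. openin (zariski X) T \<and> x \<in> T \<and> T \<subseteq> U"
          using pre[OF basic[OF q(1)]] r q x U pt
          by (intro exI[of _ "{x\<in>points X. \<phi> x \<in> {s\<in>points S. q s \<noteq> 0}}"]) auto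
      qed
    qed
    fix f
    show "regular X U f \<longleftrightarrow> openin (zariski X) U \<and>
      (\<forall>x\<in>U. \<exists>a\<in>R. \<exists>b\<in>R. b x \<noteq> 0 \<and> (\<forall>y\<in>points X. b y \<noteq> 0 \<longrightarrow> y \<in> U \<and> f y = a y / b y))"
    proof (intro iffI conjI ballI)
      assume f: "regular X U f"
      then show U: "openin (zariski X) U" by (rule function_sheaf_open[OF sh])
      fix x assume x: "x \<in> U"
      have xp: "x \<in> points X" using openin_subset[OF U] x by auto
      have f\<psi>: "regular S {s\<in>points S. \<psi> s \<in> U} (f \<circ> \<psi>)"
        by (rule mor(2)[unfolded morphism_def, THEN conjunct2, rule_format, OF f])
      have "\<phi> x \<in> {s\<in>points S. \<psi> s \<in> U}" using x xp inv pt by auto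
      from S.regular_fraction[OF f\<psi> this] obtain a b where ab: "a \<in> Q" "b \<in> Q" "b (\<phi> x) \<noteq> 0"
        "\<forall>s\<in>points S. b s \<noteq> 0 \<longrightarrow> s \<in> {s\<in>points S. \<psi> s \<in> U} \<and> (f \<circ> \<psi>) s = a s / b s"
        by (elim bexE conjE)
      obtain a' where a': "a' \<in> R" "\<forall>x\<in>points X. a' x = a (\<phi> x)" using of_Q[OF ab(1)] by blast
      obtain b' where b': "b' \<in> R" "\<forall>x\<in>points X. b' x = b (\<phi> x)" using of_Q[OF ab(2)] by blast
      have "y \<in> U \<and> f y = a' y / b' y" if "y \<in> points X" "b' y \<noteq> 0" for y
      proof -
        have "b (\<phi> y) \<noteq> 0" using b'(2) that by simp
        then show ?thesis
          using bspec[OF ab(4) pt[OF that(1)]] inv[OF that(1)] a'(2) b'(2) that(1) by simp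
      qed
      moreover have "b' x \<noteq> 0" using b'(2) ab(3) xp by auto
      ultimately show "\<exists>a\<in>R. \<exists>b\<in>R. b x \<noteq> 0 \<and> (\<forall>y\<in>points X. b y \<noteq> 0 \<longrightarrow> y \<in> U \<and> f y = a y / b y)"
        using a'(1) b'(1) by blast
    next
      assume U: "openin (zariski X) U \<and>
        (\<forall>x\<in>U. \<exists>a\<in>R. \<exists>b\<in>R. b x \<noteq> 0 \<and> (\<forall>y\<in>points X. b y \<noteq> 0 \<longrightarrow> y \<in> U \<and> f y = a y / b y))"
      have "\<exists>V g. x \<in> V \<and> V \<subseteq> U \<and> regular X V g \<and> (\<forall>y\<in>V. f y = g y)" if x: "x \<in> U" for x
      proof -
        obtain a b where ab: "a \<in> R" "b \<in> R" "b x \<noteq> 0"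
          "\<forall>y\<in>points X. b y \<noteq> 0 \<longrightarrow> y \<in> U \<and> f y = a y / b y" using U x by blast
        obtain a' where a': "a' \<in> Q" "\<forall>x\<in>points X. a x = a' (\<phi> x)" using to_Q[OF ab(1)] by blast
        obtain b' where b': "b' \<in> Q" "\<forall>x\<in>points X. b x = b' (\<phi> x)" using to_Q[OF ab(2)] by blast
        note q = a' b'
        let ?V = "{s\<in>points S. b' s \<noteq> 0}"
        have "regular S ?V (\<lambda>s. a' s / b' s)"
          by (intro S.regular_divide S.regular_of_R a'(1) b'(1) basic[OF b'(1)]) auto
        then have "regular X {x\<in>points X. \<phi> x \<in> ?V} ((\<lambda>s. a' s / b' s) \<circ> \<phi>)"
          by (rule mor(1)[unfolded morphism_def, THEN conjunct2, rule_format])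
        moreover have "x \<in> points X" using openin_subset[of "zariski X" U] U x by auto
        ultimately show ?thesis using ab q pt
          by (intro exI[of _ "{x\<in>points X. \<phi> x \<in> ?V}"] exI[of _ "(\<lambda>s. a' s / b' s) \<circ> \<phi>"]) auto
      qed
      then show "regular X U f"
        by (intro function_sheaf_glue[OF sh conjunct1[OF U]])
    qed
  qed (use R in auto)
qed

section \<open>Charts, prime ideals and prime divisors of affine varieties\<close>

lemma sum_fun_apply: "(\<Sum>i\<in>I. f i) x = (\<Sum>i\<in>I. f i x)" for f :: "'i \<Rightarrow> 'a \<Rightarrow> 'k::comm_ring_1"
  by (induction I rule: infinite_finite_induct) auto

lemma power_fun_apply: "(f ^ n) x = f x ^ n" for f :: "'a \<Rightarrow> 'k::comm_ring_1"
  by (induction n) auto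

text \<open>
  The map \<open>\<chi>\<close> is a chart on the points of \<open>X\<close>, extended to the whole type such that its values stay
  on the image of \<open>X\<close>. Thus a coordinate function that vanishes on \<open>X\<close> is literally zero
  (\<open>B_zero\<close>), and the coordinate ring is a domain inside the ring of all functions.
\<close>

definition coordinate_ring :: "nat \<Rightarrow> ('a \<Rightarrow> nat \<Rightarrow> 'k::field) \<Rightarrow> ('a \<Rightarrow> 'k) set" where
  "coordinate_ring n \<chi> = {p \<circ> \<chi> |p. p \<in> polynomial_functions n}"

lemma coordinate_ring_iff: "p \<in> polynomial_functions n \<Longrightarrow> p \<circ> \<chi> \<in> coordinate_ring n \<chi>"
  by (auto simp: coordinate_ring_def)

lemma coordinate_ring_set: "ring_set (coordinate_ring n \<chi>)"
proof -
  note R = ring_setD[OF polynomial_functions_ring_set[of n]]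
  have "(1 :: (nat \<Rightarrow> 'b) \<Rightarrow> 'b) \<circ> \<chi> \<in> coordinate_ring n \<chi>" by (rule coordinate_ring_iff[OF R(1)])
  moreover have "(1 :: (nat \<Rightarrow> 'b) \<Rightarrow> 'b) \<circ> \<chi> = 1" by (simp add: fun_eq_iff)
  moreover have "a - b \<in> coordinate_ring n \<chi>" "a * b \<in> coordinate_ring n \<chi>"
    if ab: "a \<in> coordinate_ring n \<chi>" "b \<in> coordinate_ring n \<chi>" for a b
  proof -
    obtain p q where pq: "a = p \<circ> \<chi>" "b = q \<circ> \<chi>" "p \<in> polynomial_functions n" "q \<in> polynomial_functions n"
      using ab unfolding coordinate_ring_def by blast
    have "a - b = (p - q) \<circ> \<chi>" "a * b = (p * q) \<circ> \<chi>" unfolding pq(1,2) by (simp_all add: fun_eq_iff)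
    then show "a - b \<in> coordinate_ring n \<chi>" "a * b \<in> coordinate_ring n \<chi>"
      using coordinate_ring_iff[OF R(3)[OF pq(3,4)], of \<chi>] coordinate_ring_iff[OF R(4)[OF pq(3,4)], of \<chi>] by simp_all
  qed
  ultimately show ?thesis unfolding ring_set_def by simp
qed

lemma coordinate_ring_const: "(\<lambda>x. c) \<in> coordinate_ring n \<chi>"
proof -
  have "(\<lambda>x. c) \<circ> \<chi> \<in> coordinate_ring n \<chi>" by (intro coordinate_ring_iff polynomial_functions.const)
  then show ?thesis by (simp add: comp_def)
qed

lemma coordinate_ring_pullback_ideal:
  assumes "ideal_in (coordinate_ring n \<chi>) J"
  shows "ideal_in (polynomial_functions n) {p\<in>polynomial_functions n. p \<circ> \<chi> \<in> J}"
proof -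
  note R = ring_setD[OF polynomial_functions_ring_set[of n]]
  have eq: "(p + q) \<circ> \<chi> = (p \<circ> \<chi>) + (q \<circ> \<chi>)" "(p * q) \<circ> \<chi> = (p \<circ> \<chi>) * (q \<circ> \<chi>)" "0 \<circ> \<chi> = 0" for p q
    by (simp_all add: fun_eq_iff)
  show ?thesis
    unfolding ideal_in_def
    using R ideal_inD(2-4)[OF assms] coordinate_ring_iff[of _ n \<chi>]
    by (auto simp: eq)
qed

text \<open>
  Ideals of the coordinate ring are the images of their preimages in the polynomial ring.
\<close>

lemma coordinate_ring_noetherian: "noetherian (coordinate_ring n \<chi>)"
  unfolding noetherian_def
proof (intro allI impI, elim conjE)
  fix J assume J: "\<forall>k. ideal_in (coordinate_ring n \<chi>) (J k)" and inc: "\<forall>k. J k \<subseteq> J (Suc k)"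
  define I where "I k = {p\<in>polynomial_functions n. p \<circ> \<chi> \<in> J k}" for k
  have "\<exists>K. \<forall>k\<ge>K. I k = I K"
  proof (rule noetherianD[OF polynomial_functions_noetherian])
    show "ideal_in (polynomial_functions n) (I k)" for k
      unfolding I_def by (rule coordinate_ring_pullback_ideal) (rule J[rule_format])
    show "I k \<subseteq> I (Suc k)" for k unfolding I_def using inc by blast
  qed
  then obtain K where K: "\<forall>k\<ge>K. I k = I K" by blast
  have J_I: "J k = (\<lambda>p. p \<circ> \<chi>) ` I k" for k
    using ideal_inD(1)[OF J[rule_format, of k]] unfolding I_def coordinate_ring_def by blast
  have "J k = J K" if "k \<ge> K" for k
    unfolding J_I[of k] J_I[of K] using K[rule_format, OF that] by simp
  then show "\<exists>K. \<forall>k\<ge>K. J k = J K" by blast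
qed

text \<open>
  An irreducible affine variety, embedded by \<open>\<chi>\<close> as the zero set of all polynomial equations that hold
  on it.
\<close>

locale affine_chart = fraction_functions X "coordinate_ring n \<chi>"
  for X :: "('a, 'k::{alg_closed_field, field_char_0}) fun_space" and n :: nat and \<chi> :: "'a \<Rightarrow> nat \<Rightarrow> 'k" +
  assumes sheaf: "function_sheaf X"
    and irreducible: "irreducible_space X"
    and chart_retract: "\<exists>y\<in>points X. \<chi> x = \<chi> y"
    and chart_inj: "inj_on \<chi> (points X)"
    and chart_surj: "a \<in> {..<n} \<rightarrow>\<^sub>E UNIV \<Longrightarrow>
      (\<And>p. p \<in> polynomial_functions n \<Longrightarrow> (\<And>x. x \<in> points X \<Longrightarrow> p (\<chi> x) = 0) \<Longrightarrow> p a = 0) \<Longrightarrow> \<exists>x\<in>points X. \<chi> x = a"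
    and chart_range: "\<chi> x \<in> {..<n} \<rightarrow>\<^sub>E UNIV"

lemma affine_variety_chart:
  fixes X :: "('a, 'k::{alg_closed_field, field_char_0}) fun_space"
  assumes "affine_variety X" "irreducible_space X"
  shows "\<exists>n \<chi>. affine_chart X n \<chi>"
proof -
  obtain n P \<phi> where sh: "function_sheaf X" and P: "P \<subseteq> polynomial_functions n"
    and iso: "isomorphism X (affine_set_space n P) \<phi>"
    using assms(1) unfolding affine_variety_def by blast
  let ?Z = "zero_locus n P" and ?S = "affine_set_space n P"
  have Z: "points ?S = ?Z" and S: "fraction_functions ?S (polynomial_functions n)"
    unfolding affine_set_space_def
    by (rule fraction_space_single[OF polynomial_functions_ring_set polynomial_functions.const])+
  obtain \<psi> where mor: "morphism X ?S \<phi>" "morphism ?S X \<psi>" and inv: "\<And>x. x \<in> points X \<Longrightarrow> \<psi> (\<phi> x) = x"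
    "\<And>x. x \<in> points ?S \<Longrightarrow> \<phi> (\<psi> x) = x"
    using iso unfolding isomorphism_def by (elim conjE exE) blast
  obtain x0 where x0: "x0 \<in> points X" using assms(2) unfolding irreducible_in_def by blast
  define \<chi> where "\<chi> x = \<phi> (if x \<in> points X then x else x0)" for x
  have \<chi>: "\<chi> x = \<phi> x" if "x \<in> points X" for x using that by (simp add: \<chi>_def)
  have \<chi>Z: "\<chi> x \<in> ?Z" for x using morphism_points[OF mor(1)] x0 Z by (simp add: \<chi>_def)
  have "fraction_functions X (coordinate_ring n \<chi>)"
  proof (rule fraction_functions_transport[OF S sh iso coordinate_ring_set coordinate_ring_const])
    show "\<exists>q\<in>polynomial_functions n. \<forall>x\<in>points X. r x = q (\<phi> x)" if "r \<in> coordinate_ring n \<chi>" for r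
      using that \<chi> unfolding coordinate_ring_def by fastforce
    show "\<exists>r\<in>coordinate_ring n \<chi>. \<forall>x\<in>points X. r x = q (\<phi> x)" if "q \<in> polynomial_functions n" for q
      using coordinate_ring_iff[OF that, of \<chi>] \<chi> by (intro bexI[of _ "q \<circ> \<chi>"]) auto
  qed
  moreover have "affine_chart_axioms X n \<chi>"
  proof
    show "function_sheaf X" by (rule sh)
    show "irreducible_space X" by (rule assms(2))
    show "\<exists>y\<in>points X. \<chi> x = \<chi> y" for x
      using x0 by (intro bexI[of _ "if x \<in> points X then x else x0"]) (auto simp: \<chi>_def)
    show "inj_on \<chi> (points X)" using inv(1) \<chi> by (metis inj_onI)
    show "\<chi> x \<in> {..<n} \<rightarrow>\<^sub>E UNIV" for x using \<chi>Z unfolding zero_locus_def by blast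
    fix a :: "nat \<Rightarrow> 'k"
    assume a: "a \<in> {..<n} \<rightarrow>\<^sub>E UNIV"
      and v: "\<And>p. p \<in> polynomial_functions n \<Longrightarrow> (\<And>x. x \<in> points X \<Longrightarrow> p (\<chi> x) = 0) \<Longrightarrow> p a = 0"
    have "p a = 0" if p: "p \<in> P" for p
    proof (rule v)
      show "p \<in> polynomial_functions n" using P p by blast
      show "p (\<chi> x) = 0" for x using \<chi>Z[of x] p unfolding zero_locus_def by blast
    qed
    then have "a \<in> points ?S" using a unfolding Z zero_locus_def by blast
    then show "\<exists>x\<in>points X. \<chi> x = a"
      using inv(2) \<chi> morphism_points[OF mor(2)] by (intro bexI[of _ "\<psi> a"]) auto
  qed
  ultimately show ?thesis unfolding affine_chart_def by blast
qed

context affine_chart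
begin

abbreviation "B \<equiv> coordinate_ring n \<chi>"

abbreviation global :: "('a \<Rightarrow> 'k) \<Rightarrow> bool" where
  "global f \<equiv> regular X (points X) f"

lemma points_open: "openin (zariski X) (points X)"
  by simp

lemma B_global: "b \<in> B \<Longrightarrow> global b"
  by (rule regular_of_R) simp_all

lemma B_zero:
  assumes "b \<in> B" "\<And>x. x \<in> points X \<Longrightarrow> b x = 0"
  shows "b = 0"
proof -
  obtain p where p: "b = p \<circ> \<chi>" using assms(1) unfolding coordinate_ring_def by blast
  have "b x = 0" for x
  proof -
    obtain y where "y \<in> points X" "\<chi> x = \<chi> y" using chart_retract by blast
    then show ?thesis using assms(2)[of y] p by simp
  qed
  then show ?thesis by (simp add: fun_eq_iff)
qed

lemma global_domain:
  assumes "global f" "global g" "\<And>x. x \<in> points X \<Longrightarrow> f x * g x = 0" "x0 \<in> points X" "f x0 \<noteq> 0" "x \<in> points X"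
  shows "g x = 0"
  using regular_prime[OF irreducible assms(1,2,3)] assms(4-6) by blast

lemma B_domain:
  assumes "a \<in> B" "b \<in> B" "a * b = 0"
  shows "a = 0 \<or> b = 0"
proof -
  have "a x * b x = 0" for x using fun_cong[OF assms(3), of x] by simp
  then have "(\<forall>x\<in>points X. a x = 0) \<or> (\<forall>x\<in>points X. b x = 0)"
    by (intro regular_prime[OF irreducible] B_global assms)
  then show ?thesis using B_zero assms(1,2) by blast
qed

lemma closed_separate:
  assumes "closedin (zariski X) Z" "x \<in> points X" "x \<notin> Z"
  shows "\<exists>b\<in>B. b x \<noteq> 0 \<and> (\<forall>z\<in>Z. b z = 0)"
proof -
  have Z: "Z \<subseteq> points X" by (rule closedin_subset[OF assms(1)])
  have "openin (zariski X) (points X - Z)" using assms(1) by (simp add: openin_diff)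
  from open_basic[OF this, of x] obtain b where "b \<in> B" "b x \<noteq> 0" "\<forall>y\<in>points X. b y \<noteq> 0 \<longrightarrow> y \<in> points X - Z"
    using assms(2,3) by blast
  then show ?thesis using Z by blast
qed

lemma vanishing_ideal_prime:
  assumes "irreducible_in (zariski X) D"
  shows "prime_ideal_in B {f\<in>B. \<forall>x\<in>D. f x = 0}"
proof -
  have ne: "D \<noteq> {}" using assms unfolding irreducible_in_def by blast
  have "(\<forall>x\<in>D. a x = 0) \<or> (\<forall>x\<in>D. b x = 0)" if "a \<in> B" "b \<in> B" "\<forall>x\<in>D. a x * b x = 0" for a b
    by (rule regular_prime[OF assms B_global[OF that(1)] B_global[OF that(2)]]) (use that in blast)
  then show ?thesis using ne RD(2,4,6)
    unfolding prime_ideal_in_def ideal_in_def by auto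
qed

lemma zero_set_closed:
  assumes "I \<subseteq> B"
  shows "closedin (zariski X) {x\<in>points X. \<forall>f\<in>I. f x = 0}"
proof -
  let ?C = "{x\<in>points X. \<forall>f\<in>I. f x = 0}"
  have "openin (zariski X) (points X - ?C)"
  proof (subst openin_subopen, intro ballI)
    fix x assume "x \<in> points X - ?C"
    then obtain f where f: "f \<in> I" "f x \<noteq> 0" "x \<in> points X" by blast
    have "openin (zariski X) {x\<in>points X. f x \<noteq> 0}" using f assms by (intro nonvanishing_open B_global) blast
    then show "\<exists>T. openin (zariski X) T \<and> x \<in> T \<and> T \<subseteq> points X - ?C"
      using f by (intro exI[of _ "{x\<in>points X. f x \<noteq> 0}"]) auto
  qed
  then show ?thesis unfolding closedin_def by blast
qed

text \<open>
  The Nullstellensatz, transported along the chart.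
\<close>

lemma prime_ideal_point:
  assumes q: "prime_ideal_in B q" and g: "g \<in> B" "g \<notin> q"
  shows "\<exists>x\<in>points X. (\<forall>f\<in>q. f x = 0) \<and> g x \<noteq> 0"
proof -
  let ?I = "{p\<in>polynomial_functions n. p \<circ> \<chi> \<in> q}"
  note qi = prime_ideal_inD(1)[OF q]
  have eq: "(a * b) \<circ> \<chi> = (a \<circ> \<chi>) * (b \<circ> \<chi>)" "(1 :: (nat \<Rightarrow> 'k) \<Rightarrow> 'k) \<circ> \<chi> = 1"
    for a b :: "(nat \<Rightarrow> 'k) \<Rightarrow> 'k" by (simp_all add: fun_eq_iff)
  have "prime_ideal_in (polynomial_functions n) ?I"
    unfolding prime_ideal_in_def
  proof (intro conjI ballI impI)
    show "ideal_in (polynomial_functions n) ?I" by (rule coordinate_ring_pullback_ideal[OF qi])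
    show "1 \<notin> ?I" using prime_ideal_inD(2)[OF q] eq by simp
    fix a b assume "a \<in> polynomial_functions n" "b \<in> polynomial_functions n" "a * b \<in> ?I"
    then show "a \<in> ?I \<or> b \<in> ?I"
      using prime_ideal_inD(3)[OF q coordinate_ring_iff[of a n \<chi>] coordinate_ring_iff[of b n \<chi>]] eq by auto
  qed
  moreover obtain p where p: "p \<in> polynomial_functions n" "g = p \<circ> \<chi>" using g(1) unfolding coordinate_ring_def by blast
  moreover have "p \<notin> ?I" using g p by blast
  ultimately obtain a where a: "a \<in> {..<n} \<rightarrow>\<^sub>E UNIV" "\<forall>p\<in>?I. p a = 0" "p a \<noteq> 0"
    using prime_nullstellensatz by blast
  have "\<exists>x\<in>points X. \<chi> x = a"
  proof (rule chart_surj[OF a(1)])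
    fix r assume r: "r \<in> polynomial_functions n" "\<And>x. x \<in> points X \<Longrightarrow> r (\<chi> x) = 0"
    then have "r \<circ> \<chi> = 0" by (intro B_zero coordinate_ring_iff) auto
    then show "r a = 0" using a(2) r(1) ideal_inD(2)[OF qi] by auto
  qed
  then obtain x where x: "x \<in> points X" "\<chi> x = a" by blast
  have "f x = 0" if f: "f \<in> q" for f
  proof -
    obtain r where "r \<in> polynomial_functions n" "f = r \<circ> \<chi>" using ideal_inD(1)[OF qi f] unfolding coordinate_ring_def by blast
    then show ?thesis using a(2) f x by auto
  qed
  then show ?thesis using x a(3) p(2) by auto
qed

text \<open>
  Two functions witnessing a decomposition would have a product outside \<open>q\<close> that vanishes on the zero
  set, which the Nullstellensatz forbids.
\<close>

lemma prime_zero_set_irreducible: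
  assumes q: "prime_ideal_in B q"
  shows "irreducible_in (zariski X) {x\<in>points X. \<forall>f\<in>q. f x = 0}"
  unfolding irreducible_in_def
proof (intro conjI allI impI)
  let ?C = "{x\<in>points X. \<forall>f\<in>q. f x = 0}"
  show "?C \<subseteq> points X" by blast
  show "?C \<noteq> {}" using prime_ideal_point[OF q RD(1) prime_ideal_inD(2)[OF q]] by blast
  fix E F assume EF: "closedin (zariski X) E \<and> closedin (zariski X) F \<and> ?C \<subseteq> E \<union> F"
  show "?C \<subseteq> E \<or> ?C \<subseteq> F"
  proof (rule ccontr)
    assume "\<not> ?thesis"
    then obtain x y where xy: "x \<in> ?C" "x \<notin> E" "y \<in> ?C" "y \<notin> F" by blast
    obtain a where a: "a \<in> B" "a x \<noteq> 0" "\<forall>z\<in>E. a z = 0"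
      using closed_separate[OF conjunct1[OF EF], of x] xy by blast
    obtain b where b: "b \<in> B" "b y \<noteq> 0" "\<forall>z\<in>F. b z = 0"
      using closed_separate[OF conjunct1[OF conjunct2[OF EF]], of y] xy by blast
    have "a \<notin> q" "b \<notin> q" using a b xy by auto
    then have "a * b \<notin> q" by (rule prime_ideal_inD(4)[OF q a(1) b(1)])
    then obtain z where "z \<in> ?C" "(a * b) z \<noteq> 0" using prime_ideal_point[OF q RD(4)[OF a(1) b(1)]] by blast
    moreover have "z \<in> E \<or> z \<in> F" using \<open>z \<in> ?C\<close> EF by blast
    ultimately show False using a(3) b(3) by auto
  qed
qed

lemma prime_divisor_proper:
  assumes "prime_divisor X D"
  shows "D \<noteq> points X"
proof
  assume D: "D = points X"
  have "n = 0" if C: "C 0 = D" "\<forall>i\<le>n. closedin (zariski X) (C i) \<and> irreducible_in (zariski X) (C i)"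
    "\<forall>i<n. C i \<subset> C (Suc i)" for n and C :: "nat \<Rightarrow> 'a set"
  proof (rule ccontr)
    assume "n \<noteq> 0"
    then have "C 0 \<subset> C (Suc 0)" "C (Suc 0) \<subseteq> points X" using C(2,3) closedin_subset by (blast, metis One_nat_def Suc_leI neq0_conv)
    then show False using C(1) D by blast
  qed
  then have "codimension (zariski X) D \<le> 0"
    unfolding codimension_def by (intro Sup_least) (auto simp: zero_enat_def)
  then show False using assms unfolding prime_divisor_def by simp
qed

text \<open>
  A nonzero prime strictly below the ideal of \<open>D\<close> would have as zero set an irreducible closed set
  strictly between \<open>D\<close> and \<open>X\<close>, so that \<open>D\<close> would have codimension at least two.
\<close>

lemma prime_divisor_height_one:
  assumes D: "prime_divisor X D" and q: "prime_ideal_in B q" "q \<noteq> {0}"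
    and sub: "q \<subseteq> {f\<in>B. \<forall>x\<in>D. f x = 0}"
  shows "q = {f\<in>B. \<forall>x\<in>D. f x = 0}"
proof (rule ccontr)
  assume "q \<noteq> {f\<in>B. \<forall>x\<in>D. f x = 0}"
  then obtain g where g: "g \<in> B" "g \<notin> q" "\<forall>x\<in>D. g x = 0" using sub by blast
  let ?C = "{x\<in>points X. \<forall>f\<in>q. f x = 0}"
  have qB: "q \<subseteq> B" using ideal_inD(1)[OF prime_ideal_inD(1)[OF q(1)]] by blast
  have D': "closedin (zariski X) D" "irreducible_in (zariski X) D" "codimension (zariski X) D = 1"
    using D unfolding prime_divisor_def by blast+
  have "D \<subseteq> ?C" using sub closedin_subset[OF D'(1)] by blast
  moreover have "\<exists>x\<in>?C. x \<notin> D" using prime_ideal_point[OF q(1) g(1,2)] g(3) by blast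
  ultimately have DC: "D \<subset> ?C" by blast
  obtain f where f: "f \<in> q" "f \<noteq> 0" using q(2) ideal_inD(2)[OF prime_ideal_inD(1)[OF q(1)]] by blast
  then have "\<exists>x\<in>points X. f x \<noteq> 0" using B_zero qB by blast
  then have CX: "?C \<subset> points X" using f(1) by blast
  \<comment> \<open>A chain that shows codimension at least two.\<close>
  define C where "C i = (if i = 0 then D else if i = 1 then ?C else points X)" for i :: nat
  have "C 0 = D \<and> (\<forall>i\<le>2. closedin (zariski X) (C i) \<and> irreducible_in (zariski X) (C i)) \<and> (\<forall>i<2. C i \<subset> C (Suc i))"
  proof (intro conjI allI impI)
    show "C 0 = D" by (simp add: C_def)
    show "closedin (zariski X) (C i)" for i
      using D'(1) zero_set_closed[OF qB] by (simp add: C_def)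
    show "irreducible_in (zariski X) (C i)" for i
      using D'(2) prime_zero_set_irreducible[OF q(1)] irreducible by (simp add: C_def)
    show "C i \<subset> C (Suc i)" if "i < 2" for i
    proof -
      have "i = 0 \<or> i = 1" using that by linarith
      then show ?thesis using DC CX by (auto simp: C_def)
    qed
  qed
  then have "enat 2 \<le> codimension (zariski X) D"
    unfolding codimension_def by (intro Sup_upper) blast
  then show False using D'(3) by (simp add: one_enat_def)
qed

text \<open>
  Normality at \<open>x0\<close>, applied to the fraction \<open>y / f\<close>: the equation divided by \<open>b * f ^ k\<close> is an integral
  equation with coefficients regular near \<open>x0\<close>.
\<close>

lemma normal_integrally_closed:
  assumes N: "normal_space X" and y: "y \<in> B" and f: "f \<in> B" "f \<noteq> 0" and b: "b \<in> B" and x0: "x0 \<in> points X" "b x0 \<noteq> 0"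
    and c: "\<And>j. c j \<in> B" and eq: "b * y ^ k = (\<Sum>j<k. c j * y ^ j * f ^ (k - j))"
  shows "\<exists>b'\<in>B. b' x0 \<noteq> 0 \<and> (\<exists>a\<in>B. b' * y = f * a)"
proof -
  define U where "U = {x\<in>points X. f x \<noteq> 0}"
  define V where "V = {x\<in>points X. b x \<noteq> 0}"
  define w where "w x = y x / f x" for x
  have Uo: "openin (zariski X) U" unfolding U_def by (rule nonvanishing_open[OF B_global[OF f(1)]])
  have Vo: "openin (zariski X) V" unfolding V_def by (rule nonvanishing_open[OF B_global[OF b]])
  have U: "U \<noteq> {}" using B_zero[OF f(1)] f(2) unfolding U_def by blast
  have w: "regular X U w" unfolding w_def
    by (intro regular_divide regular_of_R y f(1) Uo) (simp add: U_def)
  have "integral_at X x0 U w"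
    unfolding integral_at_def
  proof (intro exI[of _ V] exI[of _ k] exI[of _ "\<lambda>j x. - c j x / b x"] conjI allI impI ballI)
    show "openin (zariski X) V" by (rule Vo)
    show "x0 \<in> V" using x0 by (simp add: V_def)
    show "regular X V (\<lambda>x. - c j x / b x)" for j
      by (intro regular_divide regular_minus regular_of_R c b Vo) (simp add: V_def)
    fix x assume x: "x \<in> U \<inter> V"
    then have nz: "f x \<noteq> 0" "b x \<noteq> 0" by (auto simp: U_def V_def)
    have "b x * y x ^ k = (\<Sum>j<k. c j x * y x ^ j * f x ^ (k - j))"
      using fun_cong[OF eq, of x] by (simp add: sum_fun_apply power_fun_apply)
    also have "\<dots> = (\<Sum>j<k. (c j x / b x * w x ^ j) * (b x * f x ^ k))"
    proof (rule sum.cong[OF refl])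
      fix j assume "j \<in> {..<k}"
      then have "f x ^ k = f x ^ (k - j) * f x ^ j" by (simp flip: power_add)
      then show "c j x * y x ^ j * f x ^ (k - j) = (c j x / b x * w x ^ j) * (b x * f x ^ k)"
        using nz by (simp add: w_def power_divide)
    qed
    also have "\<dots> = (\<Sum>j<k. c j x / b x * w x ^ j) * (b x * f x ^ k)" by (simp only: sum_distrib_right)
    finally have "w x ^ k = (\<Sum>j<k. c j x / b x * w x ^ j)"
      using nz by (simp add: w_def power_divide field_simps)
    then show "w x ^ k + (\<Sum>j<k. - c j x / b x * w x ^ j) = 0" by (simp add: sum_negf)
  qed
  then obtain W g where W: "x0 \<in> W" "regular X W g" "\<forall>y\<in>U \<inter> W. g y = w y"
    using N[unfolded normal_space_def, rule_format, of x0 U w] x0 U w by blast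
  obtain a b' where ab: "a \<in> B" "b' \<in> B" "b' x0 \<noteq> 0" "\<forall>y\<in>points X. b' y \<noteq> 0 \<longrightarrow> y \<in> W \<and> g y = a y / b' y"
    using regular_fraction[OF W(2,1)] by blast
  have "(b' * f) * (b' * y - f * a) = 0"
  proof (rule B_zero)
    show "(b' * f) * (b' * y - f * a) \<in> B" by (intro RD(4) RD(3) ab f y)
    fix x assume x: "x \<in> points X"
    show "((b' * f) * (b' * y - f * a)) x = 0"
    proof (cases "b' x = 0 \<or> f x = 0")
      case False
      then have "x \<in> U \<inter> W" "g x = a x / b' x" using ab(4) x by (auto simp: U_def)
      then have "y x / f x = a x / b' x" using W(3) by (simp add: w_def)
      then show ?thesis using False by (simp add: field_simps)
    qed auto
  qed
  moreover have "b' \<noteq> 0" using ab(3) by auto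
  moreover have "b' * f \<in> B" "b' * y - f * a \<in> B" by (intro RD(4) RD(3) ab f y)+
  ultimately have "b' * y - f * a = 0" using B_domain[OF ab(2) f(1)] B_domain f(2) by blast
  then have "b' * y = f * a" by simp
  then show ?thesis using ab by blast
qed

text \<open>
  The discrete valuation ring at \<open>D\<close>. It is obtained from the coordinate ring; a global function is
  related to it by a denominator that does not vanish at a chosen point of \<open>D\<close>.
\<close>

theorem divisor_uniformizer:
  assumes N: "normal_space X" and D: "prime_divisor X D"
  shows "\<exists>u. global u \<and> (\<forall>x\<in>D. u x = 0) \<and>
    (\<forall>g x0. global g \<and> x0 \<in> points X \<and> g x0 \<noteq> 0 \<longrightarrow>
      (\<exists>m a b. global a \<and> global b \<and> (\<exists>x\<in>D. a x \<noteq> 0) \<and> (\<exists>x\<in>D. b x \<noteq> 0) \<and>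
         (\<forall>x\<in>points X. b x * g x = u x ^ m * a x)))"
proof -
  let ?P = "{f\<in>B. \<forall>x\<in>D. f x = 0}"
  have D': "closedin (zariski X) D" "irreducible_in (zariski X) D" using D unfolding prime_divisor_def by blast+
  have DX: "D \<subseteq> points X" by (rule closedin_subset[OF D'(1)])
  obtain d where d: "d \<in> D" using D'(2) unfolding irreducible_in_def by blast
  have P: "prime_ideal_in B ?P" by (rule vanishing_ideal_prime[OF D'(2)])
  obtain x1 where "x1 \<in> points X" "x1 \<notin> D" using prime_divisor_proper[OF D] DX by blast
  then obtain b1 where b1: "b1 \<in> B" "b1 x1 \<noteq> 0" "\<forall>z\<in>D. b1 z = 0" using closed_separate[OF D'(1)] by blast
  have nz: "?P \<noteq> {0}"
  proof
    assume "?P = {0}"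
    then have "b1 = 0" using b1 by blast
    then show False using b1(2) by simp
  qed
  have int: "\<exists>b'\<in>B - ?P. \<exists>a\<in>B. b' * y = f * a"
    if h: "y \<in> B" "f \<in> B" "f \<noteq> 0" "b \<in> B" "b \<notin> ?P" "\<And>j. c j \<in> B" "b * y ^ k = (\<Sum>j<k. c j * y ^ j * f ^ (k - j))"
    for y f b k c
  proof -
    obtain x0 where x0: "x0 \<in> D" "b x0 \<noteq> 0" using h(4,5) by blast
    have "\<exists>b'\<in>B. b' x0 \<noteq> 0 \<and> (\<exists>a\<in>B. b' * y = f * a)"
      by (rule normal_integrally_closed[OF N h(1-4) _ x0(2) h(6,7)]) (use x0 DX in blast)
    then show ?thesis using x0(1) by blast
  qed
  have "\<exists>u\<in>?P. \<forall>g\<in>B. g \<noteq> 0 \<longrightarrow> (\<exists>m. \<exists>a\<in>B - ?P. \<exists>b\<in>B - ?P. b * g = u ^ m * a)"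
  proof (rule normal_height_one_uniformizer[OF ring coordinate_ring_noetherian B_domain P nz])
    show "q = ?P" if "prime_ideal_in B q" "q \<subseteq> ?P" "q \<noteq> {0}" for q
      by (rule prime_divisor_height_one[OF D that(1,3,2)])
  qed (assumption | (rule int, assumption+))+
  then obtain u where u: "u \<in> ?P"
    and dvr: "\<And>g. g \<in> B \<Longrightarrow> g \<noteq> 0 \<Longrightarrow> \<exists>m. \<exists>a\<in>B - ?P. \<exists>b\<in>B - ?P. b * g = u ^ m * a" by blast
  have "\<exists>m a b. global a \<and> global b \<and> (\<exists>x\<in>D. a x \<noteq> 0) \<and> (\<exists>x\<in>D. b x \<noteq> 0) \<and> (\<forall>x\<in>points X. b x * g x = u x ^ m * a x)"
    if g: "global g" "x0 \<in> points X" "g x0 \<noteq> 0" for g x0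
  proof -
    obtain a b where ab: "a \<in> B" "b \<in> B" "b d \<noteq> 0" "\<forall>y\<in>points X. b y \<noteq> 0 \<longrightarrow> y \<in> points X \<and> g y = a y / b y"
      using regular_fraction[OF g(1), of d] d DX by blast
    have bg: "b x * g x = a x" if "x \<in> points X" for x
    proof (rule regular_agree[OF irreducible _ _ nonvanishing_open[OF B_global[OF ab(2)]] _ _ that])
      show "global (\<lambda>x. b x * g x)" by (intro regular_mult B_global ab g)
      show "global a" by (intro B_global ab)
      show "{x \<in> points X. b x \<noteq> 0} \<noteq> {}" using ab(3) d DX by blast
    qed (use ab(4) in auto)
    have "a \<noteq> 0"
    proof
      assume "a = 0"
      then have "b x * g x = 0" if "x \<in> points X" for x using bg[OF that] by simp
      then have "g x0 = 0" using global_domain[OF B_global[OF ab(2)] g(1) _ _ ab(3) g(2)] d DX by blast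
      then show False using g(3) by simp
    qed
    then obtain m a' b' where h: "a' \<in> B - ?P" "b' \<in> B - ?P" "b' * a = u ^ m * a'" using dvr[OF ab(1)] by blast
    have bB: "b' * b \<in> B" by (rule RD(4)) (use h ab in blast)+
    have bP: "b' * b \<notin> ?P"
      by (rule prime_ideal_inD(4)[OF P]) (use h ab d in blast)+
    have "(b' * b) x * g x = u x ^ m * a' x" if "x \<in> points X" for x
      using fun_cong[OF h(3), of x] bg[OF that] by (simp add: power_fun_apply mult.assoc)
    then have eq: "\<forall>x\<in>points X. (b' * b) x * g x = u x ^ m * a' x" by blast
    have aD: "\<exists>x\<in>D. a' x \<noteq> 0" and bD: "\<exists>x\<in>D. (b' * b) x \<noteq> 0" using h(1) bB bP by blast+
    have "global a'" "global (b' * b)" using h(1) bB by (blast intro: B_global)+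
    then show ?thesis using aD bD eq by (intro exI conjI)
  qed
  then have "\<forall>g x0. global g \<and> x0 \<in> points X \<and> g x0 \<noteq> 0 \<longrightarrow>
      (\<exists>m a b. global a \<and> global b \<and> (\<exists>x\<in>D. a x \<noteq> 0) \<and> (\<exists>x\<in>D. b x \<noteq> 0) \<and>
         (\<forall>x\<in>points X. b x * g x = u x ^ m * a x))" by (elim conjE | intro allI impI | assumption)+
  moreover have "global u" "\<forall>x\<in>D. u x = 0" using u B_global by auto
  ultimately show ?thesis by (intro exI conjI)
qed

end

section \<open>Slices of products and Laurent expansions\<close>

text \<open>
  The functions on \<open>U \<times> V\<close> whose local fractions define the product.
\<close>

definition product_sections ::
  "('a, 'k::field) fun_space \<Rightarrow> ('b, 'k) fun_space \<Rightarrow> ('a \<times> 'b) set \<Rightarrow> ('a \<times> 'b \<Rightarrow> 'k) set" where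
  "product_sections S X W = {h. \<exists>U V n f g. W = U \<times> V \<and> openin (zariski S) U \<and> openin (zariski X) V \<and>
     (\<forall>i<n. regular S U (f i) \<and> regular X V (g i)) \<and> h = (\<lambda>(x, y). \<Sum>i<(n::nat). f i x * g i y)}"

lemma product_space_sections: "product_space S X = fraction_space (product_sections S X)"
  unfolding product_space_def product_sections_def ..

lemma product_zariski:
  "zariski (product_space S X) =
     topology_generated_by {{z\<in>W. h z \<noteq> 0} |W h. h \<in> product_sections S X W}"
  by (simp add: product_space_sections fraction_space_def fraction_topology_def)

lemma product_regular_fraction:
  assumes "regular (product_space S X) W F" "z \<in> W"
  shows "\<exists>U N a b. a \<in> product_sections S X U \<and> b \<in> product_sections S X U \<and>
    openin (zariski (product_space S X)) N \<and> z \<in> N \<and> N \<subseteq> U \<inter> W \<and> (\<forall>y\<in>N. b y \<noteq> 0 \<and> F y = a y / b y)"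
  using assms by (simp add: product_space_sections fraction_space_def)

lemma product_sectionsE:
  assumes "h \<in> product_sections S X W"
  shows "\<exists>U V n f g. W = U \<times> V \<and> openin (zariski S) U \<and> openin (zariski X) V \<and>
     (\<forall>i<n. regular S U (f i) \<and> regular X V (g i)) \<and> h = (\<lambda>(x, y). \<Sum>i<(n::nat). f i x * g i y)"
  using assms by (simp add: product_sections_def)

lemma (in fraction_functions) regular_empty: "regular X {} f"
  by (rule regularI) simp_all

text \<open>
  The universal property in the form needed for the slices of a product: both premises concern only
  the generating sections.
\<close>

lemma (in fraction_functions) morphism_into_product:
  assumes pt: "\<And>z. z \<in> points X \<Longrightarrow> \<exists>W h. h \<in> product_sections S Y W \<and> \<iota> z \<in> W \<and> h (\<iota> z) \<noteq> 0"
    and sec: "\<And>W h. h \<in> product_sections S Y W \<Longrightarrow> regular X {z\<in>points X. \<iota> z \<in> W} (\<lambda>z. h (\<iota> z))"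
  shows "morphism X (product_space S Y) \<iota>"
proof -
  have cont: "continuous_map (zariski X) (zariski (product_space S Y)) \<iota>"
    unfolding product_zariski continuous_on_generated_topo_iff
  proof (intro conjI allI impI)
    fix U assume "U \<in> {{z\<in>W. h z \<noteq> 0} |W h. h \<in> product_sections S Y W}"
    then obtain W h where h: "h \<in> product_sections S Y W" "U = {z\<in>W. h z \<noteq> 0}" by blast
    have "\<iota> -` U \<inter> points X = {z\<in>{z\<in>points X. \<iota> z \<in> W}. h (\<iota> z) \<noteq> 0}" using h(2) by auto
    then show "openin (zariski X) (\<iota> -` U \<inter> points X)" using nonvanishing_open[OF sec[OF h(1)]] by simp
  next
    show "\<iota> ` points X \<subseteq> \<Union> {{z\<in>W. h z \<noteq> 0} |W h. h \<in> product_sections S Y W}"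
    proof
      fix y assume "y \<in> \<iota> ` points X"
      then obtain z where z: "z \<in> points X" "y = \<iota> z" by blast
      then obtain W h where "h \<in> product_sections S Y W" "y \<in> {z\<in>W. h z \<noteq> 0}" using pt[OF z(1)] by blast
      then show "y \<in> \<Union> {{z\<in>W. h z \<noteq> 0} |W h. h \<in> product_sections S Y W}" by blast
    qed
  qed
  have pre: "openin (zariski X) {z\<in>points X. \<iota> z \<in> N}" if "openin (zariski (product_space S Y)) N" for N
    using cont that unfolding continuous_map_def by blast
  show ?thesis
    unfolding morphism_def
  proof (intro conjI allI impI cont)
    fix W F assume F: "regular (product_space S Y) W F"
    show "regular X {z\<in>points X. \<iota> z \<in> W} (F \<circ> \<iota>)"
    proof (rule regularI)
      show "openin (zariski X) {z\<in>points X. \<iota> z \<in> W}"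
        by (rule pre) (use F in \<open>simp add: product_space_sections fraction_space_def\<close>)
      fix z assume z: "z \<in> {z\<in>points X. \<iota> z \<in> W}"
      then have "\<iota> z \<in> W" by blast
      from product_regular_fraction[OF F this] obtain U N a b where
        ab: "a \<in> product_sections S Y U" "b \<in> product_sections S Y U"
        "openin (zariski (product_space S Y)) N" "\<iota> z \<in> N" "N \<subseteq> U \<inter> W" "\<forall>y\<in>N. b y \<noteq> 0 \<and> F y = a y / b y"
        by (elim exE conjE)
      let ?V = "{z\<in>points X. \<iota> z \<in> N}"
      have V: "openin (zariski X) ?V" "?V \<subseteq> {z\<in>points X. \<iota> z \<in> U}" using pre[OF ab(3)] ab(5) by auto
      have "regular X ?V (\<lambda>z. a (\<iota> z) / b (\<iota> z))"
        by (intro regular_divide regular_subset[OF sec[OF ab(1)] V] regular_subset[OF sec[OF ab(2)] V])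
          (use ab(6) in blast)
      moreover have "\<forall>y\<in>{z\<in>points X. \<iota> z \<in> W} \<inter> ?V. (F \<circ> \<iota>) y = a (\<iota> y) / b (\<iota> y)" using ab(6) by simp
      moreover have "z \<in> ?V" using z ab(4) by blast
      ultimately show "\<exists>V g. z \<in> V \<and> regular X V g \<and> (\<forall>y\<in>{z\<in>points X. \<iota> z \<in> W} \<inter> V. (F \<circ> \<iota>) y = g y)"
        by (intro exI conjI)
    qed
  qed
qed

lemma product_section_one:
  assumes "regular S U (\<lambda>_. 1)" "openin (zariski S) U" "regular X V (\<lambda>_. 1)" "openin (zariski X) V"
  shows "(\<lambda>_. 1) \<in> product_sections S X (U \<times> V)"
  unfolding product_sections_def
  by (rule CollectI, intro exI[of _ U] exI[of _ V] exI[of _ 1] exI[of _ "\<lambda>_ _. 1"]) (use assms in auto)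

lemma (in fraction_functions) slice_right:
  assumes g: "g \<in> U" "openin (zariski S) U" "regular S U (\<lambda>_. 1)"
  shows "morphism X (product_space S X) (\<lambda>x. (g, x))"
proof (rule morphism_into_product)
  fix x assume x: "x \<in> points X"
  have "(\<lambda>_. 1) \<in> product_sections S X (U \<times> points X)"
    by (rule product_section_one[OF g(3,2)]) (simp_all add: regular_const)
  then show "\<exists>W h. h \<in> product_sections S X W \<and> (g, x) \<in> W \<and> h (g, x) \<noteq> 0"
    using g(1) x by (intro exI[of _ "U \<times> points X"] exI[of _ "\<lambda>_. 1"]) simp
next
  fix W h assume "h \<in> product_sections S X W"
  from product_sectionsE[OF this] obtain U V f f' and n :: nat where h: "W = U \<times> V" "openin (zariski X) V"
    "\<forall>i<n. regular S U (f i) \<and> regular X V (f' i)" "h = (\<lambda>(x, y). \<Sum>i<n. f i x * f' i y)" by (elim exE conjE)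
  show "regular X {z\<in>points X. (g, z) \<in> W} (\<lambda>z. h (g, z))"
  proof (cases "g \<in> U")
    case True
    then have "{z\<in>points X. (g, z) \<in> W} = V" using h(1) open_subset_points[OF h(2)] by auto
    moreover have "regular X V (\<lambda>z. \<Sum>i<n. f i g * f' i z)"
      by (intro regular_sum regular_mult regular_const h(2)) (use h(3) in simp)
    ultimately show ?thesis using h(4) by simp
  next
    case False
    then have "{z\<in>points X. (g, z) \<in> W} = {}" using h(1) by auto
    then show ?thesis by (simp only: regular_empty)
  qed
qed

lemma (in fraction_functions) slice_left:
  assumes g: "g \<in> U" "openin (zariski S) U" "regular S U (\<lambda>_. 1)"
  shows "morphism X (product_space X S) (\<lambda>x. (x, g))"
proof (rule morphism_into_product)
  fix x assume x: "x \<in> points X"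
  have "(\<lambda>_. 1) \<in> product_sections X S (points X \<times> U)"
    by (rule product_section_one[OF _ _ g(3,2)]) (simp_all add: regular_const)
  then show "\<exists>W h. h \<in> product_sections X S W \<and> (x, g) \<in> W \<and> h (x, g) \<noteq> 0"
    using g(1) x by (intro exI[of _ "points X \<times> U"] exI[of _ "\<lambda>_. 1"]) simp
next
  fix W h assume "h \<in> product_sections X S W"
  from product_sectionsE[OF this] obtain V U f' f and n :: nat where h: "W = V \<times> U" "openin (zariski X) V"
    "\<forall>i<n. regular X V (f' i) \<and> regular S U (f i)" "h = (\<lambda>(x, y). \<Sum>i<n. f' i x * f i y)" by (elim exE conjE)
  show "regular X {z\<in>points X. (z, g) \<in> W} (\<lambda>z. h (z, g))"
  proof (cases "g \<in> U")
    case True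
    then have "{z\<in>points X. (z, g) \<in> W} = V" using h(1) open_subset_points[OF h(2)] by auto
    moreover have "regular X V (\<lambda>z. \<Sum>i<n. f' i z * f i g)"
      by (intro regular_sum regular_mult regular_const h(2)) (use h(3) in simp)
    ultimately show ?thesis using h(4) by simp
  next
    case False
    then have "{z\<in>points X. (z, g) \<in> W} = {}" using h(1) by auto
    then show ?thesis by (simp only: regular_empty)
  qed
qed

lemma range_poly_ring_set: "ring_set (range (poly :: 'k::field poly \<Rightarrow> 'k \<Rightarrow> 'k))"
  unfolding ring_set_def
proof (intro conjI ballI)
  show "1 \<in> range (poly :: 'k poly \<Rightarrow> 'k \<Rightarrow> 'k)" by (rule range_eqI[of _ _ 1]) (simp add: fun_eq_iff)
  fix a b :: "'k \<Rightarrow> 'k" assume "a \<in> range poly" "b \<in> range poly"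
  then obtain p q where pq: "a = poly p" "b = poly q" by blast
  show "a - b \<in> range poly" by (rule range_eqI[of _ _ "p - q"]) (simp add: fun_eq_iff pq)
  show "a * b \<in> range poly" by (rule range_eqI[of _ _ "p * q"]) (simp add: fun_eq_iff pq)
qed

lemma Gm_points: "points (Gm_space :: ('k::field, 'k) fun_space) = - {0}"
  and Gm_fraction_functions: "fraction_functions (Gm_space :: ('k, 'k) fun_space) (range poly)"
proof -
  have c: "(\<lambda>x. c) \<in> range poly" for c :: 'k
    by (rule range_eqI[of _ _ "[:c:]"]) (simp add: fun_eq_iff)
  show "points (Gm_space :: ('k, 'k) fun_space) = - {0}"
    unfolding Gm_space_def by (rule fraction_space_single[OF range_poly_ring_set c])
  show "fraction_functions (Gm_space :: ('k, 'k) fun_space) (range poly)"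
    unfolding Gm_space_def by (rule fraction_space_single[OF range_poly_ring_set c])
qed

interpretation Gm: fraction_functions "Gm_space :: ('k::{field_char_0}, 'k) fun_space" "range poly"
  by (rule Gm_fraction_functions)

lemma poly_eq_of_cofinite:
  fixes p q :: "'k::field_char_0 poly"
  assumes "finite F" "\<And>t. t \<notin> F \<Longrightarrow> poly p t = poly q t"
  shows "p = q"
proof (rule ccontr)
  assume "p \<noteq> q"
  then have "finite {t. poly (p - q) t = 0}" by (intro poly_roots_finite) simp
  moreover have "UNIV \<subseteq> F \<union> {t. poly (p - q) t = 0}" using assms(2) by auto
  ultimately show False using assms(1) infinite_UNIV_char_0 by (meson finite_UnI finite_subset)
qed

lemma Gm_open_cofinite:
  fixes U :: "'k::field_char_0 set"
  assumes "openin (zariski Gm_space) U" "t \<in> U"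
  shows "finite (- U)"
proof -
  obtain q where q: "poly q t \<noteq> 0" "\<forall>s\<in>- {0}. poly q s \<noteq> 0 \<longrightarrow> s \<in> U"
    using Gm.open_basic[OF assms] Gm_points by auto
  have "q \<noteq> 0" using q(1) by auto
  then have "finite (insert 0 {s. poly q s = 0})" using poly_roots_finite by blast
  moreover have "- U \<subseteq> insert 0 {s. poly q s = 0}" using q(2) by auto
  ultimately show ?thesis by (rule finite_subset[rotated])
qed

lemma Gm_regular_fraction:
  fixes f :: "'k::field_char_0 \<Rightarrow> 'k"
  assumes "regular Gm_space U f" "t \<in> U"
  shows "\<exists>p q. poly q t \<noteq> 0 \<and> (\<forall>s. s \<noteq> 0 \<longrightarrow> poly q s \<noteq> 0 \<longrightarrow> s \<in> U \<and> f s = poly p s / poly q s)"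
  using Gm.regular_fraction[OF assms] Gm_points by auto

text \<open>
  A regular function on the torus is a rational function without poles in the torus. Among all
  denominators one of minimal degree has no root except zero, so over an algebraically closed field it is
  a power of the coordinate.
\<close>

lemma Gm_regular_laurent:
  fixes h :: "'k::{alg_closed_field, field_char_0} \<Rightarrow> 'k"
  assumes h: "regular Gm_space (- {0}) h"
  shows "\<exists>N p. \<forall>t. t \<noteq> 0 \<longrightarrow> t ^ N * h t = poly p t"
proof -
  \<comment> \<open>A polynomial relation that holds at almost all points holds on the whole torus.\<close>
  have extend: "poly q t1 * h t1 = poly p t1"
    if F: "finite F" "\<And>t. t \<notin> F \<Longrightarrow> poly q t * h t = poly p t" and t1: "t1 \<noteq> 0" for F p q t1
  proof -
    obtain a b where ab: "poly b t1 \<noteq> 0" "\<forall>s. s \<noteq> 0 \<longrightarrow> poly b s \<noteq> 0 \<longrightarrow> s \<in> - {0} \<and> h s = poly a s / poly b s"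
      using Gm_regular_fraction[OF h, of t1] t1 by blast
    have "b \<noteq> 0" using ab(1) by auto
    then have fin: "finite (insert 0 (F \<union> {s. poly b s = 0}))" using F(1) poly_roots_finite by blast
    have "q * a = p * b"
    proof (rule poly_eq_of_cofinite[OF fin])
      fix t assume t: "t \<notin> insert 0 (F \<union> {s. poly b s = 0})"
      have "poly q t * h t = poly p t" using F(2) t by blast
      moreover have "h t = poly a t / poly b t" "poly b t \<noteq> 0" using ab(2) t by auto
      ultimately show "poly (q * a) t = poly (p * b) t" by (simp add: field_simps)
    qed
    then have "poly q t1 * poly a t1 = poly p t1 * poly b t1" by (metis poly_mult)
    moreover have "h t1 = poly a t1 / poly b t1" using ab t1 by blast
    ultimately have "poly b t1 * (poly q t1 * h t1) = poly b t1 * poly p t1" using ab(1) by simp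
    then show ?thesis using ab(1) by simp
  qed
  define good where "good d \<longleftrightarrow> (\<exists>q p. q \<noteq> 0 \<and> degree q = d \<and> (\<forall>t. t \<noteq> 0 \<longrightarrow> poly q t * h t = poly p t))" for d
  have "\<exists>d. good d"
  proof -
    obtain a b where ab: "poly b 1 \<noteq> 0" "\<forall>s. s \<noteq> 0 \<longrightarrow> poly b s \<noteq> 0 \<longrightarrow> s \<in> - {0} \<and> h s = poly a s / poly b s"
      using Gm_regular_fraction[OF h, of 1] by auto
    have b0: "b \<noteq> 0" using ab(1) by auto
    then have fin: "finite (insert 0 {s. poly b s = 0})" using poly_roots_finite by blast
    have "poly b t * h t = poly a t" if "t \<noteq> 0" for t
      by (rule extend[OF fin _ that]) (use ab(2) in auto)
    then show ?thesis unfolding good_def using b0 by blast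
  qed
  then have "good (LEAST d. good d)" by (rule LeastI_ex)
  then obtain q p where q: "q \<noteq> 0" "degree q = (LEAST d. good d)" "\<And>t. t \<noteq> 0 \<Longrightarrow> poly q t * h t = poly p t"
    unfolding good_def by blast
  have root: "t1 = 0" if t1: "poly q t1 = 0" for t1
  proof (rule ccontr)
    assume nz: "t1 \<noteq> 0"
    then have "poly p t1 = 0" using q(3)[OF nz] t1 by simp
    then obtain p' q' where pq: "q = [:- t1, 1:] * q'" "p = [:- t1, 1:] * p'"
      using t1 by (metis dvdE poly_eq_0_iff_dvd)
    have q'0: "q' \<noteq> 0" using pq(1) q(1) by auto
    have "poly q' t * h t = poly p' t" if "t \<noteq> 0" for t
    proof (rule extend[OF _ _ that, of "{0, t1}"])
      fix s assume s: "s \<notin> {0, t1}"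
      then have "(s - t1) * (poly q' s * h s) = (s - t1) * poly p' s"
        using q(3)[of s] pq by (simp add: algebra_simps)
      then show "poly q' s * h s = poly p' s" using s by simp
    qed simp
    then have "good (degree q')" unfolding good_def using q'0 by blast
    moreover have "degree q' < degree q"
    proof -
      have "degree q = degree [:- t1, 1:] + degree q'" unfolding pq(1) by (rule degree_mult_eq) (use q'0 in auto)
      then show ?thesis by simp
    qed
    ultimately show False using Least_le[of good "degree q'"] q(2) by linarith
  qed
  obtain r where r: "q = [:- 0, 1:] ^ order 0 q * r" "\<not> [:- 0, 1:] dvd r" using order_decomp[OF q(1)] by blast
  have "degree r = 0"
  proof (rule ccontr)
    assume "degree r \<noteq> 0"
    then obtain z where z: "poly r z = 0" using alg_closed_imp_poly_has_root by blast
    then have "poly q z = 0" using arg_cong[OF r(1), of "\<lambda>p. poly p z"] by simp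
    then have "z = 0" by (rule root)
    then show False using z r(2) poly_eq_0_iff_dvd by blast
  qed
  then obtain c where c: "r = [:c:]" using degree_eq_zeroE by blast
  have c0: "c \<noteq> 0" using c r(1) q(1) by auto
  have "t ^ order 0 q * h t = poly (smult (inverse c) p) t" if "t \<noteq> 0" for t
  proof -
    have "poly q t = t ^ order 0 q * c" using arg_cong[OF r(1), of "\<lambda>p. poly p t"] c by simp
    then show ?thesis using q(3)[OF that] c0 by (simp add: field_simps)
  qed
  then show ?thesis by blast
qed

lemma laurent_of_poly:
  fixes h :: "'k::field_char_0 \<Rightarrow> 'k"
  assumes "degree p \<le> 2 * N" "t \<noteq> 0" "t ^ N * h t = poly p t"
  shows "h t = (\<Sum>j\<in>{- int N..int N}. coeff p (nat (j + int N)) * t powi j)"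
proof -
  have "(\<Sum>j\<in>{- int N..int N}. coeff p (nat (j + int N)) * t powi j)
    = (\<Sum>i\<in>{..2 * N}. coeff p i * t powi (int i - int N))"
    by (rule sum.reindex_bij_witness[of _ "\<lambda>i. int i - int N" "\<lambda>j. nat (j + int N)"]) auto
  also have "\<dots> = (\<Sum>i\<in>{..2 * N}. coeff p i * t ^ i) / t ^ N"
    unfolding sum_divide_distrib using assms(2) by (simp add: power_int_diff)
  also have "(\<Sum>i\<in>{..2 * N}. coeff p i * t ^ i) = poly p t"
    unfolding poly_altdef using assms(1) by (intro sum.mono_neutral_right) (auto simp: coeff_eq_0)
  also have "poly p t / t ^ N = h t" using assms by (simp add: field_simps)
  finally show ?thesis by simp
qed

lemma laurent_zero:
  fixes c :: "int \<Rightarrow> 'k::field_char_0"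
  assumes J: "finite J" and z: "\<And>t. t \<noteq> 0 \<Longrightarrow> (\<Sum>j\<in>J. c j * t powi j) = 0" and j: "j \<in> J"
  shows "c j = 0"
proof -
  obtain N :: nat where N: "\<And>j. j \<in> J \<Longrightarrow> 0 \<le> j + int N"
  proof
    fix j assume "j \<in> J"
    then have "\<bar>j\<bar> \<le> (\<Sum>j\<in>J. \<bar>j\<bar>)" using J by (intro member_le_sum) auto
    then show "0 \<le> j + int (nat (\<Sum>j\<in>J. \<bar>j\<bar>))" by linarith
  qed
  define P where "P = (\<Sum>j\<in>J. monom (c j) (nat (j + int N)))"
  have "poly P t = poly 0 t" if "t \<notin> {0}" for t
  proof -
    have t: "t \<noteq> 0" using that by simp
    have "poly P t = (\<Sum>j\<in>J. c j * t ^ nat (j + int N))" by (simp add: P_def poly_sum poly_monom)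
    also have "\<dots> = (\<Sum>j\<in>J. t ^ N * (c j * t powi j))"
    proof (rule sum.cong[OF refl])
      fix j assume "j \<in> J"
      then have "t ^ nat (j + int N) = t powi (j + int N)" using N by (simp add: power_int_nonneg_exp)
      then show "c j * t ^ nat (j + int N) = t ^ N * (c j * t powi j)" using t by (simp add: power_int_add)
    qed
    also have "\<dots> = 0" using z[OF t] by (simp flip: sum_distrib_left)
    finally show ?thesis by simp
  qed
  then have "P = 0" by (intro poly_eq_of_cofinite[of "{0}"]) auto
  then have "0 = coeff P (nat (j + int N))" by simp
  also have "\<dots> = (\<Sum>i\<in>J. if nat (i + int N) = nat (j + int N) then c i else 0)"
    by (simp add: P_def coeff_sum)
  also have "\<dots> = (\<Sum>i\<in>J. if i = j then c i else 0)"
    using N j by (intro sum.cong refl) (metis add_right_cancel nat_0_le of_nat_eq_iff)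
  also have "\<dots> = c j" using J j by simp
  finally show ?thesis by simp
qed

text \<open>
  Combining the dilates \<open>h (2 ^ k * t)\<close> with the coefficients of \<open>P\<close> multiplies the coefficient of
  \<open>t powi j\<close> by \<open>P (2 powi j)\<close>. As the powers of two are distinct in characteristic zero, a suitable
  \<open>P\<close> annihilates any given finite set of exponents. This bounds the exponents that occur and extracts
  single coefficients using only finitely many elements of the torus.
\<close>

lemma laurent_dilation_sum:
  fixes h :: "'k::field_char_0 \<Rightarrow> 'k"
  assumes h: "\<And>t. t \<noteq> 0 \<Longrightarrow> h t = (\<Sum>j\<in>J. c j * t powi j)" and t: "t \<noteq> 0"
  shows "(\<Sum>k\<le>degree P. coeff P k * h (2 ^ k * t)) = (\<Sum>j\<in>J. (c j * poly P (2 powi j)) * t powi j)"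
proof -
  have "(\<Sum>k\<le>degree P. coeff P k * h (2 ^ k * t))
      = (\<Sum>k\<le>degree P. \<Sum>j\<in>J. coeff P k * (c j * ((2 powi j) ^ k * t powi j)))"
  proof (rule sum.cong[OF refl])
    fix k
    have "h (2 ^ k * t) = (\<Sum>j\<in>J. c j * (2 ^ k * t) powi j)" using t by (intro h) simp
    then show "coeff P k * h (2 ^ k * t) = (\<Sum>j\<in>J. coeff P k * (c j * ((2 powi j) ^ k * t powi j)))"
      by (simp add: sum_distrib_left power_int_mult_distrib power_int_power power_int_power' mult.commute)
  qed
  also have "\<dots> = (\<Sum>j\<in>J. \<Sum>k\<le>degree P. coeff P k * (c j * ((2 powi j) ^ k * t powi j)))" by (rule sum.swap)
  also have "\<dots> = (\<Sum>j\<in>J. (c j * poly P (2 powi j)) * t powi j)"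
    by (intro sum.cong refl) (simp add: poly_altdef sum_distrib_left sum_distrib_right mult_ac)
  finally show ?thesis .
qed

lemma two_powi_inject: "(2 :: 'k::field_char_0) powi i = 2 powi j \<Longrightarrow> i = j"
proof (induction i j rule: linorder_wlog)
  case (le i j)
  then have "(2 :: 'k) powi (j - i) = 1" by (simp add: power_int_diff)
  then have "(2 :: 'k) ^ nat (j - i) = 1" using le(1) by (simp add: power_int_nonneg_exp)
  then have "of_nat (2 ^ nat (j - i)) = (of_nat 1 :: 'k)" by simp
  then have "(2::nat) ^ nat (j - i) = 1" by (simp only: of_nat_eq_iff)
  then show ?case using le(1) by simp
qed metis

section \<open>The weight decomposition for a torus action\<close>

text \<open>
  The upper bound for the exponents comes from comparing degrees in the equation, the lower bound from
  comparing orders of vanishing at zero.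
\<close>

lemma laurent_bound:
  fixes p a b :: "'k::field_char_0 poly"
  assumes eq: "p * b = monom 1 N * a" and b: "b \<noteq> 0" "degree b \<le> M" and a: "degree a \<le> M"
    and h: "\<And>t. t \<noteq> 0 \<Longrightarrow> t ^ N * h t = poly p t"
  shows "\<exists>p'. degree p' \<le> 2 * M \<and> (\<forall>t. t \<noteq> 0 \<longrightarrow> t ^ M * h t = poly p' t)"
proof (cases "p = 0")
  case True
  then have "h t = 0" if "t \<noteq> 0" for t using h[OF that] that by simp
  then show ?thesis by (intro exI[of _ 0]) simp
next
  case False
  then have a0: "a \<noteq> 0" using eq b by auto
  have "degree p + degree b = N + degree a"
    using arg_cong[OF eq, of degree] False b a0 by (simp add: degree_mult_eq degree_monom_eq)
  then have degp: "degree p \<le> N + M" using a by linarith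
  have "monom 1 N dvd p * b" by (simp add: eq)
  then have "[:- 0, 1:] ^ N dvd p * b" by (simp add: monom_altdef)
  then have "N \<le> order 0 (p * b)" using False b by (subst (asm) order_divides) auto
  also have "order 0 (p * b) = order 0 p + order 0 b" using False b by (intro order_mult) auto
  finally have "N - M \<le> order 0 p" using order_degree[OF b(1), of 0] b(2) by linarith
  then have "[:- 0, 1:] ^ (N - M) dvd p" by (subst order_divides) auto
  then obtain r where r: "p = monom 1 (N - M) * r" by (auto simp: monom_altdef elim: dvdE)
  then have r0: "r \<noteq> 0" using False by auto
  have degr: "degree p = N - M + degree r" unfolding r using r0 by (simp add: degree_mult_eq degree_monom_eq)
  have "degree (monom 1 (M - N) * r) = M - N + degree r" using r0 by (simp add: degree_mult_eq degree_monom_eq)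
  then have "degree (monom 1 (M - N) * r) \<le> 2 * M" using degr degp by linarith
  moreover have "t ^ M * h t = poly (monom 1 (M - N) * r) t" if t: "t \<noteq> 0" for t
  proof (cases "M \<le> N")
    case True
    have "t ^ (N - M) * (t ^ M * h t) = t ^ N * h t" using True by (simp flip: power_add mult.assoc)
    also have "\<dots> = t ^ (N - M) * poly r t" using h[OF t] by (simp add: r poly_monom)
    finally show ?thesis using t True by (simp add: poly_monom)
  next
    case False
    then have "t ^ M * h t = t ^ (M - N) * (t ^ N * h t)" by (simp flip: power_add mult.assoc)
    then show ?thesis using h[OF t] False by (simp add: r poly_monom)
  qed
  ultimately show ?thesis by blast
qed

text \<open>
  Finitely many functions of the torus variable occur in a section, so they have a common denominator.
  It is essential for what follows that \<open>Q\<close> and \<open>d\<close> do not depend on the second variable.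
\<close>

lemma section_numerators:
  fixes a :: "'k::field_char_0 \<times> 'a \<Rightarrow> 'k"
  assumes "a \<in> product_sections Gm_space X W" "(t0, x0) \<in> W"
  shows "\<exists>Q d A. poly Q t0 \<noteq> 0 \<and> (\<forall>x. degree (A x) \<le> (d::nat)) \<and>
    (\<forall>x s. s \<noteq> 0 \<longrightarrow> poly Q s \<noteq> 0 \<longrightarrow> poly Q s * a (s, x) = poly (A x) s)"
proof -
  from product_sectionsE[OF assms(1)] obtain U V f g and n :: nat where h: "W = U \<times> V"
    "\<forall>i<n. regular Gm_space U (f i) \<and> regular X V (g i)" "a = (\<lambda>(x, y). \<Sum>i<n. f i x * g i y)" by (elim exE conjE)
  have t0: "t0 \<in> U" using h(1) assms(2) by blast
  have "\<exists>p q. poly q t0 \<noteq> 0 \<and> (\<forall>s. s \<noteq> 0 \<longrightarrow> poly q s \<noteq> 0 \<longrightarrow> f i s = poly p s / poly q s)" if "i < n" for i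
    using Gm_regular_fraction[OF conjunct1[OF h(2)[rule_format, OF that]] t0] by blast
  then obtain p q where pq: "\<And>i. i < n \<Longrightarrow> poly (q i) t0 \<noteq> 0"
    "\<And>i s. i < n \<Longrightarrow> s \<noteq> 0 \<Longrightarrow> poly (q i) s \<noteq> 0 \<Longrightarrow> f i s = poly (p i) s / poly (q i) s" by metis
  define Q where "Q = (\<Prod>i<n. q i)"
  define R where "R i = p i * (\<Prod>j\<in>{..<n} - {i}. q j)" for i
  define A where "A x = (\<Sum>i<n. smult (g i x) (R i))" for x
  have "poly Q t0 \<noteq> 0" using pq(1) by (simp add: Q_def poly_prod)
  moreover have "degree (A x) \<le> (\<Sum>i<n. degree (R i))" for x
    unfolding A_def
  proof (rule degree_sum_le)
    fix i assume "i \<in> {..<n}"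
    then have "degree (R i) \<le> (\<Sum>i<n. degree (R i))" by (intro member_le_sum) auto
    then show "degree (smult (g i x) (R i)) \<le> (\<Sum>i<n. degree (R i))" using degree_smult_le order_trans by blast
  qed simp
  moreover have "poly Q s * a (s, x) = poly (A x) s" if s: "s \<noteq> 0" "poly Q s \<noteq> 0" for x s
  proof -
    have "poly Q s * a (s, x) = (\<Sum>i<n. poly Q s * (f i s * g i x))" by (simp add: h(3) sum_distrib_left)
    also have "\<dots> = (\<Sum>i<n. g i x * poly (R i) s)"
    proof (rule sum.cong[OF refl])
      fix i assume i: "i \<in> {..<n}"
      have Q: "Q = q i * (\<Prod>j\<in>{..<n} - {i}. q j)" unfolding Q_def using i by (intro prod.remove) auto
      then have qi: "poly (q i) s \<noteq> 0" using s(2) by auto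
      then have "f i s = poly (p i) s / poly (q i) s" using pq(2) i s by blast
      then show "poly Q s * (f i s * g i x) = g i x * poly (R i) s" using qi by (simp add: R_def Q)
    qed
    also have "\<dots> = poly (A x) s" by (simp add: A_def poly_sum)
    finally show ?thesis .
  qed
  ultimately show ?thesis by blast
qed

locale torus_action = affine_chart X n \<chi>
  for X :: "('a, 'k::{alg_closed_field, field_char_0}) fun_space" and n :: nat and \<chi> :: "'a \<Rightarrow> nat \<Rightarrow> 'k" +
  fixes \<psi> :: "'k \<Rightarrow> 'a \<Rightarrow> 'a"
  assumes action: "regular_action Gm_group Gm_space X \<psi>"
begin

lemma action_group: "group_action Gm_group (points X) \<psi>"
  and action_morphism: "morphism (product_space Gm_space X) X (\<lambda>(t, x). \<psi> t x)"
  using action unfolding regular_action_def by blast+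

lemma act_points: "t \<noteq> 0 \<Longrightarrow> x \<in> points X \<Longrightarrow> \<psi> t x \<in> points X"
  using group_action.element_image[OF action_group, of t x] by (simp add: Gm_group_def)

lemma act_one: "x \<in> points X \<Longrightarrow> \<psi> 1 x = x"
  using fun_cong[OF group_action.id_eq_one[OF action_group], of x] by (simp add: Gm_group_def)

lemma act_mult: "s \<noteq> 0 \<Longrightarrow> t \<noteq> 0 \<Longrightarrow> x \<in> points X \<Longrightarrow> \<psi> (s * t) x = \<psi> s (\<psi> t x)"
  using group_action.composition_rule[OF action_group, of x s t] by (simp add: Gm_group_def)

lemma Gm_regular_one: "openin (zariski Gm_space) (- {0::'k})" "regular Gm_space (- {0::'k}) (\<lambda>_. 1)"
proof -
  interpret Gm: fraction_functions "Gm_space :: ('k, 'k) fun_space" "range poly" by (rule Gm_fraction_functions)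
  show o: "openin (zariski Gm_space) (- {0::'k})" using openin_topspace[of "zariski (Gm_space :: ('k, 'k) fun_space)"]
    by (simp add: Gm_points)
  show "regular Gm_space (- {0::'k}) (\<lambda>_. 1)" by (rule Gm.regular_const[OF o])
qed

lemma torus_slice: "t \<noteq> 0 \<Longrightarrow> morphism X (product_space Gm_space X) (\<lambda>x. (t, x))"
  by (rule slice_right[OF _ Gm_regular_one]) simp

lemma orbit_slice: "x \<in> points X \<Longrightarrow> morphism Gm_space (product_space Gm_space X) (\<lambda>t. (t, x))"
  by (rule fraction_functions.slice_left[OF Gm_fraction_functions _ points_open]) (simp_all add: regular_const)

lemma act_regular: "t \<noteq> 0 \<Longrightarrow> global g \<Longrightarrow> global (\<lambda>x. g (\<psi> t x))"
  using morphism_regular[OF morphism_comp[OF torus_slice action_morphism], of t g] by simp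

lemma orbit_laurent:
  assumes "x \<in> points X" "global g"
  shows "\<exists>N p. \<forall>t. t \<noteq> 0 \<longrightarrow> t ^ N * g (\<psi> t x) = poly p t"
proof (rule Gm_regular_laurent)
  show "regular Gm_space (- {0}) (\<lambda>t. g (\<psi> t x))"
    using morphism_regular[OF morphism_comp[OF orbit_slice[OF assms(1)] action_morphism] assms(2)] by (simp add: Gm_points)
qed

text \<open>
  Along a single orbit a global function is a Laurent polynomial. That its exponents are bounded for all
  orbits near \<open>x0\<close> is where the regularity of the action on the product enters.
\<close>

lemma local_laurent_bound:
  assumes g: "global g" and x0: "x0 \<in> points X"
  shows "\<exists>W M. openin (zariski X) W \<and> x0 \<in> W \<and>
    (\<forall>x\<in>W. \<exists>p. degree p \<le> 2 * M \<and> (\<forall>t. t \<noteq> 0 \<longrightarrow> t ^ M * g (\<psi> t x) = poly p t))"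
proof -
  let ?P = "product_space Gm_space X"
  have F: "regular ?P (points ?P) (\<lambda>z. g (case z of (t, x) \<Rightarrow> \<psi> t x))" by (rule morphism_regular[OF action_morphism g])
  have "(1, x0) \<in> points ?P" by (rule morphism_points[OF torus_slice x0]) simp
  from product_regular_fraction[OF F this] obtain U N a b where
    ab: "a \<in> product_sections Gm_space X U" "b \<in> product_sections Gm_space X U" "openin (zariski ?P) N"
      "(1, x0) \<in> N" "N \<subseteq> U \<inter> points ?P" "\<forall>z\<in>N. b z \<noteq> 0 \<and> g (case z of (t, x) \<Rightarrow> \<psi> t x) = a z / b z"
    by (elim exE conjE)
  have U: "(1, x0) \<in> U" using ab(4,5) by blast
  obtain Qa da A where A: "poly Qa 1 \<noteq> 0" "\<forall>x. degree (A x) \<le> da"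
    "\<forall>x s. s \<noteq> 0 \<longrightarrow> poly Qa s \<noteq> 0 \<longrightarrow> poly Qa s * a (s, x) = poly (A x) s"
    using section_numerators[OF ab(1) U] by (elim exE conjE)
  obtain Qb db B' where B: "poly Qb 1 \<noteq> 0" "\<forall>x. degree (B' x) \<le> db"
    "\<forall>x s. s \<noteq> 0 \<longrightarrow> poly Qb s \<noteq> 0 \<longrightarrow> poly Qb s * b (s, x) = poly (B' x) s"
    using section_numerators[OF ab(2) U] by (elim exE conjE)
  \<comment> \<open>A bound for the degrees of numerator and denominator in \<open>t\<close>, uniform in \<open>x\<close>.\<close>
  define M where "M = da + db + degree Qa + degree Qb"
  define W where "W = {x\<in>points X. (1, x) \<in> N}"
  have "openin (zariski X) W"
    using torus_slice[of 1] ab(3) unfolding W_def morphism_def continuous_map_def by simp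
  moreover have "x0 \<in> W" using x0 ab(4) by (simp add: W_def)
  moreover have "\<exists>p. degree p \<le> 2 * M \<and> (\<forall>t. t \<noteq> 0 \<longrightarrow> t ^ M * g (\<psi> t x) = poly p t)" if x: "x \<in> W" for x
  proof -
    have xp: "x \<in> points X" and xN: "(1, x) \<in> N" using x by (simp_all add: W_def)
    obtain m p where p: "\<forall>t. t \<noteq> 0 \<longrightarrow> t ^ m * g (\<psi> t x) = poly p t" using orbit_laurent[OF xp g] by (elim exE)
    let ?T = "{t\<in>points Gm_space. (t, x) \<in> N}"
    have "openin (zariski Gm_space) ?T"
      using orbit_slice[OF xp] ab(3) unfolding morphism_def continuous_map_def by simp
    then have fin: "finite (- ?T)" by (rule Gm_open_cofinite[of _ 1]) (simp add: Gm_points xN)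
    have q0: "Qa \<noteq> 0" "Qb \<noteq> 0" using A(1) B(1) by auto
    have "poly (B' x) 1 = poly Qb 1 * b (1, x)" using B(1,3) by simp
    also have "\<dots> \<noteq> 0" using B(1) ab(6) xN by simp
    finally have B0: "B' x \<noteq> 0" by auto
    have fin': "finite (insert 0 (- ?T \<union> {t. poly Qa t = 0} \<union> {t. poly Qb t = 0}))"
      using fin poly_roots_finite[OF q0(1)] poly_roots_finite[OF q0(2)] by simp
    have eq: "p * (Qa * B' x) = monom 1 m * (Qb * A x)"
    proof (rule poly_eq_of_cofinite[OF fin'])
      fix t assume "t \<notin> insert 0 (- ?T \<union> {t. poly Qa t = 0} \<union> {t. poly Qb t = 0})"
      then have t: "t \<noteq> 0" "(t, x) \<in> N" "poly Qa t \<noteq> 0" "poly Qb t \<noteq> 0" by auto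
      have 1: "b (t, x) \<noteq> 0" "g (\<psi> t x) = a (t, x) / b (t, x)" using ab(6) t(2) by auto
      have "poly p t = t ^ m * (a (t, x) / b (t, x))" using p[rule_format, OF t(1)] 1(2) by simp
      moreover have "poly (A x) t = poly Qa t * a (t, x)" "poly (B' x) t = poly Qb t * b (t, x)" using A(3) B(3) t by simp_all
      ultimately show "poly (p * (Qa * B' x)) t = poly (monom 1 m * (Qb * A x)) t"
        using 1(1) by (simp add: poly_monom)
    qed
    show ?thesis
    proof (rule laurent_bound[OF eq])
      show "Qa * B' x \<noteq> 0" using q0 B0 by simp
      show "degree (Qa * B' x) \<le> M" using degree_mult_le[of Qa "B' x"] B(2)[rule_format, of x] by (simp add: M_def)
      show "degree (Qb * A x) \<le> M" using degree_mult_le[of Qb "A x"] A(2)[rule_format, of x] by (simp add: M_def)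
    qed (use p in blast)
  qed
  ultimately show ?thesis by (intro exI[of _ W] exI[of _ M]) blast
qed

definition weight :: "int \<Rightarrow> ('a \<Rightarrow> 'k) \<Rightarrow> bool" where
  "weight j g \<longleftrightarrow> global g \<and> (\<forall>t x. t \<noteq> 0 \<longrightarrow> x \<in> points X \<longrightarrow> g (\<psi> t x) = t powi j * g x)"

definition dilation_sum :: "'k poly \<Rightarrow> ('a \<Rightarrow> 'k) \<Rightarrow> 'k \<Rightarrow> 'a \<Rightarrow> 'k" where
  "dilation_sum P g t x = (\<Sum>k\<le>degree P. coeff P k * g (\<psi> (2 ^ k * t) x))"

lemma dilation_sum_regular: "global g \<Longrightarrow> t \<noteq> 0 \<Longrightarrow> global (dilation_sum P g t)"
  unfolding dilation_sum_def
  by (intro regular_sum regular_mult regular_const act_regular) simp_all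

lemma dilation_sum_laurent:
  assumes "\<And>t. t \<noteq> 0 \<Longrightarrow> g (\<psi> t x) = (\<Sum>j\<in>J. c j * t powi j)" "t \<noteq> 0"
  shows "dilation_sum P g t x = (\<Sum>j\<in>J. (c j * poly P (2 powi j)) * t powi j)"
  unfolding dilation_sum_def by (rule laurent_dilation_sum[OF assms])

definition weight_parts :: "('a \<Rightarrow> 'k) \<Rightarrow> nat \<Rightarrow> (int \<Rightarrow> 'a \<Rightarrow> 'k) \<Rightarrow> bool" where
  "weight_parts g N c \<longleftrightarrow> (\<forall>j. weight j (c j)) \<and> (\<forall>j. j \<notin> {- int N..int N} \<longrightarrow> c j = (\<lambda>_. 0)) \<and>
    (\<forall>t x. t \<noteq> 0 \<longrightarrow> x \<in> points X \<longrightarrow> g (\<psi> t x) = (\<Sum>j\<in>{- int N..int N}. c j x * t powi j))"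

lemma weight_partsD:
  assumes "weight_parts g N c"
  shows "\<forall>j. weight j (c j)" "\<forall>j. j \<notin> {- int N..int N} \<longrightarrow> c j = (\<lambda>_. 0)"
    "\<forall>t x. t \<noteq> 0 \<longrightarrow> x \<in> points X \<longrightarrow> g (\<psi> t x) = (\<Sum>j\<in>{- int N..int N}. c j x * t powi j)"
  using assms unfolding weight_parts_def by blast+

text \<open>
  The bound on the exponents holds on a nonempty open set. It extends to all of \<open>X\<close> by the identity
  principle, because the dilation sum that annihilates the permitted exponents is a regular function.
  The components are extracted by dilation sums as well, hence they are regular.
\<close>

theorem weight_decomposition:
  assumes g: "global g"
  shows "\<exists>N c. weight_parts g N c"
proof -
  obtain x0 where x0: "x0 \<in> points X" using irreducible unfolding irreducible_in_def by blast
  obtain W M where W: "openin (zariski X) W" "x0 \<in> W"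
    "\<forall>x\<in>W. \<exists>p. degree p \<le> 2 * M \<and> (\<forall>t. t \<noteq> 0 \<longrightarrow> t ^ M * g (\<psi> t x) = poly p t)"
    using local_laurent_bound[OF g x0] by (elim exE conjE)
  define J where "J = {- int M..int M}"
  \<comment> \<open>It annihilates exactly the exponents in \<open>J\<close>.\<close>
  define P where "P = (\<Prod>i\<in>J. [:- (2 powi i), 1:] :: 'k poly)"
  have Pzero: "poly P (2 powi j) = 0 \<longleftrightarrow> j \<in> J" for j
  proof -
    have "poly P (2 powi j) = (\<Prod>i\<in>J. 2 powi j - 2 powi i)" by (simp add: P_def poly_prod)
    also have "\<dots> = 0 \<longleftrightarrow> (\<exists>i\<in>J. (2::'k) powi j = 2 powi i)" by (simp add: J_def)
    also have "\<dots> \<longleftrightarrow> j \<in> J" using two_powi_inject by blast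
    finally show ?thesis .
  qed
  have on_W: "dilation_sum P g t x = 0" if "x \<in> W" "t \<noteq> 0" for x t
  proof -
    obtain p where p: "degree p \<le> 2 * M" "\<forall>t. t \<noteq> 0 \<longrightarrow> t ^ M * g (\<psi> t x) = poly p t" using W(3) \<open>x \<in> W\<close> by blast
    have "dilation_sum P g t x = (\<Sum>j\<in>J. (coeff p (nat (j + int M)) * poly P (2 powi j)) * t powi j)"
      unfolding J_def
      by (rule dilation_sum_laurent[OF laurent_of_poly[OF p(1)]]) (use p(2) \<open>t \<noteq> 0\<close> in auto)
    also have "\<dots> = 0" by (intro sum.neutral) (simp add: Pzero)
    finally show ?thesis .
  qed
  have op0: "dilation_sum P g t x = 0" if "x \<in> points X" "t \<noteq> 0" for x t
    by (rule regular_agree[OF irreducible dilation_sum_regular[OF g that(2)] regular_const[OF points_open] W(1) _ _ that(1)])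
      (use W(2) on_W that(2) in auto)
  have expand: "\<exists>c. \<forall>t. t \<noteq> 0 \<longrightarrow> g (\<psi> t x) = (\<Sum>j\<in>J. c j * t powi j)" if x: "x \<in> points X" for x
  proof -
    obtain m p where p: "\<forall>t. t \<noteq> 0 \<longrightarrow> t ^ m * g (\<psi> t x) = poly p t" using orbit_laurent[OF x g] by (elim exE)
    define m' where "m' = m + M + degree p"
    define p' where "p' = monom 1 (M + degree p) * p"
    define c where "c j = coeff p' (nat (j + int m'))" for j
    let ?J' = "{- int m'..int m'}"
    have "degree p' \<le> 2 * m'" using degree_mult_le[of "monom 1 (M + degree p)" p]
      by (simp add: p'_def m'_def degree_monom_eq)
    moreover have "t ^ m' * g (\<psi> t x) = poly p' t" if "t \<noteq> 0" for t
    proof -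
      have "t ^ m' * g (\<psi> t x) = t ^ (M + degree p) * (t ^ m * g (\<psi> t x))" by (simp add: m'_def power_add algebra_simps)
      then show ?thesis using p that by (simp add: p'_def poly_monom)
    qed
    ultimately have c: "g (\<psi> t x) = (\<Sum>j\<in>?J'. c j * t powi j)" if "t \<noteq> 0" for t
      unfolding c_def using laurent_of_poly[of p' m' t "\<lambda>t. g (\<psi> t x)"] that by simp
    have "c j = 0" if j: "j \<in> ?J'" "j \<notin> J" for j
    proof -
      have "c j * poly P (2 powi j) = 0"
      proof (rule laurent_zero[OF _ _ j(1), of "\<lambda>j. c j * poly P (2 powi j)"])
        show "(\<Sum>j\<in>?J'. c j * poly P (2 powi j) * t powi j) = 0" if "t \<noteq> 0" for t
          using dilation_sum_laurent[where J = ?J' and c = c and g = g and x = x and P = P, OF c that] op0[OF x that] by simp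
      qed simp
      then show ?thesis using j(2) Pzero by simp
    qed
    then have "(\<Sum>j\<in>?J'. c j * t powi j) = (\<Sum>j\<in>J. c j * t powi j)" for t
      by (intro sum.mono_neutral_right) (auto simp: J_def m'_def)
    then show ?thesis using c by (intro exI[of _ c]) simp
  qed
  \<comment> \<open>It annihilates all exponents in \<open>J\<close> except \<open>j\<close>.\<close>
  define Pj where "Pj j = (\<Prod>i\<in>J - {j}. [:- (2 powi i), 1:] :: 'k poly)" for j
  have Pj: "poly (Pj j) (2 powi i) = 0 \<longleftrightarrow> i \<in> J - {j}" for i j
  proof -
    have "poly (Pj j) (2 powi i) = (\<Prod>l\<in>J - {j}. 2 powi i - 2 powi l)" by (simp add: Pj_def poly_prod)
    also have "\<dots> = 0 \<longleftrightarrow> (\<exists>l\<in>J - {j}. (2::'k) powi i = 2 powi l)" by (simp add: J_def)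
    also have "\<dots> \<longleftrightarrow> i \<in> J - {j}" using two_powi_inject by blast
    finally show ?thesis .
  qed
  define c where "c j x = (if j \<in> J then dilation_sum (Pj j) g 1 x / poly (Pj j) (2 powi j) else 0)" for j x
  have coeff: "c j x = d j" if x: "x \<in> points X" and j: "j \<in> J"
    and d: "\<And>t. t \<noteq> 0 \<Longrightarrow> g (\<psi> t x) = (\<Sum>j\<in>J. d j * t powi j)" for x d j
  proof -
    have "dilation_sum (Pj j) g 1 x = (\<Sum>i\<in>J. (d i * poly (Pj j) (2 powi i)) * 1 powi i)"
      by (rule dilation_sum_laurent[OF d]) simp_all
    also have "\<dots> = (\<Sum>i\<in>J. if i = j then d j * poly (Pj j) (2 powi j) else 0)"
      by (intro sum.cong refl) (use Pj in auto)
    also have "\<dots> = d j * poly (Pj j) (2 powi j)" using j by (simp add: J_def)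
    finally show ?thesis using j Pj[of j j] by (simp add: c_def)
  qed
  have sum: "g (\<psi> t x) = (\<Sum>j\<in>J. c j x * t powi j)" if t: "t \<noteq> 0" and x: "x \<in> points X" for t x
  proof -
    from expand[OF x] obtain d where d: "\<forall>t. t \<noteq> 0 \<longrightarrow> g (\<psi> t x) = (\<Sum>j\<in>J. d j * t powi j)" by (elim exE)
    have "c j x = d j" if "j \<in> J" for j by (rule coeff[OF x that]) (use d in blast)
    then show ?thesis using d t by simp
  qed
  have "weight j (c j)" for j
  proof (cases "j \<in> J")
    case False
    have "c j = (\<lambda>_. 0)" by (rule ext) (simp add: c_def False)
    then show ?thesis by (simp add: weight_def regular_const)
  next
    case True
    have "global (c j)"
      unfolding c_def using True Pj[of j j]
      by (simp, intro regular_divide dilation_sum_regular g regular_const) simp_all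
    moreover have "c j (\<psi> s x) = s powi j * c j x" if "s \<noteq> 0" "x \<in> points X" for s x
    proof (rule coeff[OF act_points[OF that] True])
      fix t :: 'k assume t: "t \<noteq> 0"
      have "g (\<psi> t (\<psi> s x)) = g (\<psi> (t * s) x)" using act_mult[OF t that] by simp
      also have "\<dots> = (\<Sum>j\<in>J. c j x * (t * s) powi j)" using sum t that by simp
      finally show "g (\<psi> t (\<psi> s x)) = (\<Sum>j\<in>J. (s powi j * c j x) * t powi j)"
        by (simp add: power_int_mult_distrib mult_ac)
    qed
    ultimately show ?thesis by (simp add: weight_def)
  qed
  moreover have "c j = (\<lambda>_. 0)" if "j \<notin> {- int M..int M}" for j
  proof -
    have "j \<notin> J" using that by (simp only: J_def not_False_eq_True)
    then show ?thesis by (intro ext) (simp only: c_def if_False)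
  qed
  ultimately show ?thesis using sum unfolding J_def weight_parts_def by blast
qed

end

section \<open>Torus actions that fix a prime divisor pointwise\<close>

lemma laurent_shift:
  fixes c :: "int \<Rightarrow> 'k::field_char_0"
  assumes "\<And>k. k \<notin> {- int N..int N} \<Longrightarrow> c k = 0" "int N + \<bar>p\<bar> \<le> int L" "t \<noteq> 0"
  shows "t powi p * (\<Sum>k\<in>{- int N..int N}. c k * t powi k) = (\<Sum>l\<in>{- int L..int L}. c (l - p) * t powi l)"
proof -
  have "t powi p * (\<Sum>k\<in>{- int N..int N}. c k * t powi k) = (\<Sum>k\<in>{- int N..int N}. c k * t powi (k + p))"
    using assms(3) by (simp add: sum_distrib_left power_int_add mult_ac)
  also have "\<dots> = (\<Sum>l\<in>{- int N + p..int N + p}. c (l - p) * t powi l)"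
    by (rule sum.reindex_bij_witness[of _ "\<lambda>l. l - p" "\<lambda>k. k + p"]) auto
  also have "\<dots> = (\<Sum>l\<in>{- int L..int L}. c (l - p) * t powi l)"
  proof (rule sum.mono_neutral_left)
    show "\<forall>l\<in>{- int L..int L} - {- int N + p..int N + p}. c (l - p) * t powi l = 0"
    proof
      fix l assume "l \<in> {- int L..int L} - {- int N + p..int N + p}"
      then have "l - p \<notin> {- int N..int N}" by auto
      then show "c (l - p) * t powi l = 0" using assms(1) by simp
    qed
  qed (use assms(2) in auto)
  finally show ?thesis .
qed

lemma powi_root:
  fixes r :: "'k::{alg_closed_field, field_char_0}"
  assumes "i \<noteq> 0" "r \<noteq> 0"
  shows "\<exists>t. t \<noteq> 0 \<and> t powi i = r"
proof -
  have "nat \<bar>i\<bar> > 0" using assms(1) by simp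
  then obtain t where t: "t ^ nat \<bar>i\<bar> = r" using nth_root_exists by blast
  have t0: "t \<noteq> 0" using t assms by auto
  show ?thesis
  proof (cases "i > 0")
    case True
    then show ?thesis using t t0 by (intro exI[of _ t]) (simp add: power_int_nonneg_exp)
  next
    case False
    then have "inverse t powi i = t ^ nat \<bar>i\<bar>"
      by (simp add: power_int_def power_inverse)
    then show ?thesis using t t0 assms(1) by (intro exI[of _ "inverse t"]) simp
  qed
qed

locale fixed_divisor = torus_action X n \<chi> \<psi>
  for X :: "('a, 'k::{alg_closed_field, field_char_0}) fun_space" and n \<chi> \<psi> +
  fixes D :: "'a set"
  assumes normal: "normal_space X" and divisor: "prime_divisor X D"
    and fixed: "\<And>t x. t \<noteq> 0 \<Longrightarrow> x \<in> D \<Longrightarrow> \<psi> t x = x"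
    and nontrivial: "\<exists>t x. t \<noteq> 0 \<and> x \<in> points X \<and> \<psi> t x \<noteq> x"
begin

lemma D_closed: "closedin (zariski X) D" and D_irreducible: "irreducible_in (zariski X) D"
  using divisor unfolding prime_divisor_def by blast+

lemma D_points: "x \<in> D \<Longrightarrow> x \<in> points X"
  using closedin_subset[OF D_closed] by blast

definition off_D :: "('a \<Rightarrow> 'k) \<Rightarrow> bool" where
  "off_D g \<longleftrightarrow> (\<exists>x\<in>D. g x \<noteq> 0)"

lemma off_D_mult: "global f \<Longrightarrow> global g \<Longrightarrow> off_D f \<Longrightarrow> off_D g \<Longrightarrow> off_D (\<lambda>x. f x * g x)"
  using regular_prime[OF D_irreducible, of f g] unfolding off_D_def by blast

lemma off_D_one: "off_D (\<lambda>x. 1)"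
  using D_irreducible unfolding off_D_def irreducible_in_def by auto

lemma off_D_power: "global f \<Longrightarrow> off_D f \<Longrightarrow> off_D (\<lambda>x. f x ^ m)"
proof (induction m)
  case (Suc m)
  then show ?case using off_D_mult[OF Suc.prems(1) regular_power[OF Suc.prems(1), of m]] by simp
qed (simp add: off_D_one)

lemma weightD:
  assumes "weight j g"
  shows "global g" "t \<noteq> 0 \<Longrightarrow> x \<in> points X \<Longrightarrow> g (\<psi> t x) = t powi j * g x"
  using assms by (auto simp: weight_def)

lemma weight_zero_const: "weight 0 (\<lambda>_. c)"
  by (simp add: weight_def regular_const)

lemma weight_zero_mult: "weight 0 f \<Longrightarrow> weight 0 g \<Longrightarrow> weight 0 (\<lambda>x. f x * g x)"
  by (simp add: weight_def regular_mult)

text \<open>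
  Invariance under the element 2 of the torus suffices, as it is not a root of unity.
\<close>

lemma weight_on_D:
  assumes "weight j g" "j \<noteq> 0" "x \<in> D"
  shows "g x = 0"
proof (rule ccontr)
  assume nz: "g x \<noteq> 0"
  have "g x = 2 powi j * g x" using weightD(2)[OF assms(1), of 2 x] fixed[of 2 x] D_points assms(3) by simp
  then have "(2::'k) powi j = 2 powi 0" using nz by simp
  then show False using two_powi_inject assms(2) by blast
qed

lemma weight_sum:
  assumes "\<And>t x. t \<noteq> 0 \<Longrightarrow> x \<in> points X \<Longrightarrow> g (\<psi> t x) = (\<Sum>j\<in>J. c j x * t powi j)" "x \<in> points X"
  shows "g x = (\<Sum>j\<in>J. c j x)"
  using assms(1)[of 1 x] act_one assms(2) by simp

lemma weight_zero_component_on_D: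
  assumes w: "\<And>j. weight j (c j)" and g: "\<And>t x. t \<noteq> 0 \<Longrightarrow> x \<in> points X \<Longrightarrow> g (\<psi> t x) = (\<Sum>j\<in>{- int N..int N}. c j x * t powi j)"
    and x: "x \<in> D"
  shows "c 0 x = g x"
proof -
  have "g x = (\<Sum>j\<in>{- int N..int N}. c j x)" by (rule weight_sum[OF g D_points[OF x]])
  also have "\<dots> = (\<Sum>j\<in>{0}. c j x)"
    using weight_on_D[OF w _ x] by (intro sum.mono_neutral_right) auto
  finally show ?thesis by simp
qed

text \<open>
  A generator of the maximal ideal of the local ring at \<open>D\<close>; the units of this ring are the quotients of
  functions that do not vanish identically on \<open>D\<close>.
\<close>

definition uniformizer :: "('a \<Rightarrow> 'k) \<Rightarrow> bool" where
  "uniformizer u \<longleftrightarrow> global u \<and> (\<forall>x\<in>D. u x = 0) \<and>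
    (\<forall>g x0. global g \<and> x0 \<in> points X \<and> g x0 \<noteq> 0 \<longrightarrow>
      (\<exists>m a b. global a \<and> global b \<and> off_D a \<and> off_D b \<and> (\<forall>x\<in>points X. b x * g x = u x ^ m * a x)))"

lemma uniformizerD:
  assumes "uniformizer u"
  shows "global u" "x \<in> D \<Longrightarrow> u x = 0"
    "global g \<Longrightarrow> x0 \<in> points X \<Longrightarrow> g x0 \<noteq> 0 \<Longrightarrow>
      \<exists>m a b. global a \<and> global b \<and> off_D a \<and> off_D b \<and> (\<forall>x\<in>points X. b x * g x = u x ^ m * a x)"
  using assms unfolding uniformizer_def by blast+

lemma uniformizer_exists: "\<exists>u. uniformizer u"
  using divisor_uniformizer[OF normal divisor] unfolding uniformizer_def off_D_def .

text \<open>
  If \<open>u\<close> were zero, so would be every function that vanishes on \<open>D\<close>.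
\<close>

lemma uniformizer_nonzero:
  assumes u: "uniformizer u"
  shows "\<exists>x\<in>points X. u x \<noteq> 0"
proof (rule ccontr)
  assume z: "\<not> ?thesis"
  obtain x1 where "x1 \<in> points X" "x1 \<notin> D"
    using prime_divisor_proper[OF divisor] D_points by blast
  then obtain g where g: "g \<in> B" "g x1 \<noteq> 0" "\<forall>z\<in>D. g z = 0" using closed_separate[OF D_closed] by blast
  obtain m a b where h: "global a" "global b" "off_D a" "off_D b" "\<forall>x\<in>points X. b x * g x = u x ^ m * a x"
    using uniformizerD(3)[OF u B_global[OF g(1)] \<open>x1 \<in> points X\<close> g(2)] by (elim exE conjE)
  obtain d where d: "d \<in> D" "a d \<noteq> 0" using h(3) unfolding off_D_def by blast
  have m: "m \<noteq> 0"
  proof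
    assume "m = 0"
    then have "a d = 0" using h(5) g(3) d D_points by fastforce
    then show False using d(2) by simp
  qed
  have bg: "b x * g x = 0" if "x \<in> points X" for x
  proof -
    have "u x = 0" using z that by blast
    then show ?thesis using h(5) that m by simp
  qed
  obtain d' where "d' \<in> D" "b d' \<noteq> 0" using h(4) unfolding off_D_def by blast
  then have "g x1 = 0"
    using global_domain[OF h(2) B_global[OF g(1)] bg _ _ \<open>x1 \<in> points X\<close>] D_points by blast
  then show False using g(2) by simp
qed

lemma uniformizer_cancel:
  assumes u: "uniformizer u" and f: "global f" "global g"
    and eq: "\<And>x. x \<in> points X \<Longrightarrow> u x ^ m * f x = u x ^ m * g x" and x: "x \<in> points X"
  shows "f x = g x"
proof -
  obtain x1 where x1: "x1 \<in> points X" "u x1 \<noteq> 0" using uniformizer_nonzero[OF u] by blast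
  have "f x - g x = 0"
  proof (rule global_domain[OF regular_power[OF uniformizerD(1)[OF u], of m] regular_diff[OF f] _ x1(1) _ x])
    show "u y ^ m * (f y - g y) = 0" if "y \<in> points X" for y using eq[OF that] by (simp add: algebra_simps)
    show "u x1 ^ m \<noteq> 0" using x1(2) by simp
  qed
  then show ?thesis by simp
qed

text \<open>
  All weight components of a uniformizer vanish on \<open>D\<close>. If each were divisible by the square of the
  uniformizer, so would be their sum, which is the uniformizer itself. A component that is not divisible
  by the square is again a uniformizer.
\<close>

lemma homogeneous_uniformizer_exists: "\<exists>i u. weight i u \<and> uniformizer u"
proof -
  obtain u where u: "uniformizer u" using uniformizer_exists by blast
  obtain N c where "weight_parts u N c" using weight_decomposition[OF uniformizerD(1)[OF u]] by blast
  note c = weight_partsD[OF this]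
  have gc: "global (c j)" for j by (rule weightD(1)[OF c(1)[rule_format]])
  have cD: "c j x = 0" if "x \<in> D" for j x
  proof (cases "j = 0")
    case True
    have "c 0 x = u x"
      by (rule weight_zero_component_on_D[OF c(1)[rule_format] c(3)[rule_format] that])
    then show ?thesis using True uniformizerD(2)[OF u that] by simp
  next
    case False
    then show ?thesis using weight_on_D[OF c(1)[rule_format] _ that] by blast
  qed
  have "\<exists>j a b. global a \<and> global b \<and> off_D a \<and> off_D b \<and> (\<forall>x\<in>points X. b x * c j x = u x * a x)"
  proof (rule ccontr)
    assume neg: "\<not> ?thesis"
    have part: "\<exists>b d. global b \<and> global d \<and> off_D b \<and> (\<forall>x\<in>points X. b x * c j x = u x ^ 2 * d x)" for j
    proof (cases "\<exists>x0\<in>points X. c j x0 \<noteq> 0")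
      case False
      then have "\<forall>x\<in>points X. 1 * c j x = u x ^ 2 * 0" by simp
      then show ?thesis
        by (intro exI[of _ "\<lambda>_. 1"] exI[of _ "\<lambda>_. 0"] conjI off_D_one) (simp_all add: regular_const)
    next
      case True
      then obtain x0 where x0: "x0 \<in> points X" "c j x0 \<noteq> 0" by blast
      obtain m a b where h: "global a" "global b" "off_D a" "off_D b" "\<forall>x\<in>points X. b x * c j x = u x ^ m * a x"
        using uniformizerD(3)[OF u gc x0] by (elim exE conjE)
      have "m \<noteq> 0"
      proof
        assume m: "m = 0"
        obtain d where d: "d \<in> D" "a d \<noteq> 0" using h(3) unfolding off_D_def by blast
        have "b d * c j d = u d ^ m * a d" using h(5) D_points[OF d(1)] by blast
        then show False using d cD[OF d(1)] m by simp
      qed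
      moreover have "m \<noteq> 1"
      proof
        assume "m = 1"
        then have "\<forall>x\<in>points X. b x * c j x = u x * a x" using h(5) by simp
        then show False using neg h(1-4) by blast
      qed
      ultimately have m: "m = 2 + (m - 2)" by linarith
      have "\<forall>x\<in>points X. b x * c j x = u x ^ 2 * (u x ^ (m - 2) * a x)"
        using h(5) by (subst (asm) m) (simp add: power_add power2_eq_square mult.assoc)
      moreover have "global (\<lambda>x. u x ^ (m - 2) * a x)" by (intro regular_mult regular_power uniformizerD(1)[OF u] h(1))
      ultimately show ?thesis using h(2,4) by (intro exI conjI)
    qed
    have sums: "\<exists>b d. global b \<and> global d \<and> off_D b \<and> (\<forall>x\<in>points X. b x * (\<Sum>j\<in>S. c j x) = u x ^ 2 * d x)"
      if "finite S" for S
      using that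
    proof (induction S)
      case empty
      show ?case
        by (intro exI[of _ "\<lambda>_. 1"] exI[of _ "\<lambda>_. 0"] conjI off_D_one) (simp_all add: regular_const)
    next
      case (insert j S)
      obtain b d where bd: "global b" "global d" "off_D b" "\<forall>x\<in>points X. b x * (\<Sum>j\<in>S. c j x) = u x ^ 2 * d x"
        using insert.IH by (elim exE conjE)
      obtain b' d' where bd': "global b'" "global d'" "off_D b'" "\<forall>x\<in>points X. b' x * c j x = u x ^ 2 * d' x"
        using part[of j] by (elim exE conjE)
      have "(b x * b' x) * (\<Sum>j\<in>insert j S. c j x) = u x ^ 2 * (b' x * d x + b x * d' x)" if x: "x \<in> points X" for x
      proof -
        have "(b x * b' x) * (\<Sum>j\<in>insert j S. c j x) = b x * (b' x * c j x) + b' x * (b x * (\<Sum>j\<in>S. c j x))"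
          using insert.hyps by (simp add: algebra_simps)
        also have "\<dots> = u x ^ 2 * (b' x * d x + b x * d' x)" using bd(4) bd'(4) x by (simp add: algebra_simps)
        finally show ?thesis .
      qed
      moreover have "global (\<lambda>x. b x * b' x)" "global (\<lambda>x. b' x * d x + b x * d' x)"
        by (intro regular_add regular_mult bd bd')+
      moreover have "off_D (\<lambda>x. b x * b' x)" by (rule off_D_mult[OF bd(1) bd'(1) bd(3) bd'(3)])
      ultimately show ?case by (intro exI[of _ "\<lambda>x. b x * b' x"] exI[of _ "\<lambda>x. b' x * d x + b x * d' x"] conjI) simp_all
    qed
    from sums[OF finite_atLeastAtMost_int[of "- int N" "int N"]] obtain b d where bd: "global b" "global d" "off_D b"
      "\<forall>x\<in>points X. b x * (\<Sum>j\<in>{- int N..int N}. c j x) = u x ^ 2 * d x" by (elim exE conjE)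
    have "b x = u x * d x" if "x \<in> points X" for x
    proof (rule uniformizer_cancel[OF u bd(1) regular_mult[OF uniformizerD(1)[OF u] bd(2)], of 1])
      fix y assume y: "y \<in> points X"
      have "u y = (\<Sum>j\<in>{- int N..int N}. c j y)" by (rule weight_sum[OF c(3)[rule_format] y])
      then show "u y ^ 1 * b y = u y ^ 1 * (u y * d y)" using bd(4) y by (simp add: power2_eq_square mult.commute mult.left_commute)
    qed (rule that)
    then have "b x = 0" if "x \<in> D" for x using uniformizerD(2)[OF u that] D_points[OF that] by simp
    then show False using bd(3) unfolding off_D_def by blast
  qed
  then obtain j a b where ab: "global a" "global b" "off_D a" "off_D b" "\<forall>x\<in>points X. b x * c j x = u x * a x"
    by (elim exE conjE)
  have "uniformizer (c j)"
    unfolding uniformizer_def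
  proof (intro conjI ballI allI impI gc cD)
    fix g x0 assume g: "global g \<and> x0 \<in> points X \<and> g x0 \<noteq> 0"
    then obtain m a' b' where h: "global a'" "global b'" "off_D a'" "off_D b'" "\<forall>x\<in>points X. b' x * g x = u x ^ m * a' x"
      using uniformizerD(3)[OF u, of g x0] by (elim exE conjE) blast
    have "(b' x * a x ^ m) * g x = c j x ^ m * (b x ^ m * a' x)" if x: "x \<in> points X" for x
    proof -
      have "(b' x * a x ^ m) * g x = a x ^ m * (u x ^ m * a' x)" using h(5) x by (simp add: mult.commute mult.left_commute)
      also have "\<dots> = (u x * a x) ^ m * a' x" by (simp add: power_mult_distrib)
      also have "\<dots> = (b x * c j x) ^ m * a' x" using ab(5) x by simp
      finally show ?thesis by (simp add: power_mult_distrib)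
    qed
    moreover have "global (\<lambda>x. b' x * a x ^ m)" "global (\<lambda>x. b x ^ m * a' x)"
      by (intro regular_mult regular_power h ab)+
    moreover have "off_D (\<lambda>x. b' x * a x ^ m)" "off_D (\<lambda>x. b x ^ m * a' x)"
      by (intro off_D_mult off_D_power regular_power h ab)+
    ultimately show "\<exists>m a b. global a \<and> global b \<and> off_D a \<and> off_D b \<and> (\<forall>x\<in>points X. b x * g x = c j x ^ m * a x)"
      by (intro exI[of _ m] exI[of _ "\<lambda>x. b x ^ m * a' x"] exI[of _ "\<lambda>x. b' x * a x ^ m"] conjI ballI)
  qed
  then show ?thesis using c(1) by blast
qed

text \<open>
  Comparing the components of weight \<open>j\<close> in \<open>b * g = u ^ m * a\<close> replaces \<open>b\<close> by its invariant component
  and \<open>a\<close> by its component of weight \<open>j - m * i\<close>. Eliminating \<open>g\<close> from the old and the new equation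
  shows that the new numerator does not vanish on \<open>D\<close> either, so its weight is zero.
\<close>

lemma weight_value:
  assumes iu: "weight i u" and u: "uniformizer u" and g: "weight j g" and x0: "x0 \<in> points X" "g x0 \<noteq> 0"
  shows "\<exists>m a b. weight 0 a \<and> weight 0 b \<and> off_D a \<and> off_D b \<and> (\<forall>x\<in>points X. b x * g x = u x ^ m * a x) \<and> j = int m * i"
proof -
  obtain m a b where h: "global a" "global b" "off_D a" "off_D b" "\<forall>x\<in>points X. b x * g x = u x ^ m * a x"
    using uniformizerD(3)[OF u weightD(1)[OF g] x0] by (elim exE conjE)
  obtain Na ca where "weight_parts a Na ca" using weight_decomposition[OF h(1)] by blast
  note ca = weight_partsD[OF this]
  obtain Nb cb where "weight_parts b Nb cb" using weight_decomposition[OF h(2)] by blast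
  note cb = weight_partsD[OF this]
  define p where "p = int m * i"
  define L where "L = Na + Nb + nat \<bar>j\<bar> + nat \<bar>p\<bar>"
  have eq: "cb 0 x * g x = u x ^ m * ca (j - p) x" if x: "x \<in> points X" for x
  proof -
    have "cb (j - j) x * g x - u x ^ m * ca (j - p) x = 0"
    proof (rule laurent_zero[where J = "{- int L..int L}" and c = "\<lambda>l. cb (l - j) x * g x - u x ^ m * ca (l - p) x"])
      fix t :: 'k assume t: "t \<noteq> 0"
      have tx: "\<psi> t x \<in> points X" by (rule act_points[OF t x])
      have 1: "t powi j * b (\<psi> t x) = (\<Sum>l\<in>{- int L..int L}. cb (l - j) x * t powi l)"
        unfolding cb(3)[rule_format, OF t x]
        by (rule laurent_shift) (use cb(2) t in \<open>simp_all add: L_def\<close>)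
      have 2: "t powi p * a (\<psi> t x) = (\<Sum>l\<in>{- int L..int L}. ca (l - p) x * t powi l)"
        unfolding ca(3)[rule_format, OF t x]
        by (rule laurent_shift) (use ca(2) t in \<open>simp_all add: L_def\<close>)
      have "g x * (t powi j * b (\<psi> t x)) = b (\<psi> t x) * g (\<psi> t x)" using weightD(2)[OF g t x] by simp
      also have "\<dots> = (t powi i * u x) ^ m * a (\<psi> t x)" using h(5) tx weightD(2)[OF iu t x] by simp
      also have "\<dots> = u x ^ m * (t powi p * a (\<psi> t x))"
        by (simp add: power_mult_distrib p_def power_int_power' mult.commute mult.left_commute)
      finally have "g x * (t powi j * b (\<psi> t x)) - u x ^ m * (t powi p * a (\<psi> t x)) = 0" by simp
      moreover have "(\<Sum>l\<in>{- int L..int L}. (cb (l - j) x * g x - u x ^ m * ca (l - p) x) * t powi l)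
          = g x * (\<Sum>l\<in>{- int L..int L}. cb (l - j) x * t powi l) - u x ^ m * (\<Sum>l\<in>{- int L..int L}. ca (l - p) x * t powi l)"
        unfolding sum_distrib_left sum_subtractf[symmetric] by (intro sum.cong refl) (simp add: algebra_simps)
      ultimately show "(\<Sum>l\<in>{- int L..int L}. (cb (l - j) x * g x - u x ^ m * ca (l - p) x) * t powi l) = 0"
        unfolding 1 2 by simp
    next
      have "\<bar>j\<bar> \<le> int L" by (simp add: L_def)
      then show "j \<in> {- int L..int L}" by auto
    qed simp
    then show ?thesis by simp
  qed
  have gl: "global (cb 0)" "global (ca (j - p))" using weightD(1) cb(1) ca(1) by blast+
  have b0: "off_D (cb 0)"
    using h(4) weight_zero_component_on_D[OF cb(1)[rule_format] cb(3)[rule_format]] unfolding off_D_def by metis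
  \<comment> \<open>Eliminating \<open>g\<close> from the two equations for it.\<close>
  have cross: "cb 0 x * a x = b x * ca (j - p) x" if "x \<in> points X" for x
  proof (rule uniformizer_cancel[OF u _ _ _ that, of _ _ m])
    fix y assume y: "y \<in> points X"
    have "u y ^ m * (cb 0 y * a y) = cb 0 y * (b y * g y)" using h(5) y by simp
    also have "\<dots> = b y * (u y ^ m * ca (j - p) y)" using eq[OF y] by (simp add: mult.left_commute)
    finally show "u y ^ m * (cb 0 y * a y) = u y ^ m * (b y * ca (j - p) y)" by (simp add: mult.left_commute)
  qed (intro regular_mult gl h)+
  obtain d where d: "d \<in> D" "cb 0 d * a d \<noteq> 0" using off_D_mult[OF gl(1) h(1) b0 h(3)] unfolding off_D_def by blast
  then have nz: "ca (j - p) d \<noteq> 0" using cross[OF D_points[OF d(1)]] by auto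
  then have jp: "j = p" using weight_on_D[OF ca(1)[rule_format, of "j - p"] _ d(1)] by fastforce
  have "off_D (ca 0)" using nz d(1) jp unfolding off_D_def by auto
  moreover have "\<forall>x\<in>points X. cb 0 x * g x = u x ^ m * ca 0 x" using eq jp by simp
  ultimately show ?thesis using ca(1) cb(1) b0 jp unfolding p_def by blast
qed

lemma coordinate_global: "k < n \<Longrightarrow> global (\<lambda>x. \<chi> x k)"
  using B_global[OF coordinate_ring_iff[OF polynomial_functions.coord]] by (simp add: comp_def)

lemma chart_eqI: "x \<in> points X \<Longrightarrow> y \<in> points X \<Longrightarrow> (\<And>k. k < n \<Longrightarrow> \<chi> x k = \<chi> y k) \<Longrightarrow> x = y"
  using PiE_ext[OF chart_range chart_range, of x y] inj_onD[OF chart_inj] by blast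

text \<open>
  If \<open>u\<close> were invariant, then by \<open>weight_value\<close> all functions would be invariant, and the action trivial.
\<close>

lemma uniformizer_weight_nonzero:
  assumes iu: "weight i u" and u: "uniformizer u"
  shows "i \<noteq> 0"
proof
  assume i: "i = 0"
  obtain t x where tx: "t \<noteq> 0" "x \<in> points X" "\<psi> t x \<noteq> x" using nontrivial by blast
  then obtain k where k: "k < n" "\<chi> (\<psi> t x) k \<noteq> \<chi> x k" using chart_eqI[OF act_points[OF tx(1,2)] tx(2)] by blast
  obtain N c where "weight_parts (\<lambda>x. \<chi> x k) N c" using weight_decomposition[OF coordinate_global[OF k(1)]] by blast
  note c = weight_partsD[OF this]
  have z: "c j x = 0" if "j \<noteq> 0" for j
  proof (rule ccontr)
    assume "c j x \<noteq> 0"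
    then have "\<exists>m. j = int m * i" using weight_value[OF iu u c(1)[rule_format] tx(2)] by blast
    then show False using i that by simp
  qed
  have "(\<Sum>j\<in>{- int N..int N}. c j x * s powi j) = (\<Sum>j\<in>{0}. c j x * s powi j)" for s
    using z by (intro sum.mono_neutral_right) auto
  then have "\<chi> (\<psi> s x) k = c 0 x" if "s \<noteq> 0" for s using c(3) that tx(2) by simp
  from this[of t] this[of 1] show False using k(2) tx(1,2) act_one by simp
qed

end

locale homogeneous_uniformizer = fixed_divisor X n \<chi> \<psi> D
  for X :: "('a, 'k::{alg_closed_field, field_char_0}) fun_space" and n \<chi> \<psi> D +
  fixes i :: int and u :: "'a \<Rightarrow> 'k"
  assumes u_weight: "weight i u" and u_uniformizer: "uniformizer u"
begin

lemmas u_global = uniformizerD(1)[OF u_uniformizer]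

lemma i_nonzero: "i \<noteq> 0"
  by (rule uniformizer_weight_nonzero[OF u_weight u_uniformizer])

text \<open>
  Invariant functions have valuation zero, so that restriction to \<open>D\<close> is injective on them.
\<close>

lemma invariant_on_D:
  assumes "weight 0 g" "\<And>x. x \<in> D \<Longrightarrow> g x = 0" "x \<in> points X"
  shows "g x = 0"
proof (rule ccontr)
  assume nz: "g x \<noteq> 0"
  obtain m a b where h: "weight 0 a" "weight 0 b" "off_D a" "off_D b"
    "\<forall>x\<in>points X. b x * g x = u x ^ m * a x" "0 = int m * i"
    using weight_value[OF u_weight u_uniformizer assms(1,3) nz] by (elim exE conjE)
  then have "m = 0" using i_nonzero by simp
  obtain d where d: "d \<in> D" "a d \<noteq> 0" using h(3) unfolding off_D_def by blast
  have "b d * g d = u d ^ m * a d" using h(5) D_points[OF d(1)] by blast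
  then show False using assms(2)[OF d(1)] d(2) \<open>m = 0\<close> by simp
qed

lemma component_fraction:
  assumes g: "weight (int m * i) g"
  shows "\<exists>b e. weight 0 b \<and> weight 0 e \<and> off_D b \<and> (\<forall>x\<in>points X. b x * g x = u x ^ m * e x)"
proof (cases "\<exists>x0\<in>points X. g x0 \<noteq> 0")
  case True
  then obtain x0 where x0: "x0 \<in> points X" "g x0 \<noteq> 0" by blast
  obtain m' a b where h: "weight 0 a" "weight 0 b" "off_D a" "off_D b"
    "\<forall>x\<in>points X. b x * g x = u x ^ m' * a x" "int m * i = int m' * i"
    using weight_value[OF u_weight u_uniformizer g x0] by (elim exE conjE)
  then have "m' = m" using i_nonzero by simp
  then show ?thesis using h by blast
next
  case False
  then have "\<forall>x\<in>points X. 1 * g x = u x ^ m * 0" by simp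
  then show ?thesis
    by (intro exI[of _ "\<lambda>_. 1"] exI[of _ "\<lambda>_. 0"] conjI weight_zero_const off_D_one)
qed

text \<open>
  Only the weights \<open>m * i\<close> with \<open>m \<ge> 0\<close> occur, so orbit maps are polynomial in \<open>t powi i\<close> and extend to
  the value 0 of this parameter.
\<close>

lemma expansion:
  assumes g: "global g"
  shows "\<exists>M c. (\<forall>m. weight (int m * i) (c m)) \<and>
    (\<forall>t x. t \<noteq> 0 \<longrightarrow> x \<in> points X \<longrightarrow> g (\<psi> t x) = (\<Sum>m\<le>(M::nat). (t powi i) ^ m * c m x))"
proof -
  obtain N c where "weight_parts g N c" using weight_decomposition[OF g] by blast
  note c = weight_partsD[OF this]
  let ?I = "(\<lambda>m. int m * i) ` {..N}"
  have "g (\<psi> t x) = (\<Sum>m\<le>N. (t powi i) ^ m * c (int m * i) x)" if t: "t \<noteq> 0" and x: "x \<in> points X" for t x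
  proof -
    have out: "c j x = 0" if j: "j \<in> {- int N..int N}" "j \<notin> ?I" for j
    proof (rule ccontr)
      assume "c j x \<noteq> 0"
      then obtain m where m: "j = int m * i" using weight_value[OF u_weight u_uniformizer c(1)[rule_format] x] by blast
      have "int m \<le> int m * \<bar>i\<bar>" using mult_left_mono[of 1 "\<bar>i\<bar>" "int m"] i_nonzero by simp
      also have "\<dots> = \<bar>j\<bar>" by (simp add: m abs_mult)
      also have "\<dots> \<le> int N" using j(1) by auto
      finally show False using j(2) m by auto
    qed
    have "g (\<psi> t x) = (\<Sum>j\<in>{- int N..int N}. c j x * t powi j)" using c(3) t x by blast
    also have "\<dots> = (\<Sum>j\<in>{- int N..int N} \<union> ?I. c j x * t powi j)"
      using c(2) by (intro sum.mono_neutral_left) auto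
    also have "\<dots> = (\<Sum>j\<in>?I. c j x * t powi j)"
      using out by (intro sum.mono_neutral_right) auto
    also have "\<dots> = (\<Sum>m\<le>N. c (int m * i) x * t powi (int m * i))"
      by (subst sum.reindex) (use i_nonzero in \<open>auto simp: inj_on_def\<close>)
    also have "\<dots> = (\<Sum>m\<le>N. (t powi i) ^ m * c (int m * i) x)"
      by (simp add: power_int_power' mult.commute)
    finally show ?thesis .
  qed
  then show ?thesis using c(1) by (intro exI[of _ N] exI[of _ "\<lambda>m. c (int m * i)"] conjI allI impI) simp_all
qed

lemma common_denominator:
  assumes "finite S" "\<And>s. s \<in> S \<Longrightarrow> weight (int (\<mu> s) * i) (h s)"
  shows "\<exists>f. weight 0 f \<and> off_D f \<and> (\<forall>s\<in>S. \<exists>e. weight 0 e \<and> (\<forall>x\<in>points X. f x * h s x = u x ^ \<mu> s * e x))"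
  using assms
proof (induction S)
  case empty
  then show ?case using weight_zero_const off_D_one by blast
next
  case (insert s S)
  obtain f where f: "weight 0 f" "off_D f" "\<forall>s\<in>S. \<exists>e. weight 0 e \<and> (\<forall>x\<in>points X. f x * h s x = u x ^ \<mu> s * e x)"
    using insert.IH insert.prems by blast
  obtain b e where b: "weight 0 b" "weight 0 e" "off_D b" "\<forall>x\<in>points X. b x * h s x = u x ^ \<mu> s * e x"
    using component_fraction[of "\<mu> s" "h s"] insert.prems by blast
  have "\<exists>e. weight 0 e \<and> (\<forall>x\<in>points X. (f x * b x) * h s' x = u x ^ \<mu> s' * e x)" if s': "s' \<in> insert s S" for s'
  proof (cases "s' = s")
    case True
    have "\<forall>x\<in>points X. (f x * b x) * h s' x = u x ^ \<mu> s' * (f x * e x)"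
      using b(4) True by (simp add: mult.assoc mult.left_commute)
    then show ?thesis using weight_zero_mult[OF f(1) b(2)] by blast
  next
    case False
    then obtain e' where e': "weight 0 e'" "\<forall>x\<in>points X. f x * h s' x = u x ^ \<mu> s' * e' x" using f(3) s' by blast
    have "\<forall>x\<in>points X. (f x * b x) * h s' x = u x ^ \<mu> s' * (b x * e' x)"
    proof
      fix x assume x: "x \<in> points X"
      have "(f x * b x) * h s' x = b x * (f x * h s' x)" by simp
      then show "(f x * b x) * h s' x = u x ^ \<mu> s' * (b x * e' x)" using e'(2) x by simp
    qed
    then show ?thesis using weight_zero_mult[OF b(1) e'(1)] by blast
  qed
  moreover have "off_D (\<lambda>x. f x * b x)" by (rule off_D_mult[OF weightD(1)[OF f(1)] weightD(1)[OF b(1)] f(2) b(3)])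
  ultimately show ?case using weight_zero_mult[OF f(1) b(1)] by blast
qed

end

section \<open>Translations along the closures of torus orbits\<close>

text \<open>
  The coordinate functions as polynomials in \<open>u\<close>: the component \<open>c k m\<close> of the \<open>k\<close>-th coordinate is
  \<open>u ^ m * e k m / f\<close> with invariant \<open>e k m\<close> and a common invariant denominator \<open>f\<close>.
\<close>

locale root_coordinates = homogeneous_uniformizer X n \<chi> \<psi> D i u
  for X :: "('a, 'k::{alg_closed_field, field_char_0}) fun_space" and n \<chi> \<psi> D i u +
  fixes M :: "nat \<Rightarrow> nat" and c e :: "nat \<Rightarrow> nat \<Rightarrow> 'a \<Rightarrow> 'k" and f :: "'a \<Rightarrow> 'k"
  assumes expand: "\<And>k t x. k < n \<Longrightarrow> t \<noteq> 0 \<Longrightarrow> x \<in> points X \<Longrightarrow>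
      \<chi> (\<psi> t x) k = (\<Sum>m\<le>M k. (t powi i) ^ m * c k m x)"
    and f_weight: "weight 0 f" and f_off: "off_D f"
    and e_weight: "\<And>k m. k < n \<Longrightarrow> m \<le> M k \<Longrightarrow> weight 0 (e k m)"
    and fraction: "\<And>k m x. k < n \<Longrightarrow> m \<le> M k \<Longrightarrow> x \<in> points X \<Longrightarrow> f x * c k m x = u x ^ m * e k m x"

lemma (in homogeneous_uniformizer) root_coordinates_exist:
  "\<exists>M c e f. root_coordinates X n \<chi> \<psi> D i u M c e f"
proof -
  have "\<exists>M c. (\<forall>m. weight (int m * i) (c m)) \<and>
    (\<forall>t x. t \<noteq> 0 \<longrightarrow> x \<in> points X \<longrightarrow> \<chi> (\<psi> t x) k = (\<Sum>m\<le>(M::nat). (t powi i) ^ m * c m x))" if "k < n" for k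
    by (rule expansion[OF coordinate_global[OF that]])
  then obtain M c where c: "\<And>k m. k < n \<Longrightarrow> weight (int m * i) (c k m)"
    "\<And>k t x. k < n \<Longrightarrow> t \<noteq> 0 \<Longrightarrow> x \<in> points X \<Longrightarrow> \<chi> (\<psi> t x) k = (\<Sum>m\<le>(M k::nat). (t powi i) ^ m * c k m x)"
    by metis
  let ?S = "SIGMA k:{..<n}. {..M k}"
  obtain f where f: "weight 0 f" "off_D f"
    "\<forall>s\<in>?S. \<exists>e. weight 0 e \<and> (\<forall>x\<in>points X. f x * c (fst s) (snd s) x = u x ^ snd s * e x)"
    using common_denominator[of ?S snd "\<lambda>s. c (fst s) (snd s)"] c(1) by auto
  obtain e where e: "\<forall>s\<in>?S. weight 0 (e s) \<and> (\<forall>x\<in>points X. f x * c (fst s) (snd s) x = u x ^ snd s * e s x)"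
    using bchoice[OF f(3)] by (elim exE)
  have "root_coordinates_axioms X n \<chi> \<psi> D i u M c (\<lambda>k m. e (k, m)) f"
    by unfold_locales (use c f(1,2) e in auto)
  then show ?thesis using homogeneous_uniformizer_axioms unfolding root_coordinates_def by blast
qed

context root_coordinates
begin

lemma f_global: "global f" and e_global: "k < n \<Longrightarrow> m \<le> M k \<Longrightarrow> global (e k m)"
  using weightD(1) f_weight e_weight by blast+

text \<open>
  The coordinates of the translated point. By \<open>translate_fraction\<close> this is the result of replacing
  \<open>u\<close> by \<open>u + s * f\<close> in the expansion of the coordinates; written with the difference quotient of the
  \<open>m\<close>-th power, the denominator \<open>f\<close> cancels and the coordinates are regular.
\<close>

definition translate :: "'k \<Rightarrow> 'a \<Rightarrow> nat \<Rightarrow> 'k" where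
  "translate s x = (\<lambda>k\<in>{..<n}. \<chi> x k +
     s * (\<Sum>m\<le>M k. e k m x * (\<Sum>j<m. u x ^ (m - Suc j) * (u x + s * f x) ^ j)))"

lemma coordinate_fraction:
  assumes "k < n" "x \<in> points X"
  shows "f x * \<chi> x k = (\<Sum>m\<le>M k. e k m x * u x ^ m)"
proof -
  have "\<chi> x k = (\<Sum>m\<le>M k. c k m x)" using expand[OF assms(1) _ assms(2), of 1] act_one[OF assms(2)] by simp
  then have "f x * \<chi> x k = (\<Sum>m\<le>M k. f x * c k m x)" by (simp add: sum_distrib_left)
  then show ?thesis using fraction[OF assms(1) _ assms(2)] by (simp add: mult.commute)
qed

lemma translate_fraction:
  assumes k: "k < n" and x: "x \<in> points X"
  shows "f x * translate s x k = (\<Sum>m\<le>M k. e k m x * (u x + s * f x) ^ m)"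
proof -
  have step: "(u x + s * f x) ^ m = u x ^ m + s * f x * (\<Sum>j<m. u x ^ (m - Suc j) * (u x + s * f x) ^ j)" for m
    using power_diff_sumr2[of "u x + s * f x" m "u x"] by (simp add: algebra_simps)
  have "f x * translate s x k = f x * \<chi> x k +
      s * f x * (\<Sum>m\<le>M k. e k m x * (\<Sum>j<m. u x ^ (m - Suc j) * (u x + s * f x) ^ j))"
    using k by (simp add: translate_def algebra_simps)
  also have "\<dots> = (\<Sum>m\<le>M k. e k m x * u x ^ m + e k m x * (s * f x * (\<Sum>j<m. u x ^ (m - Suc j) * (u x + s * f x) ^ j)))"
    by (simp add: coordinate_fraction[OF k x] sum.distrib sum_distrib_left mult_ac)
  also have "\<dots> = (\<Sum>m\<le>M k. e k m x * (u x + s * f x) ^ m)"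
    by (intro sum.cong refl) (subst step, simp add: distrib_left)
  finally show ?thesis .
qed

lemma translate_global: "k < n \<Longrightarrow> global (\<lambda>x. translate s x k)"
  unfolding translate_def
  by (simp, intro regular_add regular_mult regular_sum regular_power regular_const coordinate_global e_global f_global u_global)
    simp_all

lemma polynomial_global:
  assumes "p \<in> polynomial_functions n" "\<And>k. k < n \<Longrightarrow> global (\<lambda>x. w x k)"
  shows "global (\<lambda>x. p (w x))"
  using assms(1)
  by induction (use assms(2) in \<open>auto intro: regular_add regular_mult regular_const points_open\<close>)

definition generic :: "'k \<Rightarrow> 'a set" where
  "generic s = {x\<in>points X. f x * (u x * (u x + s * f x)) \<noteq> 0}"

lemma generic_open: "openin (zariski X) (generic s)"
  unfolding generic_def by (intro nonvanishing_open regular_mult regular_add regular_const f_global u_global) simp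

text \<open>
  On \<open>D\<close> the function \<open>u + s * f\<close> reduces to \<open>s * f\<close>, which is not zero if \<open>s\<close> is not.
\<close>

lemma generic_nonempty: "generic s \<noteq> {}"
proof -
  obtain d where d: "d \<in> D" "f d \<noteq> 0" using f_off unfolding off_D_def by blast
  obtain x1 where x1: "x1 \<in> points X" "u x1 \<noteq> 0" using uniformizer_nonzero[OF u_uniformizer] by blast
  have sum_nz: "\<exists>y\<in>points X. u y + s * f y \<noteq> 0"
  proof (cases "s = 0")
    case True
    then show ?thesis using x1 by auto
  next
    case False
    then have "u d + s * f d \<noteq> 0" using uniformizerD(2)[OF u_uniformizer d(1)] d(2) by simp
    then show ?thesis using D_points[OF d(1)] by blast
  qed
  have gl: "global (\<lambda>x. u x + s * f x)" by (intro regular_add regular_mult regular_const u_global f_global) simp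
  have "\<exists>y\<in>points X. u y * (u y + s * f y) \<noteq> 0"
    using global_domain[OF u_global gl _ x1] sum_nz by blast
  then have "\<exists>y\<in>points X. f y * (u y * (u y + s * f y)) \<noteq> 0"
    using global_domain[OF f_global regular_mult[OF u_global gl] _ D_points[OF d(1)] d(2)] by blast
  then show ?thesis unfolding generic_def by blast
qed

text \<open>
  A generic point is translated within its torus orbit, since scaling \<open>u\<close> by \<open>r\<close> is the effect of any
  \<open>t\<close> with \<open>t powi i = r\<close>.
\<close>

lemma translate_generic:
  assumes x: "x \<in> generic s"
  shows "\<exists>t. t \<noteq> 0 \<and> u (\<psi> t x) = u x + s * f x \<and> translate s x = \<chi> (\<psi> t x)"
proof -
  have nz: "x \<in> points X" "f x \<noteq> 0" "u x \<noteq> 0" "u x + s * f x \<noteq> 0" using x by (auto simp: generic_def)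
  obtain t where t: "t \<noteq> 0" "t powi i = (u x + s * f x) / u x"
    using powi_root[OF i_nonzero, of "(u x + s * f x) / u x"] nz by auto
  have "translate s x k = \<chi> (\<psi> t x) k" if k: "k < n" for k
  proof -
    have "f x * \<chi> (\<psi> t x) k = (\<Sum>m\<le>M k. (t powi i) ^ m * (f x * c k m x))"
      by (simp add: expand[OF k t(1) nz(1)] sum_distrib_left mult.left_commute)
    also have "\<dots> = (\<Sum>m\<le>M k. e k m x * (t powi i * u x) ^ m)"
      using fraction[OF k _ nz(1)] by (intro sum.cong refl) (simp add: power_mult_distrib mult_ac)
    also have "\<dots> = (\<Sum>m\<le>M k. e k m x * (u x + s * f x) ^ m)" using t(2) nz(3) by simp
    also have "\<dots> = f x * translate s x k" by (rule translate_fraction[OF k nz(1), symmetric])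
    finally show ?thesis using nz(2) by simp
  qed
  then have "translate s x = \<chi> (\<psi> t x)"
    by (intro PiE_ext[OF _ chart_range]) (auto simp: translate_def)
  moreover have "u (\<psi> t x) = u x + s * f x" using weightD(2)[OF u_weight t(1) nz(1)] t(2) nz(3) by simp
  ultimately show ?thesis using t(1) by blast
qed

lemma agree_generic:
  assumes "global g" "global h" "\<And>x. x \<in> generic s \<Longrightarrow> g x = h x" "x \<in> points X"
  shows "g x = h x"
  by (rule regular_agree[OF irreducible assms(1,2) generic_open generic_nonempty assms(3,4)])

text \<open>
  Generically the translated coordinates are those of a point of \<open>X\<close>, so they satisfy every equation of
  \<open>X\<close> on a dense set, hence everywhere.
\<close>

lemma translate_point:
  assumes "x \<in> points X"
  shows "\<exists>y\<in>points X. \<chi> y = translate s x"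
proof (rule chart_surj)
  show "translate s x \<in> {..<n} \<rightarrow>\<^sub>E UNIV" by (auto simp: translate_def)
  fix p :: "(nat \<Rightarrow> 'k) \<Rightarrow> 'k" assume p: "p \<in> polynomial_functions n" "\<And>x. x \<in> points X \<Longrightarrow> p (\<chi> x) = 0"
  show "p (translate s x) = 0"
  proof (rule agree_generic[OF polynomial_global[OF p(1) translate_global] regular_const[OF points_open] _ assms])
    fix y assume y: "y \<in> generic s"
    then obtain t where "t \<noteq> 0" "translate s y = \<chi> (\<psi> t y)" using translate_generic by blast
    moreover have "y \<in> points X" using y by (simp add: generic_def)
    ultimately show "p (translate s y) = 0" using p(2) act_points by simp
  qed
qed

definition shift :: "'k \<Rightarrow> 'a \<Rightarrow> 'a" where
  "shift s x = (SOME y. y \<in> points X \<and> \<chi> y = translate s x)"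

lemma shift:
  assumes "x \<in> points X"
  shows "shift s x \<in> points X" "\<chi> (shift s x) = translate s x"
  using someI_ex[OF translate_point[OF assms, of s, unfolded Bex_def]] unfolding shift_def by blast+

lemma shift_generic:
  assumes "x \<in> generic s"
  shows "\<exists>t. t \<noteq> 0 \<and> u (\<psi> t x) = u x + s * f x \<and> shift s x = \<psi> t x"
proof -
  obtain t where t: "t \<noteq> 0" "u (\<psi> t x) = u x + s * f x" "translate s x = \<chi> (\<psi> t x)"
    using translate_generic[OF assms] by blast
  have x: "x \<in> points X" using assms by (simp add: generic_def)
  have "shift s x = \<psi> t x"
    using inj_onD[OF chart_inj, of "shift s x" "\<psi> t x"] shift[OF x, of s] act_points[OF t(1) x] t(3) by simp
  then show ?thesis using t by blast
qed

lemma shift_morphism: "morphism X X (shift s)"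
proof (rule morphism_from_fractions[OF fraction_functions_axioms])
  show "shift s x \<in> points X" if "x \<in> points X" for x by (rule shift(1)[OF that])
  fix b assume "b \<in> B"
  then obtain p where p: "p \<in> polynomial_functions n" "b = p \<circ> \<chi>" unfolding coordinate_ring_def by blast
  show "global (\<lambda>x. b (shift s x))"
    by (rule regular_cong[OF polynomial_global[OF p(1) translate_global[of _ s]]]) (simp_all add: p(2) shift)
qed

text \<open>
  At a generic point \<open>shift s\<close> is the action of a torus element, which preserves \<open>f\<close> and all \<open>e k m\<close> and
  sends \<open>u\<close> to \<open>u + s * f\<close>; the second translation brings \<open>u\<close> back.
\<close>

lemma shift_inverse:
  assumes x: "x \<in> points X"
  shows "shift (- s) (shift s x) = x"
proof (rule chart_eqI[OF shift(1)[OF shift(1)[OF x]] x])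
  fix k assume k: "k < n"
  show "\<chi> (shift (- s) (shift s x)) k = \<chi> x k"
  proof (rule agree_generic[OF _ coordinate_global[OF k] _ x])
    show "global (\<lambda>x. \<chi> (shift (- s) (shift s x)) k)"
      by (intro morphism_regular[OF shift_morphism] coordinate_global k)
    fix y assume y: "y \<in> generic s"
    then have nz: "y \<in> points X" "f y \<noteq> 0" by (auto simp: generic_def)
    obtain t where t: "t \<noteq> 0" "u (\<psi> t y) = u y + s * f y" "shift s y = \<psi> t y" using shift_generic[OF y] by blast
    note z = act_points[OF t(1) nz(1)]
    have inv: "f (\<psi> t y) = f y" "\<And>m. m \<le> M k \<Longrightarrow> e k m (\<psi> t y) = e k m y"
      using weightD(2)[OF f_weight t(1) nz(1)] weightD(2)[OF e_weight[OF k] t(1) nz(1)] by simp_all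
    have "f y * translate (- s) (\<psi> t y) k = (\<Sum>m\<le>M k. e k m y * u y ^ m)"
      using translate_fraction[OF k z, of "- s"] inv t(2) by simp
    also have "\<dots> = f y * \<chi> y k" by (rule coordinate_fraction[OF k nz(1), symmetric])
    finally show "\<chi> (shift (- s) (shift s y)) k = \<chi> y k" using nz(2) shift(2)[OF z] t(3) by simp
  qed
qed

lemma shift_isomorphism: "isomorphism X X (shift s)"
  unfolding isomorphism_def
proof (intro conjI exI[of _ "shift (- s)"] ballI shift_morphism)
  show "shift (- s) (shift s x) = x" "shift s (shift (- s) x) = x" if "x \<in> points X" for x
    using shift_inverse[OF that, of s] shift_inverse[OF that, of "- s"] by simp_all
qed

text \<open>
  Let \<open>y\<close> be the translated point, which has \<open>u = 0\<close>. Its coordinates are the values at 0 of the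
  polynomials that give the orbit of \<open>x\<close> in terms of \<open>t powi i\<close>. So the value at \<open>y\<close> of a function \<open>g\<close>
  that vanishes on \<open>D\<close> is the value at \<open>x\<close> of the invariant component of \<open>g\<close>, which is zero by
  \<open>invariant_on_D\<close>.
\<close>

lemma shift_into_divisor:
  assumes x: "x \<in> points X" "f x \<noteq> 0"
  shows "shift (- u x / f x) x \<in> D"
proof (rule ccontr)
  define s where "s = - u x / f x"
  define y where "y = shift s x"
  assume "shift (- u x / f x) x \<notin> D"
  then have yD: "y \<notin> D" by (simp add: y_def s_def)
  have y: "y \<in> points X" "\<chi> y = translate s x" using shift[OF x(1)] by (simp_all add: y_def)
  obtain g where g: "g \<in> B" "g y \<noteq> 0" "\<forall>z\<in>D. g z = 0" using closed_separate[OF D_closed y(1) yD] by blast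
  obtain p where p: "p \<in> polynomial_functions n" "g = p \<circ> \<chi>" using g(1) unfolding coordinate_ring_def by blast
  obtain N d where d: "\<forall>m. weight (int m * i) (d m)"
    "\<forall>t x. t \<noteq> 0 \<longrightarrow> x \<in> points X \<longrightarrow> g (\<psi> t x) = (\<Sum>m\<le>(N::nat). (t powi i) ^ m * d m x)"
    using expansion[OF B_global[OF g(1)]] by (elim exE conjE)
  have d0: "d 0 x = 0"
  proof (rule invariant_on_D[OF _ _ x(1)])
    show "weight 0 (d 0)" using d(1)[rule_format, of 0] by simp
    fix z assume z: "z \<in> D"
    have "0 = (\<Sum>m\<le>N. d m z)" using d(2)[rule_format, of 1 z] act_one g(3) z D_points[OF z] by simp
    also have "\<dots> = (\<Sum>m\<in>{0}. d m z)"
      using weight_on_D[OF d(1)[rule_format] _ z] i_nonzero by (intro sum.mono_neutral_right) auto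
    finally show "d 0 z = 0" by simp
  qed
  \<comment> \<open>The closure of the orbit of \<open>x\<close>, parametrized by \<open>\<tau> = t powi i\<close>; it passes through \<open>y\<close> at \<open>\<tau> = 0\<close>.\<close>
  define w where "w \<tau> k = (\<Sum>m\<le>M k. \<tau> ^ m * c k m x)" for \<tau> k
  have "\<exists>q. \<forall>\<tau>. p (w \<tau>) = poly q \<tau>"
    using p(1)
  proof induction
    case (const a)
    show ?case by (intro exI[of _ "[:a:]"]) simp
  next
    case (coord k)
    show ?case by (intro exI[of _ "\<Sum>m\<le>M k. monom (c k m x) m"]) (simp add: w_def poly_sum poly_monom mult.commute)
  next
    case (add p1 p2)
    then show ?case by (metis poly_add)
  next
    case (mult p1 p2)
    then show ?case by (metis poly_mult)
  qed
  then obtain q where q: "\<forall>\<tau>. p (w \<tau>) = poly q \<tau>" by blast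
  define r where "r = (\<Sum>m\<le>N. monom (d m x) m)"
  have "q = r"
  proof (rule poly_eq_of_cofinite[of "{0}"])
    fix \<tau> :: 'k assume "\<tau> \<notin> {0}"
    then obtain t where t: "t \<noteq> 0" "t powi i = \<tau>" using powi_root[OF i_nonzero, of \<tau>] by auto
    have "poly q \<tau> = p (\<chi> (\<psi> t x))"
      unfolding q[rule_format, symmetric]
      by (rule polynomial_functions_cong[OF p(1)]) (simp add: w_def expand[OF _ t(1) x(1)] t(2))
    also have "\<dots> = g (\<psi> t x)" by (simp add: p(2))
    also have "\<dots> = poly r \<tau>" using d(2)[rule_format, OF t(1) x(1)] t(2) by (simp add: r_def poly_sum poly_monom mult.commute)
    finally show "poly q \<tau> = poly r \<tau>" .
  qed simp
  then have "p (w 0) = poly r 0" using q by simp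
  also have "\<dots> = (\<Sum>m\<le>N. if m = 0 then d 0 x else 0)"
    by (simp add: r_def poly_sum poly_monom)
  also have "\<dots> = 0" using d0 by simp
  finally have pw: "p (w 0) = 0" .
  have "w 0 k = \<chi> y k" if k: "k < n" for k
  proof -
    have "u x + s * f x = 0" using x(2) by (simp add: s_def)
    then have "f x * \<chi> y k = (\<Sum>m\<le>M k. e k m x * 0 ^ m)" using translate_fraction[OF k x(1), of s] y(2) by simp
    also have "\<dots> = (\<Sum>m\<le>M k. if m = 0 then e k 0 x else 0)" by (intro sum.cong refl) simp
    also have "\<dots> = f x * c k 0 x" using fraction[OF k _ x(1), of 0] by simp
    also have "c k 0 x = (\<Sum>m\<le>M k. if m = 0 then c k 0 x else 0)" by simp
    also have "\<dots> = w 0 k" unfolding w_def by (intro sum.cong refl) simp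
    finally show ?thesis using x(2) by simp
  qed
  then have "p (w 0) = p (\<chi> y)" by (rule polynomial_functions_cong[OF p(1)])
  then show False using pw g(2) p(2) by simp
qed

end

theorem (in fixed_divisor) generic_points_move_into_divisor:
  "\<exists>W. openin (zariski X) W \<and> W \<noteq> {} \<and> (\<forall>x\<in>W. \<exists>\<alpha>. isomorphism X X \<alpha> \<and> \<alpha> x \<in> D)"
proof -
  obtain i u where iu: "weight i u" "uniformizer u" using homogeneous_uniformizer_exists by blast
  interpret H: homogeneous_uniformizer X n \<chi> \<psi> D i u by unfold_locales (fact iu)+
  obtain M c e f where "root_coordinates X n \<chi> \<psi> D i u M c e f" using H.root_coordinates_exist by blast
  then interpret R: root_coordinates X n \<chi> \<psi> D i u M c e f .
  have "openin (zariski X) {x\<in>points X. f x \<noteq> 0}" by (rule nonvanishing_open[OF R.f_global])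
  moreover have "{x\<in>points X. f x \<noteq> 0} \<noteq> {}" using R.f_off D_points unfolding off_D_def by blast
  moreover have "\<exists>\<alpha>. isomorphism X X \<alpha> \<and> \<alpha> x \<in> D" if "x \<in> {x\<in>points X. f x \<noteq> 0}" for x
    using R.shift_isomorphism R.shift_into_divisor that by blast
  ultimately show ?thesis by blast
qed

section \<open>Automorphism groups\<close>

lemma morphism_cong:
  assumes "function_sheaf X" "morphism X Y \<phi>" "\<And>x. x \<in> points X \<Longrightarrow> \<phi> x = \<phi>' x"
  shows "morphism X Y \<phi>'"
  unfolding morphism_def
proof (intro conjI allI impI)
  show "continuous_map (zariski X) (zariski Y) \<phi>'"
    by (rule continuous_map_eq[OF _ assms(3)]) (use assms(2) in \<open>simp add: morphism_def\<close>)
  fix V f assume f: "regular Y V f"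
  have eq: "{x\<in>points X. \<phi> x \<in> V} = {x\<in>points X. \<phi>' x \<in> V}" using assms(3) by auto
  have pb: "regular X {x\<in>points X. \<phi>' x \<in> V} (f \<circ> \<phi>)" using morphism_pullback[OF assms(2) f] unfolding eq .
  show "regular X {x\<in>points X. \<phi>' x \<in> V} (f \<circ> \<phi>')"
  proof (rule function_sheaf_glue[OF assms(1) function_sheaf_open[OF assms(1) pb]])
    fix x assume "x \<in> {x\<in>points X. \<phi>' x \<in> V}"
    then show "\<exists>W g. x \<in> W \<and> W \<subseteq> {x\<in>points X. \<phi>' x \<in> V} \<and> regular X W g \<and> (\<forall>y\<in>W. (f \<circ> \<phi>') y = g y)"
      using pb assms(3) by (intro exI[of _ "{x\<in>points X. \<phi>' x \<in> V}"] exI[of _ "f \<circ> \<phi>"] conjI) auto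
  qed
qed

lemma isomorphism_cong:
  assumes "function_sheaf X" "isomorphism X X \<phi>" "\<And>x. x \<in> points X \<Longrightarrow> \<phi> x = \<phi>' x"
  shows "isomorphism X X \<phi>'"
proof -
  obtain \<theta> where \<theta>: "morphism X X \<phi>" "morphism X X \<theta>" "\<forall>x\<in>points X. \<theta> (\<phi> x) = x" "\<forall>y\<in>points X. \<phi> (\<theta> y) = y"
    using assms(2) unfolding isomorphism_def by (elim exE conjE)
  have "\<forall>y\<in>points X. \<phi>' (\<theta> y) = y" using \<theta>(4) assms(3) morphism_points[OF \<theta>(2)] by metis
  moreover have "\<forall>x\<in>points X. \<theta> (\<phi>' x) = x" using \<theta>(3) assms(3) by simp
  ultimately show ?thesis
    unfolding isomorphism_def using morphism_cong[OF assms(1) \<theta>(1) assms(3)] \<theta>(2) by blast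
qed

lemma isomorphism_comp:
  assumes "isomorphism X X \<phi>" "isomorphism X X \<theta>"
  shows "isomorphism X X (\<phi> \<circ> \<theta>)"
proof -
  obtain \<phi>' where 1: "morphism X X \<phi>" "morphism X X \<phi>'" "\<forall>x\<in>points X. \<phi>' (\<phi> x) = x" "\<forall>y\<in>points X. \<phi> (\<phi>' y) = y"
    using assms(1) unfolding isomorphism_def by (elim exE conjE)
  obtain \<theta>' where 2: "morphism X X \<theta>" "morphism X X \<theta>'" "\<forall>x\<in>points X. \<theta>' (\<theta> x) = x" "\<forall>y\<in>points X. \<theta> (\<theta>' y) = y"
    using assms(2) unfolding isomorphism_def by (elim exE conjE)
  show ?thesis
    unfolding isomorphism_def
    using 1(3,4) 2(3,4) morphism_points[OF 2(1)] morphism_points[OF 1(2)]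
    by (intro conjI exI[of _ "\<theta>' \<circ> \<phi>'"] morphism_comp[OF 2(1) 1(1)] morphism_comp[OF 1(2) 2(2)]) simp_all
qed

lemma isomorphism_bij: "isomorphism X X \<phi> \<Longrightarrow> bij_betw \<phi> (points X) (points X)"
  unfolding isomorphism_def
  by (elim exE conjE, rule bij_betw_byWitness) (auto dest: morphism_points)

lemma automorphism_carrier:
  "carrier (automorphism_group X) = {\<phi>. \<phi> \<in> extensional (points X) \<and> isomorphism X X \<phi>}"
  using isomorphism_bij by (auto simp: automorphism_group_def Bij_def)

lemma isomorphism_restrict:
  assumes "function_sheaf X" "isomorphism X X \<phi>"
  shows "restrict \<phi> (points X) \<in> carrier (automorphism_group X)"
  unfolding automorphism_carrier using isomorphism_cong[OF assms] by simp

lemma morphism_id: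
  assumes "function_sheaf X"
  shows "morphism X X (\<lambda>x. x)"
  unfolding morphism_def
proof (intro conjI allI impI)
  fix V f assume f: "regular X V f"
  have "{x\<in>points X. x \<in> V} = V" using openin_subset[OF function_sheaf_open[OF assms f]] by auto
  then show "regular X {x\<in>points X. x \<in> V} (f \<circ> (\<lambda>x. x))" using f by (simp add: comp_def)
qed simp

lemma automorphism_group_action:
  assumes "function_sheaf X"
  shows "group_action (automorphism_group X) (points X) (\<lambda>\<phi>. \<phi>)"
proof -
  let ?S = "points X"
  let ?H = "{\<phi> \<in> Bij ?S. isomorphism X X \<phi>}"
  have "subgroup ?H (BijGroup ?S)"
  proof (rule group.subgroupI[OF group_BijGroup])
    show "?H \<subseteq> carrier (BijGroup ?S)" by (auto simp: BijGroup_def)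
    have "isomorphism X X (\<lambda>x. x)" unfolding isomorphism_def using morphism_id[OF assms] by blast
    then have "isomorphism X X (\<lambda>x\<in>?S. x)" by (rule isomorphism_cong[OF assms]) simp
    then show "?H \<noteq> {}" using id_Bij by blast
    fix \<phi> assume \<phi>: "\<phi> \<in> ?H"
    then obtain \<theta> where \<theta>: "morphism X X \<phi>" "morphism X X \<theta>" "\<forall>x\<in>?S. \<theta> (\<phi> x) = x" "\<forall>y\<in>?S. \<phi> (\<theta> y) = y"
      unfolding isomorphism_def by blast
    have "isomorphism X X \<theta>" unfolding isomorphism_def using \<theta> by blast
    moreover have "\<theta> x = (\<lambda>x\<in>?S. inv_into ?S \<phi> x) x" if x: "x \<in> ?S" for x
    proof -
      have "inj_on \<phi> ?S" using \<phi> by (simp add: Bij_def bij_betw_def)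
      then have "inv_into ?S \<phi> (\<phi> (\<theta> x)) = \<theta> x" using morphism_points[OF \<theta>(2) x] by (rule inv_into_f_f)
      then show ?thesis using \<theta>(4) x by simp
    qed
    ultimately have inv: "isomorphism X X (\<lambda>x\<in>?S. inv_into ?S \<phi> x)" by (rule isomorphism_cong[OF assms])
    have bij: "\<phi> \<in> Bij ?S" using \<phi> by blast
    show "inv\<^bsub>BijGroup ?S\<^esub> \<phi> \<in> ?H"
      unfolding inv_BijGroup[OF bij] using restrict_inv_into_Bij[OF bij] inv by blast
  next
    fix \<phi> \<theta> assume h: "\<phi> \<in> ?H" "\<theta> \<in> ?H"
    then have "isomorphism X X (\<phi> \<circ> \<theta>)" by (intro isomorphism_comp) auto
    then have "isomorphism X X (compose ?S \<phi> \<theta>)" by (rule isomorphism_cong[OF assms]) (simp add: compose_def)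
    then show "\<phi> \<otimes>\<^bsub>BijGroup ?S\<^esub> \<theta> \<in> ?H" using h compose_Bij[of \<phi> ?S \<theta>]
      by (simp add: BijGroup_def)
  qed
  from group.canonical_inj_is_hom[OF group_BijGroup this]
  show ?thesis unfolding group_action_def automorphism_group_def id_def .
qed

text \<open>
  Constants are regular near each point of a variety, because they are so on affine pieces.
\<close>

lemma variety_regular_one:
  assumes "variety S" "g \<in> points S"
  shows "\<exists>U. g \<in> U \<and> openin (zariski S) U \<and> regular S U (\<lambda>_. 1)"
proof -
  obtain \<U> where U: "\<Union>\<U> = points S" "\<forall>U\<in>\<U>. openin (zariski S) U \<and> affine_variety (open_subspace S U)"
    using assms(1) unfolding variety_def by (elim exE conjE)
  then obtain U where g: "g \<in> U" "openin (zariski S) U" "affine_variety (open_subspace S U)" using assms(2) by blast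
  obtain n P \<phi> where iso: "isomorphism (open_subspace S U) (affine_set_space n P) \<phi>"
    using g(3) unfolding affine_variety_def by (elim exE conjE)
  let ?Y = "affine_set_space n P"
  have "fraction_functions ?Y (polynomial_functions n)"
    unfolding affine_set_space_def by (rule fraction_space_single[OF polynomial_functions_ring_set polynomial_functions.const])
  then have "regular ?Y (points ?Y) (\<lambda>_. 1)" by (rule fraction_functions.regular_const) simp
  moreover have "morphism (open_subspace S U) ?Y \<phi>" using iso unfolding isomorphism_def by (elim conjE)
  ultimately have "regular (open_subspace S U) (points (open_subspace S U)) (\<lambda>_. 1)" using morphism_regular by fastforce
  moreover have "points (open_subspace S U) = U" using openin_subset[OF g(2)] by (auto simp: open_subspace_def)
  ultimately have "regular S U (\<lambda>_. 1)" by (simp add: open_subspace_def)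
  then show ?thesis using g by blast
qed

lemma (in fraction_functions) action_isomorphism:
  assumes G: "algebraic_group G S" and act: "regular_action G S X \<phi>" and g: "g \<in> carrier G"
  shows "isomorphism X X (\<phi> g)"
proof -
  have ga: "group_action G (points X) \<phi>" and mor: "morphism (product_space S X) X (\<lambda>(g, x). \<phi> g x)"
    using act unfolding regular_action_def by blast+
  have grp: "group G" and S: "variety S" "points S = carrier G" using G unfolding algebraic_group_def by blast+
  have m: "morphism X X (\<phi> h)" if "h \<in> carrier G" for h
  proof -
    obtain U where "h \<in> U" "openin (zariski S) U" "regular S U (\<lambda>_. 1)" using variety_regular_one[OF S(1)] S(2) \<open>h \<in> carrier G\<close> by blast
    from morphism_comp[OF slice_right[OF this] mor] show ?thesis by (simp add: comp_def)
  qed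
  have i: "inv\<^bsub>G\<^esub> g \<in> carrier G" using group.inv_closed[OF grp g] .
  show ?thesis
    unfolding isomorphism_def
  proof (intro conjI exI[of _ "\<phi> (inv\<^bsub>G\<^esub> g)"] ballI m g i)
    fix x assume x: "x \<in> points X"
    have one: "\<phi> \<one>\<^bsub>G\<^esub> x = x" using fun_cong[OF group_action.id_eq_one[OF ga], of x] x by simp
    show "\<phi> (inv\<^bsub>G\<^esub> g) (\<phi> g x) = x"
      using group_action.composition_rule[OF ga x i g] one group.l_inv[OF grp g] by simp
    show "\<phi> g (\<phi> (inv\<^bsub>G\<^esub> g) x) = x"
      using group_action.composition_rule[OF ga x g i] one group.r_inv[OF grp g] by simp
  qed
qed

section \<open>The open orbit of the automorphism group\<close>

theorem corollary1:
  fixes X :: "('a, 'k::{alg_closed_field, field_char_0}) fun_space"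
    and D :: "'a set"
    and \<psi> :: "'k \<Rightarrow> 'a \<Rightarrow> 'a"
  assumes "affine_variety X" and "irreducible_space X" and "normal_space X"
    and "almost_homogeneous TYPE('g) X"
    and "prime_divisor X D"
    and "regular_action Gm_group Gm_space X \<psi>"
    and "\<exists>t\<in>carrier Gm_group. \<exists>x\<in>points X. \<psi> t x \<noteq> x"
    and "\<forall>t\<in>carrier Gm_group. \<forall>x\<in>D. \<psi> t x = x"
  shows "group_action (automorphism_group X) (points X) (\<lambda>\<phi>. \<phi>) \<and>
    (\<exists>\<Omega>\<in>orbits (automorphism_group X) (points X) (\<lambda>\<phi>. \<phi>).
       openin (zariski X) \<Omega> \<and> \<Omega> \<inter> D \<noteq> {})"
proof -
  obtain n \<chi> where "affine_chart X n \<chi>" using affine_variety_chart[OF assms(1,2)] by blast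
  then interpret affine_chart X n \<chi> .
  interpret F: fixed_divisor X n \<chi> \<psi> D
    by unfold_locales (use assms(3,5-8) in \<open>auto simp: Gm_group_def\<close>)
  obtain W where W: "openin (zariski X) W" "W \<noteq> {}" "\<forall>x\<in>W. \<exists>\<alpha>. isomorphism X X \<alpha> \<and> \<alpha> x \<in> D"
    using F.generic_points_move_into_divisor by (elim exE conjE)
  obtain G :: "'g monoid" and S \<phi> where G: "algebraic_group G S" "regular_action G S X \<phi>" "has_open_orbit G X \<phi>"
    using assms(4) unfolding almost_homogeneous_def by (elim exE conjE)
  obtain x0 where x0: "x0 \<in> points X" "openin (zariski X) (orbit G \<phi> x0)"
    using G(3) unfolding has_open_orbit_def orbits_def by blast
  have ga: "group_action G (points X) \<phi>" using G(2) unfolding regular_action_def by blast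
  have "x0 \<in> orbit G \<phi> x0"
  proof -
    interpret group_action G "points X" \<phi> by (rule ga)
    show ?thesis using orbit_refl[OF x0(1)] by simp
  qed
  let ?A = "automorphism_group X"
  define \<Omega> where "\<Omega> = orbit ?A (\<lambda>\<phi>. \<phi>) x0"
  have in_\<Omega>: "\<alpha> x0 \<in> \<Omega>" if "isomorphism X X \<alpha>" for \<alpha>
  proof -
    have "restrict \<alpha> (points X) \<in> carrier ?A" by (rule isomorphism_restrict[OF sheaf that])
    then have "restrict \<alpha> (points X) x0 \<in> \<Omega>" unfolding \<Omega>_def orbit_def by blast
    then show ?thesis using x0(1) by simp
  qed
  have move: "\<alpha> y \<in> \<Omega>" if "isomorphism X X \<alpha>" and y: "y \<in> orbit G \<phi> x0" for \<alpha> y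
  proof -
    obtain g where g: "g \<in> carrier G" "y = \<phi> g x0" using y unfolding orbit_def by blast
    show ?thesis
      using in_\<Omega>[OF isomorphism_comp[OF that(1) action_isomorphism[OF G(1,2) g(1)]]] g(2) by simp
  qed
  have "openin (zariski X) \<Omega>"
  proof (subst openin_subopen, intro ballI)
    fix y assume "y \<in> \<Omega>"
    then obtain \<alpha> where \<alpha>: "isomorphism X X \<alpha>" "y = \<alpha> x0"
      unfolding \<Omega>_def orbit_def automorphism_carrier by blast
    obtain \<beta> where \<beta>: "morphism X X \<alpha>" "morphism X X \<beta>" "\<forall>x\<in>points X. \<beta> (\<alpha> x) = x" "\<forall>y\<in>points X. \<alpha> (\<beta> y) = y"
      using \<alpha>(1) unfolding isomorphism_def by (elim exE conjE)
    let ?T = "{z\<in>points X. \<beta> z \<in> orbit G \<phi> x0}"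
    have "openin (zariski X) ?T" using \<beta>(2) x0(2) unfolding morphism_def continuous_map_def by blast
    moreover have "y \<in> ?T" using \<alpha>(2) \<beta>(3) x0(1) morphism_points[OF \<beta>(1)] \<open>x0 \<in> orbit G \<phi> x0\<close> by auto
    moreover have "?T \<subseteq> \<Omega>"
    proof
      fix z assume z: "z \<in> ?T"
      then have "\<alpha> (\<beta> z) \<in> \<Omega>" by (intro move[OF \<alpha>(1)]) blast
      then show "z \<in> \<Omega>" using \<beta>(4) z by simp
    qed
    ultimately show "\<exists>T. openin (zariski X) T \<and> y \<in> T \<and> T \<subseteq> \<Omega>" by (intro exI conjI)
  qed
  moreover have "\<Omega> \<inter> D \<noteq> {}"
  proof -
    have "\<exists>x\<in>W. x \<in> orbit G \<phi> x0"
    proof (rule ccontr)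
      assume "\<not> ?thesis"
      then have "points X \<subseteq> (points X - W) \<union> (points X - orbit G \<phi> x0)" by blast
      moreover have "closedin (zariski X) (points X - W)" "closedin (zariski X) (points X - orbit G \<phi> x0)"
        using W(1) x0(2) by (simp_all add: closedin_diff)
      ultimately have "points X \<subseteq> points X - W \<or> points X \<subseteq> points X - orbit G \<phi> x0"
        using irreducible unfolding irreducible_in_def by blast
      then show False
        using W(2) open_subset_points[OF W(1)] x0(1) \<open>x0 \<in> orbit G \<phi> x0\<close> by blast
    qed
    then obtain x \<alpha> where "x \<in> orbit G \<phi> x0" "isomorphism X X \<alpha>" "\<alpha> x \<in> D" using W(3) by blast
    then show ?thesis using move by blast
  qed
  moreover have "\<Omega> \<in> orbits ?A (points X) (\<lambda>\<phi>. \<phi>)" unfolding \<Omega>_def orbits_def using x0(1) by blast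
  ultimately show ?thesis using automorphism_group_action[OF sheaf] by blast
qed

end
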